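(* Let $V$ be a finite graph, each vertex of which has valence at least three, and $T$ a subtree of $V$ with two edges and root vertex $v_T$. Let $\mathcal{F}$ be the frontier of $T$ in $V$ and fix $\mathbf{d}_{\mathcal{F}}\in(\mathbb{R}^+)^{\mathcal{F}}$ with $\mathrm{Ad}(\mathbf{d}_{\mathcal{F}})\neq\emptyset$. For $R\geq 0$, $D_R(T,\mathbf{d})$ attains a minimum (over $\mathbf d_{\mathcal E}\in\overline{\mathrm{Ad}}(\mathbf d_{\mathcal F})$) at $\mathbf{d} = (\mathbf{d}_{\mathcal{E}},\mathbf{d}_{\mathcal{F}})$ satisfying one of: (1) $P_{v}(\mathbf{d})\in\widetilde{\mathcal{BC}}_{n_v}$ for each $v\in T^{(0)}-\{v_T\}$, where $v$ has valence $n_v$ in $V$; or (2) $P_{v_T}(\mathbf{d}) \in\widetilde{\mathcal{BC}}_{n_T}$, where $v_T$ has valence $n_T$ in $V$; or (3) $J(P_{v}(\mathbf{d})) = J(P_{v_T}(\mathbf{d}))$ for each $v\in T^{(0)}-\{v_T\}$.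
   Context: Cyclic polygons. A compact convex polygon in $\mathbb{H}^2$ is cyclic if its vertices are equidistant from a point (its center); the common distance is its radius. For $n\ge3$ let $\widetilde{\mathcal{AC}}_n=\{(d_0,\dots,d_{n-1})\in(\mathbb{R}^+)^n : \sinh(d_i/2)<\sum_{j\ne i}\sinh(d_j/2)\ \forall i\}$; its elements are exactly the cyclically ordered side length collections of cyclic $n$-gons, each unique up to isometry. $J(\mathbf d)$ denotes the radius of the polygon represented by $\mathbf d$. For $J\ge d/2>0$ let $A_d(J)\in(0,\pi]$ be given by $\sinh J\,\sin(A_d(J)/2)=\sinh(d/2)$. $\widetilde{\mathcal C}_n$ is the set of $\mathbf d\in(\mathbb{R}^+)^n$ with $\sum_{j}A_{d_j}(d_i/2)>2\pi$ where $d_i$ is a maximal entry; equivalently, the elements of $\widetilde{\mathcal{AC}}_n$ whose polygon has its center in its interior. $\widetilde{\mathcal{BC}}_n$ is the set with $\sum_{j}A_{d_j}(d_i/2)=2\pi$; equivalently, the elements of $\widetilde{\mathcal{AC}}_n$ whose polygon has its center at the midpoint of its longest side. For $R\ge0$ and $\mathbf d\in\widetilde{\mathcal{AC}}_n$, $D_R(\mathbf d)=(n-2)\pi-\cosh R\sum_i\alpha_i$, where $\alpha_i$ are the interior angles of the cyclic polygon represented by $\mathbf d$. Trees. Let $T\subset V$ be finite graphs, $T$ a rooted tree with root $v_T$; at each vertex of $V$ a cyclic order on the edges of $V$ containing it is fixed. $\mathcal E$ is the edge set of $T$. The frontier $\mathcal F$ of $T$ is the set of pairs $(e,v)$ with $e$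 an edge of $V$ not in $T$ and $v\in e\cap T$; "$e\in\mathcal F$" means $(e,v)\in\mathcal F$ for some $v$. For $v\in T^{(0)}-\{v_T\}$, $e_v$ is the first edge of the path in $T$ from $v$ to $v_T$. For $v\in T^{(0)}$ let $v-1$ be the set of $w\in T^{(0)}-\{v_T\}$ such that $v$ is the endpoint of $e_w$ other than $w$. Given $\mathbf d_{\mathcal F}=(d_e\,|\,e\in\mathcal F)$ with $d_e>0$ and $\mathbf d_{\mathcal E}=(d_e\,|\,e\in\mathcal E)$, put $\mathbf d=(\mathbf d_{\mathcal E},\mathbf d_{\mathcal F})$ and $P_v(\mathbf d)=(d_{e_0},\dots,d_{e_{n-1}})$, where $e_0,\dots,e_{n-1}$ are the cyclically ordered edges of $V$ at $v$. $\mathrm{Ad}(\mathbf d_{\mathcal F})$ is the set of $\mathbf d_{\mathcal E}\in\mathbb{R}^{\mathcal E}$ such that: (i) for $v\in T^{(0)}-\{v_T\}$ of valence $n_v$ in $V$, $P_v(\mathbf d)\in\widetilde{\mathcal{AC}}_{n_v}-\widetilde{\mathcal C}_{n_v}$ has largest entry $d_{e_v}$; (ii) $P_{v_T}(\mathbf d)\in\widetilde{\mathcal C}_{n_T}$; (iii) $J(P_v(\mathbf d))>J(P_w(\mathbf d))$ for each $v\in T^{(0)}$ and $w\in v-1$. $\overline{\mathrm{Ad}}(\mathbf d_{\mathcal F})$ is its closure in $\mathbb{R}^{\mathcal E}$. For $\mathbf d_{\mathcal E}\in\overline{\mathrm{Ad}}(\mathbf d_{\mathcal F})$, $D_R(T,\mathbf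 d)=\sum_{v\in T^{(0)}}D_R(P_v(\mathbf d))$. *)

theory Defs
  imports "HOL-Analysis.Analysis" "HOL-Library.Multiset"
begin

section \<open>Cyclic polygons in the hyperbolic plane\<close>

text \<open>The hyperbolic plane is realised as the upper sheet of the hyperboloid in Minkowski space
  of signature (2,1).\<close>

definition lorentz :: "real^3 \<Rightarrow> real^3 \<Rightarrow> real" where
  "lorentz x y = x$1 * y$1 + x$2 * y$2 - x$3 * y$3"

definition hyp_plane :: "(real^3) set" where
  "hyp_plane = {x. lorentz x x = -1 \<and> x$3 > 0}"

definition hdist :: "real^3 \<Rightarrow> real^3 \<Rightarrow> real" where
  "hdist x y = arcosh (- lorentz x y)"

text \<open>The vector tangent to the hyperboloid at \<open>p\<close> in the direction of the geodesic from \<open>p\<close> to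
  \<open>q\<close>, that is, the Lorentz-orthogonal projection of \<open>q\<close> to the tangent plane at \<open>p\<close>.\<close>

definition hdirection :: "real^3 \<Rightarrow> real^3 \<Rightarrow> real^3" where
  "hdirection p q = q + lorentz p q *\<^sub>R p"

definition hangle :: "real^3 \<Rightarrow> real^3 \<Rightarrow> real^3 \<Rightarrow> real" where
  "hangle q p r =
     (let u = hdirection p q; v = hdirection p r
      in arccos (lorentz u v / (sqrt (lorentz u u) * sqrt (lorentz v v))))"

text \<open>Geodesics are the intersections of the hyperboloid with planes through the origin, so the
  sign of \<open>line_side x y z\<close> tells on which side of the geodesic through \<open>x\<close> and \<open>y\<close> the point \<open>z\<close>
  lies.\<close>

definition line_side :: "real^3 \<Rightarrow> real^3 \<Rightarrow> real^3 \<Rightarrow> real" where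
  "line_side x y z = det (vector [x, y, z] :: real^3^3)"

text \<open>The list \<open>xs\<close> enumerates, in cyclic order (of either orientation), the vertices of a compact
  convex polygon: the geodesic through two consecutive vertices has all the other vertices
  strictly on one side.\<close>

definition convex_polygon :: "(real^3) list \<Rightarrow> bool" where
  "convex_polygon xs \<longleftrightarrow>
     (let n = length xs in
      3 \<le> n \<and> set xs \<subseteq> hyp_plane \<and>
      (\<forall>i<n. \<forall>j<n. \<forall>k<n. j \<notin> {i, Suc i mod n} \<longrightarrow> k \<notin> {i, Suc i mod n} \<longrightarrow>
         line_side (xs!i) (xs!(Suc i mod n)) (xs!j) *
         line_side (xs!i) (xs!(Suc i mod n)) (xs!k) > 0))"

definition centered_at :: "(real^3) list \<Rightarrow> real^3 \<Rightarrow> real \<Rightarrow> bool" where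
  "centered_at xs c r \<longleftrightarrow> c \<in> hyp_plane \<and> (\<forall>x\<in>set xs. hdist c x = r)"

definition cyclic_polygon :: "(real^3) list \<Rightarrow> bool" where
  "cyclic_polygon xs \<longleftrightarrow> convex_polygon xs \<and> (\<exists>c r. centered_at xs c r)"

definition polygon_radius :: "(real^3) list \<Rightarrow> real" where
  "polygon_radius xs = (THE r. \<exists>c. centered_at xs c r)"

definition side_lengths :: "(real^3) list \<Rightarrow> real list" where
  "side_lengths xs =
     map (\<lambda>i. hdist (xs!i) (xs!(Suc i mod length xs))) [0..<length xs]"

definition interior_angle :: "(real^3) list \<Rightarrow> nat \<Rightarrow> real" where
  "interior_angle xs i =
     (let n = length xs in hangle (xs!((i + n - 1) mod n)) (xs!i) (xs!(Suc i mod n)))"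

text \<open>A tuple of \<open>n\<close> side lengths is a list of length \<open>n\<close>. The cyclic polygon with given side
  lengths is unique only up to isometry; \<open>represented_polygon\<close> chooses one.\<close>

definition represented_polygon :: "real list \<Rightarrow> (real^3) list" where
  "represented_polygon ds = (SOME xs. cyclic_polygon xs \<and> side_lengths xs = ds)"

definition cyc_radius :: "real list \<Rightarrow> real" where
  "cyc_radius ds = polygon_radius (represented_polygon ds)"

definition D_poly :: "real \<Rightarrow> real list \<Rightarrow> real" where
  "D_poly R ds = (real (length ds) - 2) * pi
     - cosh R * (\<Sum>i<length ds. interior_angle (represented_polygon ds) i)"

text \<open>The side lengths of cyclic polygons: the inequalities say that some circle, rather than a
  horocycle or an equidistant curve, carries the vertices.\<close>

definition AC_tilde :: "nat \<Rightarrow> real list set" where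
  "AC_tilde n = {ds. length ds = n \<and> (\<forall>x\<in>set ds. 0 < x) \<and>
     (\<forall>i<n. sinh (ds!i / 2) < (\<Sum>j\<in>{..<n} - {i}. sinh (ds!j / 2)))}"

text \<open>The angle subtended at the center by a chord of length \<open>d\<close> of a circle of radius \<open>r\<close>;
  meaningful for \<open>r \<ge> d/2 > 0\<close>.\<close>

definition central_angle :: "real \<Rightarrow> real \<Rightarrow> real" where
  "central_angle d r = (THE a. 0 < a \<and> a \<le> pi \<and> sinh r * sin (a / 2) = sinh (d / 2))"

lemma central_angle_eq_arcsin:
  assumes "0 < d" "d / 2 \<le> r"
  shows "central_angle d r = 2 * arcsin (sinh (d / 2) / sinh r)"
proof -
  define q where "q = sinh (d / 2) / sinh r"
  have r: "0 < sinh r" and q: "0 < q" "q \<le> 1"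
    using assms by (auto simp: q_def)
  have pos: "0 < arcsin q"
    using q arcsin_less_arcsin[of 0 q] by simp
  show ?thesis
    unfolding central_angle_def q_def[symmetric]
  proof (rule the_equality)
    show "0 < 2 * arcsin q \<and> 2 * arcsin q \<le> pi \<and> sinh r * sin (2 * arcsin q / 2) = sinh (d / 2)"
      using pos q r arcsin_ubound[of q] by (simp add: q_def)
  next
    fix a assume a: "0 < a \<and> a \<le> pi \<and> sinh r * sin (a / 2) = sinh (d / 2)"
    then have "q = sin (a / 2)"
      using r by (simp add: q_def field_simps)
    with a show "a = 2 * arcsin q"
      by (simp add: arcsin_sin)
  qed
qed

text \<open>In a circle having the longest side as diameter, the total angle subtended by the sides
  exceeds \<open>2 * pi\<close> iff the polygon has its center in its interior, and equals \<open>2 * pi\<close> iff the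
  center is the midpoint of the longest side.\<close>

definition C_tilde :: "nat \<Rightarrow> real list set" where
  "C_tilde n = {ds. length ds = n \<and> (\<forall>x\<in>set ds. 0 < x) \<and>
     (\<Sum>j<n. central_angle (ds!j) (Max (set ds) / 2)) > 2 * pi}"

definition BC_tilde :: "nat \<Rightarrow> real list set" where
  "BC_tilde n = {ds. length ds = n \<and> (\<forall>x\<in>set ds. 0 < x) \<and>
     (\<Sum>j<n. central_angle (ds!j) (Max (set ds) / 2)) = 2 * pi}"

section \<open>Graphs and rooted trees\<close>

text \<open>Loops and multiple edges are allowed; \<open>ends G e\<close> is the multiset of the two endpoints of
  the edge \<open>e\<close>.\<close>

record ('v, 'e) graph =
  verts :: "'v set"
  edges :: "'e set"
  ends :: "'e \<Rightarrow> 'v multiset"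

definition finite_graph :: "('v, 'e) graph \<Rightarrow> bool" where
  "finite_graph G \<longleftrightarrow> finite (verts G) \<and> finite (edges G) \<and>
     (\<forall>e\<in>edges G. size (ends G e) = 2 \<and> set_mset (ends G e) \<subseteq> verts G)"

definition valence :: "('v, 'e) graph \<Rightarrow> 'v \<Rightarrow> nat" where
  "valence G v = (\<Sum>e\<in>edges G. count (ends G e) v)"

text \<open>The cyclic order at \<open>v\<close> is given by a list, to be read up to rotation, in which a loop at
  \<open>v\<close> occurs twice.\<close>

definition cyclic_orders :: "('v, 'e) graph \<Rightarrow> ('v \<Rightarrow> 'e list) \<Rightarrow> bool" where
  "cyclic_orders G cyc \<longleftrightarrow> (\<forall>v\<in>verts G. set (cyc v) \<subseteq> edges G \<and>
     (\<forall>e\<in>edges G. count (mset (cyc v)) e = count (ends G e) v))"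

definition subgraph :: "('v, 'e) graph \<Rightarrow> ('v, 'e) graph \<Rightarrow> bool" where
  "subgraph T G \<longleftrightarrow> finite_graph T \<and> verts T \<subseteq> verts G \<and> edges T \<subseteq> edges G \<and>
     (\<forall>e\<in>edges T. ends T e = ends G e)"

fun walk :: "('v, 'e) graph \<Rightarrow> 'v \<Rightarrow> 'e list \<Rightarrow> 'v \<Rightarrow> bool" where
  "walk G u [] w \<longleftrightarrow> u \<in> verts G \<and> u = w"
| "walk G u (e # p) w \<longleftrightarrow> e \<in> edges G \<and> (\<exists>x. ends G e = {#u, x#} \<and> walk G x p w)"

text \<open>A graph has a cycle iff it has a nonempty closed walk without repeated edges.\<close>

definition tree :: "('v, 'e) graph \<Rightarrow> bool" where
  "tree T \<longleftrightarrow> verts T \<noteq> {} \<and>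
     (\<forall>u\<in>verts T. \<forall>w\<in>verts T. \<exists>p. walk T u p w) \<and>
     \<not> (\<exists>u p. p \<noteq> [] \<and> distinct p \<and> walk T u p u)"

text \<open>In a tree, the path between two vertices is the unique walk without repeated edges.\<close>

definition tree_path :: "('v, 'e) graph \<Rightarrow> 'v \<Rightarrow> 'v \<Rightarrow> 'e list" where
  "tree_path T u w = (THE p. walk T u p w \<and> distinct p)"

definition first_edge :: "('v, 'e) graph \<Rightarrow> 'v \<Rightarrow> 'v \<Rightarrow> 'e" where
  "first_edge T vT v = hd (tree_path T v vT)"

definition children :: "('v, 'e) graph \<Rightarrow> 'v \<Rightarrow> 'v \<Rightarrow> 'v set" where
  "children T vT v = {w \<in> verts T - {vT}. ends T (first_edge T vT w) = {#w, v#}}"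

definition tree_frontier :: "('v, 'e) graph \<Rightarrow> ('v, 'e) graph \<Rightarrow> ('e \<times> 'v) set" where
  "tree_frontier V T = {(e, v). e \<in> edges V - edges T \<and> v \<in># ends V e \<and> v \<in> verts T}"

section \<open>Admissible spaces\<close>

definition P_tuple :: "('v \<Rightarrow> 'e list) \<Rightarrow> ('e \<Rightarrow> real) \<Rightarrow> 'v \<Rightarrow> real list" where
  "P_tuple cyc d v = map d (cyc v)"

text \<open>The tuple \<open>d\<close> combining the edge parameters \<open>dE\<close> with the frontier parameters \<open>dF\<close>.\<close>

definition combine :: "('v, 'e) graph \<Rightarrow> ('e \<Rightarrow> real) \<Rightarrow> ('e \<Rightarrow> real) \<Rightarrow> 'e \<Rightarrow> real" where
  "combine T dE dF = override_on dF dE (edges T)"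

text \<open>Elements of the space of real tuples indexed by the edges of \<open>T\<close> are functions that are
  \<open>undefined\<close> off the edges of \<open>T\<close>, as for \<open>powertop_real\<close>.\<close>

definition Ad ::
  "('v, 'e) graph \<Rightarrow> ('v, 'e) graph \<Rightarrow> 'v \<Rightarrow> ('v \<Rightarrow> 'e list) \<Rightarrow> ('e \<Rightarrow> real) \<Rightarrow> ('e \<Rightarrow> real) set"
  where
  "Ad V T vT cyc dF = {dE \<in> edges T \<rightarrow>\<^sub>E UNIV. let d = combine T dE dF in
     (\<forall>v\<in>verts T - {vT}.
        P_tuple cyc d v \<in> AC_tilde (valence V v) - C_tilde (valence V v) \<and>
        Max (set (P_tuple cyc d v)) = d (first_edge T vT v)) \<and>
     P_tuple cyc d vT \<in> C_tilde (valence V vT) \<and>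
     (\<forall>v\<in>verts T. \<forall>w\<in>children T vT v.
        cyc_radius (P_tuple cyc d v) > cyc_radius (P_tuple cyc d w))}"

definition Ad_closure ::
  "('v, 'e) graph \<Rightarrow> ('v, 'e) graph \<Rightarrow> 'v \<Rightarrow> ('v \<Rightarrow> 'e list) \<Rightarrow> ('e \<Rightarrow> real) \<Rightarrow> ('e \<Rightarrow> real) set"
  where
  "Ad_closure V T vT cyc dF = powertop_real (edges T) closure_of Ad V T vT cyc dF"

definition D_tree ::
  "real \<Rightarrow> ('v, 'e) graph \<Rightarrow> ('v \<Rightarrow> 'e list) \<Rightarrow> ('e \<Rightarrow> real) \<Rightarrow> real" where
  "D_tree R T cyc d = (\<Sum>v\<in>verts T. D_poly R (P_tuple cyc d v))"

end

theory Submission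
  imports Defs
begin

text \<open>Since \<open>D_poly R\<close> is an affine function of the sum of the interior angles with slope
  \<open>- cosh R\<close>, it suffices to maximise the sum of all interior angles. An isosceles triangle with
  base \<open>d\<close> and legs \<open>r\<close> has apex angle \<open>2 \<alpha>\<close> and base angles \<open>\<beta>\<close> with
  \<open>\<partial>\<beta>/\<partial>r = - (\<partial>\<alpha>/\<partial>r) / cosh r\<close>. Hence \<open>E d r = 2 \<beta> + 2 \<alpha> / cosh r\<close> satisfies
  \<open>\<partial>E/\<partial>r = - 2 \<alpha> sinh r / (cosh r)\<^sup>2\<close>, and the radius of a polygon is a critical point of a sum of
  such terms: a minimum if the center lies inside, a maximum (with the term of the longest side
  negated) if it does not.

  Comparing the values of these functions at the radii before and after a change of the side lengths
  shows that shortening a tree edge strictly increases the angle sum as long as the radius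
  on the side of the root is at least the radius beyond the edge, and that it then makes the
  difference of these radii positive. At an extremal point of the closure, which exists by
  compactness, no tree edge can be shortened within the admissible space, and this forces one
  of the three alternatives.\<close>

section \<open>Isosceles triangles\<close>

text \<open>Radii depend on the side lengths only implicitly, and \<open>half_angle\<close> has an
  infinite derivative where a side becomes a diameter, which is precisely the situation of the first
  two alternatives. Hence no radius is ever differentiated with respect to a length. Inserting a
  wrong radius into an extremal sum gives a one-sided estimate, and only derivatives in
  \<open>r\<close> at fixed lengths occur. For a center outside the polygon, uniqueness of the
  critical point is the delicate fact; it comes down to tan z / z being increasing. The resulting
  estimate is strict only if the two radii at the shortened edge differ. If they agree, a first
  shortening that loses nothing separates them, and a second one gains. The radii are kept as
  coordinates of a configuration, because the conditions on lengths and radii together are closed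
  and bounded. The hyperboloid enters only to show that the side lengths determine the radius and
  the angle sum of a polygon; if its center is outside, the longest side spans an arc longer than
  pi.\<close>

definition half_angle :: "real \<Rightarrow> real \<Rightarrow> real" where
  "half_angle d r = arcsin (sinh (d / 2) / sinh r)"

text \<open>The altitude cuts the isosceles triangle into two right triangles with hypotenuse
  \<open>r\<close>, whose acute angles satisfy \<open>cosh r = cot \<alpha> * cot \<beta>\<close>.
  For \<open>\<alpha> = pi / 2\<close> the triangle is flat and the value is 0.\<close>

definition base_angle :: "real \<Rightarrow> real \<Rightarrow> real" where
  "base_angle d r = arctan (cot (half_angle d r) / cosh r)"

lemma sin_half_angle:
  assumes "0 < d" "d / 2 \<le> r"
  shows "sinh r * sin (half_angle d r) = sinh (d / 2)"
proof -
  have "0 < sinh r" "sinh (d/2) \<le> sinh r" "0 < sinh (d/2)" using assms by auto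
  then have "- 1 \<le> sinh (d/2) / sinh r" "sinh (d/2) / sinh r \<le> 1"
    by (auto intro: order_trans[of _ 0])
  with \<open>0 < sinh r\<close> show ?thesis by (simp add: half_angle_def)
qed

lemma half_angle_pos:
  assumes "0 < d" "d / 2 \<le> r"
  shows "0 < half_angle d r"
proof -
  have "0 < sinh r" "sinh (d/2) \<le> sinh r" "0 < sinh (d/2)" using assms by auto
  then have "0 < sinh (d/2) / sinh r" "sinh (d/2) / sinh r \<le> 1" by auto
  then have "arcsin 0 < arcsin (sinh (d/2) / sinh r)"
    by (intro arcsin_less_arcsin) auto
  then show ?thesis by (simp add: half_angle_def)
qed

lemma half_angle_le:
  assumes "0 < d" "d / 2 \<le> r"
  shows "half_angle d r \<le> pi / 2"
proof -
  have "0 < sinh r" "sinh (d/2) \<le> sinh r" "0 < sinh (d/2)" using assms by auto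
  then have "0 < sinh (d/2) / sinh r" "sinh (d/2) / sinh r \<le> 1" by auto
  then show ?thesis unfolding half_angle_def by (intro arcsin_ubound) auto
qed

lemma half_angle_unique:
  assumes "0 < d" "0 < r" "0 \<le> a" "a \<le> pi / 2" "sinh r * sin a = sinh (d / 2)"
  shows "half_angle d r = a"
proof -
  have "sinh (d/2) / sinh r = sin a" using assms by (simp add: field_simps)
  then show ?thesis using assms by (simp add: half_angle_def arcsin_sin)
qed

lemma half_angle_half: "0 < d \<Longrightarrow> half_angle d (d / 2) = pi / 2"
  by (rule half_angle_unique) auto

lemma half_angle_less_length:
  assumes "0 < d" "d < d'" "d' / 2 \<le> r"
  shows "half_angle d r < half_angle d' r"
proof -
  have "0 < sinh r" "sinh (d'/2) \<le> sinh r" "0 < sinh (d/2)" "sinh (d/2) < sinh (d'/2)"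
    using assms by auto
  then show ?thesis unfolding half_angle_def
    by (intro arcsin_less_arcsin) (auto simp: divide_strict_right_mono intro: order_trans[of _ 0])
qed

lemma half_angle_less_radius:
  assumes "0 < d" "d / 2 \<le> r" "r < r'"
  shows "half_angle d r' < half_angle d r"
proof -
  have "0 < sinh r" "sinh (d/2) \<le> sinh r" "0 < sinh (d/2)" "sinh r < sinh r'"
    using assms by auto
  then have "0 < sinh (d/2) / sinh r'" "sinh (d/2) / sinh r \<le> 1"
      "sinh (d/2) / sinh r' < sinh (d/2) / sinh r"
    by (auto simp: divide_strict_left_mono)
  then show ?thesis unfolding half_angle_def
    by (intro arcsin_less_arcsin) (auto intro: order_trans[of _ 0])
qed

lemma half_angle_le_radius:
  "0 < d \<Longrightarrow> d / 2 \<le> r \<Longrightarrow> r \<le> r' \<Longrightarrow> half_angle d r' \<le> half_angle d r"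
  using half_angle_less_radius[of d r r'] by (cases "r = r'") auto

lemma half_angle_less_pi_half:
  "0 < d \<Longrightarrow> d / 2 < r \<Longrightarrow> half_angle d r < pi / 2"
  using half_angle_less_radius[of d "d/2" r] half_angle_half by simp

lemma continuous_on_half_angle:
  fixes S :: "'a::t2_space set"
  assumes "continuous_on S f" "continuous_on S g" "\<And>z. z \<in> S \<Longrightarrow> 0 < f z \<and> f z / 2 \<le> g z"
  shows "continuous_on S (\<lambda>z. half_angle (f z) (g z))"
proof -
  have *: "sinh (g z) \<noteq> 0" "- 1 \<le> sinh (f z/2) / sinh (g z)" "sinh (f z/2) / sinh (g z) \<le> 1"
    if "z \<in> S" for z
  proof -
    have "0 < sinh (g z)" "sinh (f z/2) \<le> sinh (g z)" "0 < sinh (f z/2)"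
      using assms(3)[OF that] by auto
    then show "sinh (g z) \<noteq> 0" "- 1 \<le> sinh (f z/2) / sinh (g z)" "sinh (f z/2) / sinh (g z) \<le> 1"
      by (auto intro: order_trans[of _ 0])
  qed
  show ?thesis unfolding half_angle_def
    using assms(1,2) *
    by (intro continuous_on_arcsin continuous_intros ballI conjI) auto
qed

lemma continuous_on_base_angle:
  fixes S :: "'a::t2_space set"
  assumes "continuous_on S f" "continuous_on S g" "\<And>z. z \<in> S \<Longrightarrow> 0 < f z \<and> f z / 2 \<le> g z"
  shows "continuous_on S (\<lambda>z. base_angle (f z) (g z))"
proof -
  have "sin (half_angle (f z) (g z)) \<noteq> 0" if "z \<in> S" for z
    using sin_half_angle[of "f z" "g z"] assms(3)[OF that] by auto
  moreover have "continuous_on S (\<lambda>z. half_angle (f z) (g z))"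
    by (rule continuous_on_half_angle) (use assms in auto)
  ultimately show ?thesis
    unfolding base_angle_def cot_def
    using assms(2)
    by (intro continuous_on_arctan continuous_on_divide continuous_on_cosh continuous_on_cos
        continuous_on_sin) auto
qed

lemma base_angle_half: "0 < d \<Longrightarrow> base_angle d (d / 2) = 0"
  by (simp add: base_angle_def half_angle_half cot_def)

text \<open>Implicit differentiation of \<open>sinh r * sin \<alpha> = sinh (d / 2)\<close>; the
  tangent is the reason for excluding \<open>r = d / 2\<close>.\<close>

lemma has_derivative_half_angle:
  assumes "0 < d" "d / 2 < r"
  shows "(half_angle d has_real_derivative - tan (half_angle d r) * cosh r / sinh r) (at r)"
proof -
  define q where "q = sinh (d/2) / sinh r"
  have s: "0 < sinh r" "sinh (d/2) < sinh r" "0 < sinh (d/2)" using assms by auto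
  then have q: "0 < q" "q < 1" by (auto simp: q_def)
  have t: "tan (half_angle d r) = q / sqrt (1 - q\<^sup>2)"
    using q unfolding half_angle_def q_def[symmetric] by (simp add: tan_def cos_arcsin)
  have "((\<lambda>r. arcsin (sinh (d / 2) / sinh r)) has_real_derivative
      inverse (sqrt (1 - q\<^sup>2)) * (- sinh (d/2) * cosh r / (sinh r)\<^sup>2)) (at r)"
  proof -
    have "((\<lambda>r. sinh (d / 2) / sinh r) has_real_derivative - sinh (d/2) * cosh r / (sinh r)\<^sup>2) (at r)"
      using s by (auto intro!: derivative_eq_intros simp: power2_eq_square)
    from DERIV_chain2[OF DERIV_arcsin this] q show ?thesis unfolding q_def by simp
  qed
  then show ?thesis unfolding t unfolding half_angle_def[abs_def]
    by (rule DERIV_cong) (use s in \<open>simp add: q_def field_simps power2_eq_square\<close>)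
qed

lemma has_derivative_base_angle:
  assumes "0 < d" "d / 2 < r"
  shows "(base_angle d has_real_derivative tan (half_angle d r) / sinh r) (at r)"
proof -
  define a where "a = half_angle d r"
  have r: "0 < r" and sh: "0 < sinh r" and ch: "0 < cosh r" using assms by auto
  have a: "0 < a" "a < pi/2" "sinh r * sin a = sinh (d/2)"
    using half_angle_pos[of d r] half_angle_less_pi_half[of d r] sin_half_angle[of d r] assms
    by (auto simp: a_def)
  have sa: "0 < sin a" and ca: "0 < cos a" using a by (auto intro: sin_gt_zero cos_gt_zero)
  have dch: "(cosh has_real_derivative sinh r) (at r)"
    by (auto intro!: derivative_eq_intros)
  have D: "(base_angle d has_real_derivative
       inverse (1 + (cot a / cosh r)\<^sup>2) *
        ((- inverse ((sin a)\<^sup>2) * (- tan a * cosh r / sinh r) * cosh r - cot a * sinh r) / (cosh r * cosh r))) (at r)"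
    unfolding base_angle_def[abs_def] a_def
    using sa ch assms
    by (intro DERIV_chain2[OF DERIV_arctan] DERIV_divide DERIV_chain2[OF DERIV_cot]
       has_derivative_half_angle dch) (auto simp: a_def)
  have c2: "(cosh r)\<^sup>2 = 1 + (sinh r)\<^sup>2" by (simp add: cosh_square_eq)
  have s2: "(cos a)\<^sup>2 = 1 - (sin a)\<^sup>2" by (simp add: cos_squared_eq)
  have p: "0 < 1 + (sinh r)\<^sup>2 * (sin a)\<^sup>2" by (simp add: add_pos_nonneg)
  \<comment> \<open>The derivative of arctan and the numerator of the inner derivative share the
    factor \<open>1 + (sinh r * sin a)^2\<close>, which cancels.\<close>
  have 1: "1 + (cot a / cosh r)\<^sup>2 = (1 + (sinh r)\<^sup>2 * (sin a)\<^sup>2) / ((cosh r)\<^sup>2 * (sin a)\<^sup>2)"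
    using sa ch by (simp add: cot_def divide_simps power2_eq_square) (use c2 s2 in algebra)
  have 2: "(- inverse ((sin a)\<^sup>2) * (- tan a * cosh r / sinh r) * cosh r - cot a * sinh r)
     = (1 + (sinh r)\<^sup>2 * (sin a)\<^sup>2) / (sin a * cos a * sinh r)"
    using sa ca sh by (simp add: cot_def tan_def divide_simps power2_eq_square) (use c2 s2 in algebra)
  show ?thesis unfolding a_def[symmetric]
    by (rule DERIV_cong[OF D], unfold 1 2)
      (use p sa ca sh ch in \<open>simp add: tan_def divide_simps power2_eq_square\<close>)
qed

text \<open>The function \<open>E\<close> of the overview. In its derivative the tangents cancel, so
  it stays bounded as \<open>r\<close> approaches \<open>d / 2\<close>.\<close>

definition side_term :: "real \<Rightarrow> real \<Rightarrow> real" where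
  "side_term d r = 2 * base_angle d r + 2 * half_angle d r / cosh r"

lemma has_derivative_side_term:
  assumes "0 < d" "d / 2 < r"
  shows "(side_term d has_real_derivative - 2 * half_angle d r * sinh r / (cosh r)\<^sup>2) (at r)"
proof -
  have "0 < sinh r" "0 < cosh r" using assms by auto
  then show ?thesis unfolding side_term_def[abs_def]
    using assms
    by (auto intro!: derivative_eq_intros has_derivative_half_angle has_derivative_base_angle
        simp: divide_simps power2_eq_square) (simp add: algebra_simps)?
qed

lemma continuous_on_side_term:
  assumes "0 < d"
  shows "continuous_on {d / 2..} (side_term d)"
  unfolding side_term_def[abs_def] using assms
  by (intro continuous_intros continuous_on_half_angle continuous_on_base_angle) auto

text \<open>The derivative of the difference is a positive multiple of
  \<open>half_angle d z - half_angle d' z\<close>, and the longer chord subtends the larger angle.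
  This is the source of every strict gain: shortening a shared edge changes its term by more on the
  larger circle.\<close>

lemma side_term_diff_less:
  assumes "0 < d'" "d' < d" "d / 2 \<le> r" "r < r'"
  shows "side_term d' r - side_term d r < side_term d' r' - side_term d r'"
proof (rule DERIV_pos_imp_increasing_open[OF assms(4)])
  fix z assume z: "r < z" "z < r'"
  have D: "((\<lambda>r. side_term d' r - side_term d r) has_real_derivative
     (- 2 * half_angle d' z * sinh z / (cosh z)\<^sup>2 - - 2 * half_angle d z * sinh z / (cosh z)\<^sup>2)) (at z)"
    using assms z by (intro DERIV_diff has_derivative_side_term) auto
  have "half_angle d' z < half_angle d z" using assms z by (intro half_angle_less_length) auto
  moreover have "0 < sinh z / (cosh z)\<^sup>2" using assms z by simp
  ultimately have "0 < 2 * (half_angle d z - half_angle d' z) * (sinh z / (cosh z)\<^sup>2)"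
    by (intro mult_pos_pos) auto
  also have "\<dots> = - 2 * half_angle d' z * sinh z / (cosh z)\<^sup>2 - - 2 * half_angle d z * sinh z / (cosh z)\<^sup>2"
    by (simp add: algebra_simps diff_divide_distrib)
  finally show "\<exists>y. ((\<lambda>r. side_term d' r - side_term d r) has_real_derivative y) (at z) \<and> 0 < y"
    using D by blast
next
  show "continuous_on {r..r'} (\<lambda>r. side_term d' r - side_term d r)"
    using assms
    by (intro continuous_intros continuous_on_subset[OF continuous_on_side_term]) auto
qed

text \<open>The derivative has the sign of \<open>z - sin z * cos z\<close>.\<close>

lemma tan_over_self_less:
  fixes s t :: real
  assumes "0 < s" "s < t" "t < pi / 2"
  shows "tan s / s < tan t / t"
proof (rule DERIV_pos_imp_increasing[OF assms(2)])
  fix z assume z: "s \<le> z" "z \<le> t"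
  have c: "0 < cos z" using z assms by (intro cos_gt_zero_pi) auto
  have D: "((\<lambda>z. tan z / z) has_real_derivative (inverse ((cos z)\<^sup>2) * z - tan z) / (z * z)) (at z)"
    using c z assms by (auto intro!: derivative_eq_intros)
  have "sin z * cos z < z"
  proof -
    have "cos z < 1" using z assms cos_monotone_0_pi[of 0 z] by simp
    moreover have "0 < sin z" using z assms by (intro sin_gt_zero) auto
    moreover have "sin z \<le> z" using z assms by (intro sin_x_le_x) auto
    ultimately have "sin z * cos z < sin z * 1" "sin z \<le> z"
      by (auto simp del: mult_1_right intro!: mult_strict_left_mono)
    then show ?thesis by simp
  qed
  then have "0 < inverse ((cos z)\<^sup>2) * z - tan z"
    using c by (simp add: tan_def field_simps power2_eq_square)
  then show "\<exists>y. ((\<lambda>z. tan z / z) has_real_derivative y) (at z) \<and> 0 < y"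
    using D z assms by (intro exI conjI) (assumption, simp)
qed

text \<open>By the quotient rule the derivative has the sign of \<open>tan b * a - tan a * b\<close>
  for the half angles \<open>a < b\<close>, so the monotonicity of tan z / z decides.\<close>

lemma half_angle_ratio_less:
  assumes "0 < d" "d < x" "x / 2 \<le> r" "r < r'"
  shows "half_angle d r / half_angle x r < half_angle d r' / half_angle x r'"
proof (rule DERIV_pos_imp_increasing_open[OF assms(4)])
  fix z assume z: "r < z" "z < r'"
  let ?a = "half_angle d z" and ?b = "half_angle x z"
  have ab: "0 < ?a" "?a < ?b" "?b < pi / 2" using assms z
    by (auto intro!: half_angle_pos half_angle_less_length half_angle_less_pi_half simp del: less_divide_eq_numeral1)
  have s: "0 < sinh z" "0 < cosh z" using assms z by auto
  have D: "((\<lambda>r. half_angle d r / half_angle x r) has_real_derivative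
     ((- tan ?a * cosh z / sinh z) * ?b - ?a * (- tan ?b * cosh z / sinh z)) / (?b * ?b)) (at z)"
    using assms z ab by (intro DERIV_divide has_derivative_half_angle) auto
  have "tan ?a * ?b < tan ?b * ?a" using tan_over_self_less[OF ab] ab by (simp add: field_simps)
  then have "0 < (tan ?b * ?a - tan ?a * ?b) * (cosh z / sinh z)" using s by simp
  also have "\<dots> = (- tan ?a * cosh z / sinh z) * ?b - ?a * (- tan ?b * cosh z / sinh z)"
    by (simp add: algebra_simps diff_divide_distrib)
  finally show "\<exists>y. ((\<lambda>r. half_angle d r / half_angle x r) has_real_derivative y) (at z) \<and> 0 < y"
    using D ab by (intro exI conjI) (assumption, simp)
next
  have "half_angle x z \<noteq> 0" if "z \<in> {r..r'}" for z
    using half_angle_pos[of x z] that assms by auto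
  then show "continuous_on {r..r'} (\<lambda>r. half_angle d r / half_angle x r)"
    using assms by (intro continuous_intros continuous_on_half_angle) auto
qed

section \<open>Radii and angle sums\<close>

definition angle_sum :: "real multiset \<Rightarrow> real \<Rightarrow> real" where
  "angle_sum M r = (\<Sum>d\<in>#M. half_angle d r)"

definition base_sum :: "real multiset \<Rightarrow> real \<Rightarrow> real" where
  "base_sum M r = (\<Sum>d\<in>#M. base_angle d r)"

definition side_sum :: "real multiset \<Rightarrow> real \<Rightarrow> real" where
  "side_sum M r = (\<Sum>d\<in>#M. side_term d r)"

lemma angle_sum_add [simp]: "angle_sum (add_mset d M) r = half_angle d r + angle_sum M r"
  and angle_sum_empty [simp]: "angle_sum {#} r = 0"
  and angle_sum_union [simp]: "angle_sum (M + N) r = angle_sum M r + angle_sum N r"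
  by (simp_all add: angle_sum_def)

lemma base_sum_add [simp]: "base_sum (add_mset d M) r = base_angle d r + base_sum M r"
  and base_sum_empty [simp]: "base_sum {#} r = 0"
  by (simp_all add: base_sum_def)

lemma side_sum_add [simp]: "side_sum (add_mset d M) r = side_term d r + side_sum M r"
  and side_sum_empty [simp]: "side_sum {#} r = 0"
  and side_sum_union [simp]: "side_sum (M + N) r = side_sum M r + side_sum N r"
  by (simp_all add: side_sum_def)

lemma side_sum_eq: "side_sum M r = 2 * base_sum M r + 2 * angle_sum M r / cosh r"
  by (induction M) (auto simp: side_term_def add_divide_distrib distrib_left)

text \<open>The center may lie on the boundary in both cases: it is then the midpoint of a side of length
  \<open>2 * r\<close>, and both predicates hold, \<open>x\<close> being that side.\<close>

definition centered :: "real multiset \<Rightarrow> real \<Rightarrow> bool" where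
  "centered M r \<longleftrightarrow> (\<forall>d\<in>#M. 0 < d \<and> d / 2 \<le> r) \<and> angle_sum M r = pi"

definition uncentered :: "real \<Rightarrow> real multiset \<Rightarrow> real \<Rightarrow> bool" where
  "uncentered x M r \<longleftrightarrow> 2 \<le> size M \<and> x / 2 \<le> r \<and> (\<forall>d\<in>#M. 0 < d \<and> d \<le> x) \<and>
     angle_sum M r = half_angle x r"

lemma sum_mset_strict_mono:
  fixes f g :: "'a \<Rightarrow> 'b::{ordered_cancel_comm_monoid_add}"
  assumes "M \<noteq> {#}" "\<And>d. d \<in># M \<Longrightarrow> f d < g d"
  shows "(\<Sum>d\<in>#M. f d) < (\<Sum>d\<in>#M. g d)"
  using assms
proof (induction M)
  case (add d M)
  then show ?case by (cases "M = {#}") (auto intro: add_strict_mono)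
qed simp

lemma angle_sum_strict_anti:
  assumes "M \<noteq> {#}" "\<And>d. d \<in># M \<Longrightarrow> 0 < d \<and> d / 2 \<le> r" "r < r'"
  shows "angle_sum M r' < angle_sum M r"
  unfolding angle_sum_def
  by (rule sum_mset_strict_mono) (use assms half_angle_less_radius in auto)

lemma angle_sum_anti:
  assumes "\<And>d. d \<in># M \<Longrightarrow> 0 < d \<and> d / 2 \<le> r" "r \<le> r'"
  shows "angle_sum M r' \<le> angle_sum M r"
  unfolding angle_sum_def
  by (rule sum_mset_mono) (use assms half_angle_le_radius in auto)

lemma angle_sum_nonneg:
  assumes "\<And>d. d \<in># M \<Longrightarrow> 0 < d \<and> d / 2 \<le> r"
  shows "0 \<le> angle_sum M r"
  using assms
proof (induction M)
  case (add d M)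
  then show ?case using half_angle_pos[of d r] by (simp add: add_nonneg_nonneg less_imp_le)
qed simp

lemma angle_sum_ge_member:
  assumes "\<And>d. d \<in># M \<Longrightarrow> 0 < d \<and> d / 2 \<le> r" "d \<in># M"
  shows "half_angle d r \<le> angle_sum M r"
proof -
  obtain N where N: "M = add_mset d N" using assms(2) by (metis multi_member_split)
  have "0 \<le> angle_sum N r" using assms(1) N by (intro angle_sum_nonneg) auto
  then show ?thesis using N by simp
qed

text \<open>The quotient of \<open>angle_sum M r\<close> by \<open>half_angle x r\<close> is a sum
  of increasing quotients, so it passes the value 1 at most once. Uniqueness and extremality of
  uncentered radii rest on this single crossing.\<close>

lemma angle_sum_greater_radius:
  assumes "M \<noteq> {#}" "\<And>d. d \<in># M \<Longrightarrow> 0 < d \<and> d < x" "x / 2 \<le> r" "r < r'"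
    and "half_angle x r \<le> angle_sum M r"
  shows "half_angle x r' < angle_sum M r'"
proof -
  have x: "0 < x" using assms(1,2) by (meson multiset_nonemptyE less_trans)
  have p: "0 < half_angle x r" "0 < half_angle x r'" using x assms by (auto intro!: half_angle_pos)
  have e: "(\<Sum>d\<in>#M. half_angle d r / half_angle x r) = angle_sum M r / half_angle x r" for r
    by (induction M) (auto simp: add_divide_distrib)
  have "(\<Sum>d\<in>#M. half_angle d r / half_angle x r) < (\<Sum>d\<in>#M. half_angle d r' / half_angle x r')"
    by (rule sum_mset_strict_mono) (use assms half_angle_ratio_less in auto)
  then have "angle_sum M r / half_angle x r < angle_sum M r' / half_angle x r'" by (simp add: e)
  moreover have "1 \<le> angle_sum M r / half_angle x r" using p assms by simp
  ultimately have "1 < angle_sum M r' / half_angle x r'" by simp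
  then show ?thesis using p by simp
qed

text \<open>The definition has only the weak bound \<open>d \<le> x\<close>, which survives limits.
  Strictness is automatic: a side as long as \<open>x\<close> would use up the whole angle
  \<open>half_angle x r\<close>, while at least one further side takes a positive angle.\<close>

lemma uncenteredD:
  assumes "uncentered x M r"
  shows "M \<noteq> {#}" "0 < x" "0 < r" "x / 2 \<le> r" "angle_sum M r = half_angle x r"
    "\<And>d. d \<in># M \<Longrightarrow> 0 < d" "\<And>d. d \<in># M \<Longrightarrow> d < x" "2 \<le> size M"
proof -
  show M: "M \<noteq> {#}" and s: "2 \<le> size M" using assms by (auto simp: uncentered_def)
  obtain e where e: "e \<in># M" using M by blast
  show x: "0 < x" using e assms by (force simp: uncentered_def)
  show xr: "x / 2 \<le> r" and eq: "angle_sum M r = half_angle x r" using assms by (auto simp: uncentered_def)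
  show "0 < r" using x xr by simp
  show pos: "0 < d" if "d \<in># M" for d using that assms by (auto simp: uncentered_def)
  show "d < x" if d: "d \<in># M" for d
  proof -
    obtain N where N: "M = add_mset d N" using d by (metis multi_member_split)
    have *: "0 < d' \<and> d' / 2 \<le> r" if "d' \<in># M" for d' using assms that by (auto simp: uncentered_def)
    from s N obtain d' where "d' \<in># N" by fastforce
    then have "half_angle d' r \<le> angle_sum N r" "0 < half_angle d' r"
      using * N by (auto intro!: angle_sum_ge_member half_angle_pos)
    then have "d \<noteq> x" using eq N by auto
    then show ?thesis using d assms by (auto simp: uncentered_def less_le)
  qed
qed

section \<open>Uniqueness of the radius\<close>

lemma centered_nonempty: "centered M r \<Longrightarrow> M \<noteq> {#}"
  by (auto simp: centered_def)

lemma centered_unique: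
  assumes "centered M r" "centered M r'"
  shows "r = r'"
proof -
  have "\<not> r < r'" if "centered M r" "centered M r'" for r r'
    using angle_sum_strict_anti[of M r r'] that centered_nonempty by (auto simp: centered_def)
  then show ?thesis using assms by (meson linorder_neqE)
qed

lemma uncentered_unique:
  assumes "uncentered x M r" "uncentered x M r'"
  shows "r = r'"
proof -
  have "\<not> r < r'" if "uncentered x M r" "uncentered x M r'" for r r'
    using angle_sum_greater_radius[of M x r r'] uncenteredD[OF that(1)] uncenteredD[OF that(2)] by auto
  then show ?thesis using assms by (meson linorder_neqE)
qed

text \<open>At \<open>r\<close> the side \<open>x\<close> takes at most \<open>pi / 2\<close>, so
  the other sides take at least as much as \<open>x\<close>; by the single crossing they are
  strictly ahead at any larger radius, which excludes \<open>r < r'\<close>. At \<open>r'\<close>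
  the total angle is at most \<open>pi\<close>, and it decreases with the radius, which excludes
  \<open>r' < r\<close>.\<close>

lemma centered_uncentered_unique:
  assumes "centered (add_mset x M) r" "uncentered x M r'"
  shows "r = r'"
proof (rule ccontr)
  note u = uncenteredD[OF assms(2)]
  have x: "x / 2 \<le> r" and s: "half_angle x r + angle_sum M r = pi"
    using assms(1) by (auto simp: centered_def)
  assume "r \<noteq> r'"
  then consider "r < r'" | "r' < r" by linarith
  then show False
  proof cases
    case 1
    have "half_angle x r \<le> angle_sum M r" using half_angle_le[OF u(2) x] s by simp
    from angle_sum_greater_radius[OF u(1) _ x 1 this] u show False by auto
  next
    case 2
    have "0 < d \<and> d / 2 \<le> r'" if "d \<in># add_mset x M" for d
      using that u(2,4) u(6,7)[of d] by auto
    then have "angle_sum (add_mset x M) r < angle_sum (add_mset x M) r'"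
      using 2 by (intro angle_sum_strict_anti) auto
    also have "\<dots> \<le> pi" using half_angle_le[OF u(2,4)] u(5) by simp
    finally show False using s by simp
  qed
qed

lemma uncentered_longest_unique:
  assumes "uncentered x M r" "uncentered x' M' r'" "add_mset x M = add_mset x' M'"
  shows "x = x' \<and> M = M' \<and> r = r'"
proof -
  have "x = x'"
  proof (rule ccontr)
    assume "x \<noteq> x'"
    then have "x \<in># M'" "x' \<in># M" using assms(3) by (metis insert_noteq_member)+
    then show False using uncenteredD(7)[OF assms(1)] uncenteredD(7)[OF assms(2)] by fastforce
  qed
  then show ?thesis using assms uncentered_unique by auto
qed

section \<open>Extremal properties of the radius\<close>

lemma has_derivative_side_sum:
  assumes "\<And>d. d \<in># M \<Longrightarrow> 0 < d \<and> d / 2 < r"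
  shows "(side_sum M has_real_derivative - 2 * angle_sum M r * (sinh r / (cosh r)\<^sup>2)) (at r)"
  using assms
proof (induction M)
  case empty
  then show ?case by (simp add: side_sum_def[abs_def])
next
  case (add d M)
  have "((\<lambda>r. side_term d r + side_sum M r) has_real_derivative
     (- 2 * half_angle d r * sinh r / (cosh r)\<^sup>2 + - 2 * angle_sum M r * (sinh r / (cosh r)\<^sup>2))) (at r)"
    using add by (intro DERIV_add has_derivative_side_term add.IH) auto
  moreover have "side_sum (add_mset d M) = (\<lambda>r. side_term d r + side_sum M r)" by (simp add: fun_eq_iff)
  ultimately show ?case
    by (simp add: algebra_simps)
qed

lemma continuous_on_sum_mset:
  fixes f :: "'i \<Rightarrow> 'a::topological_space \<Rightarrow> 'b::topological_comm_monoid_add"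
  assumes "\<And>d. d \<in># M \<Longrightarrow> continuous_on S (f d)"
  shows "continuous_on S (\<lambda>z. \<Sum>d\<in>#M. f d z)"
  using assms by (induction M) (auto intro!: continuous_intros)

lemma continuous_on_angle_sum:
  fixes S :: "'a::t2_space set"
  assumes "continuous_on S g" "\<And>z d. z \<in> S \<Longrightarrow> d \<in># M \<Longrightarrow> 0 < d \<and> d / 2 \<le> g z"
  shows "continuous_on S (\<lambda>z. angle_sum M (g z))"
  unfolding angle_sum_def
  by (intro continuous_on_sum_mset continuous_on_half_angle continuous_intros assms(1)) (use assms(2) in auto)

lemma continuous_on_base_sum:
  fixes S :: "'a::t2_space set"
  assumes "continuous_on S g" "\<And>z d. z \<in> S \<Longrightarrow> d \<in># M \<Longrightarrow> 0 < d \<and> d / 2 \<le> g z"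
  shows "continuous_on S (\<lambda>z. base_sum M (g z))"
  unfolding base_sum_def
  by (intro continuous_on_sum_mset continuous_on_base_angle continuous_intros assms(1)) (use assms(2) in auto)

lemma continuous_on_side_sum:
  assumes "\<And>d. d \<in># M \<Longrightarrow> 0 < d \<and> d / 2 \<le> a"
  shows "continuous_on {a..} (side_sum M)"
  unfolding side_sum_def[abs_def]
  by (intro continuous_on_sum_mset continuous_on_subset[OF continuous_on_side_term]) (use assms in auto)

text \<open>The derivative has the sign of \<open>pi - angle_sum M z\<close>, and the angle sum
  decreases through \<open>pi\<close> at \<open>J\<close>. Subtracting
  \<open>2 * pi / cosh r\<close> makes the value at \<open>J\<close> twice the sum of the base
  angles, see \<open>base_sum_centered\<close>.\<close>

lemma centered_side_sum_le:
  assumes "centered M J" "\<And>d. d \<in># M \<Longrightarrow> d / 2 \<le> r"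
  shows "side_sum M J - 2 * pi / cosh J \<le> side_sum M r - 2 * pi / cosh r"
proof -
  define f where "f r = side_sum M r - 2 * pi / cosh r" for r
  have M: "M \<noteq> {#}" and dJ: "\<And>d. d \<in># M \<Longrightarrow> 0 < d \<and> d / 2 \<le> J" and J: "angle_sum M J = pi"
    using assms(1) centered_nonempty by (auto simp: centered_def)
  obtain e where e: "e \<in># M" using M by blast
  have cont: "continuous_on {min r J..} f" unfolding f_def[abs_def]
    using assms(2) dJ by (intro continuous_intros continuous_on_side_sum) auto
  have D: "(f has_real_derivative 2 * (pi - angle_sum M z) * (sinh z / (cosh z)\<^sup>2)) (at z)"
    and pos: "0 < sinh z / (cosh z)\<^sup>2" if "min r J < z" for z
  proof -
    have *: "0 < d \<and> d / 2 < z" if "d \<in># M" for d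
      using assms(2)[OF that] dJ[OF that] \<open>min r J < z\<close> by (auto simp: min_def split: if_splits)
    have "cosh z \<noteq> 0" by simp
    then show "(f has_real_derivative 2 * (pi - angle_sum M z) * (sinh z / (cosh z)\<^sup>2)) (at z)"
      unfolding f_def[abs_def] using *
      by (auto intro!: derivative_eq_intros has_derivative_side_sum simp: algebra_simps power2_eq_square)
    show "0 < sinh z / (cosh z)\<^sup>2" using *[OF e] by simp
  qed
  consider "r = J" | "r < J" | "J < r" by linarith
  then have "f J \<le> f r"
  proof cases
    case 2
    have "f J < f r"
    proof (rule DERIV_neg_imp_decreasing_open[OF 2])
      fix z assume z: "r < z" "z < J"
      have "angle_sum M J < angle_sum M z"
        by (rule angle_sum_strict_anti) (use M z dJ assms(2) in force)+
      then have "2 * (pi - angle_sum M z) * (sinh z / (cosh z)\<^sup>2) < 0"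
        using pos[of z] z J 2 by (subst mult_neg_pos) auto
      then show "\<exists>y. (f has_real_derivative y) (at z) \<and> y < 0" using D[of z] z 2 by auto
    qed (use cont 2 in \<open>auto intro: continuous_on_subset\<close>)
    then show ?thesis by simp
  next
    case 3
    have "f J < f r"
    proof (rule DERIV_pos_imp_increasing_open[OF 3])
      fix z assume z: "J < z" "z < r"
      have "angle_sum M z < angle_sum M J"
        by (rule angle_sum_strict_anti) (use M z dJ assms(2) in force)+
      then have "2 * (pi - angle_sum M z) * (sinh z / (cosh z)\<^sup>2) > 0"
        using pos[of z] z J 3 by (intro mult_pos_pos) auto
      then show "\<exists>y. (f has_real_derivative y) (at z) \<and> y > 0" using D[of z] z 3 by auto
    qed (use cont 3 in \<open>auto intro: continuous_on_subset\<close>)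
    then show ?thesis by simp
  qed simp
  then show ?thesis by (simp add: f_def)
qed

text \<open>The derivative has the sign of \<open>half_angle x z - angle_sum M z\<close>, which by
  the single crossing changes from positive to negative at \<open>J\<close>.\<close>

lemma uncentered_side_sum_ge:
  assumes "uncentered x M J" "x / 2 \<le> r"
  shows "side_sum M r - side_term x r \<le> side_sum M J - side_term x J"
proof -
  define f where "f r = side_sum M r - side_term x r" for r
  note u = uncenteredD[OF assms(1)]
  have cont: "continuous_on {min r J..} f" unfolding f_def[abs_def]
    using assms(2) u(2,4,6) 
    by (intro continuous_intros continuous_on_side_sum continuous_on_subset[OF continuous_on_side_term[OF u(2)]])
      (auto dest: u(7))
  have D: "(f has_real_derivative 2 * (half_angle x z - angle_sum M z) * (sinh z / (cosh z)\<^sup>2)) (at z)"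
    and pos: "0 < sinh z / (cosh z)\<^sup>2" if "min r J < z" for z
  proof -
    have x: "x / 2 < z" using that assms(2) u(4) by (auto simp: min_def split: if_splits)
    then have *: "0 < d \<and> d / 2 < z" if "d \<in># M" for d using u(6,7)[OF that] by auto
    show "(f has_real_derivative 2 * (half_angle x z - angle_sum M z) * (sinh z / (cosh z)\<^sup>2)) (at z)"
      unfolding f_def[abs_def]
      by (rule DERIV_cong[OF DERIV_diff[OF has_derivative_side_sum[OF *] has_derivative_side_term[OF u(2) x]]])
        (auto simp: algebra_simps diff_divide_distrib)
    show "0 < sinh z / (cosh z)\<^sup>2" using x u(2) by simp
  qed
  have sm: "\<And>d. d \<in># M \<Longrightarrow> 0 < d \<and> d < x" using u by auto
  consider "r = J" | "r < J" | "J < r" by linarith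
  then have "f r \<le> f J"
  proof cases
    case 2
    have "f r < f J"
    proof (rule DERIV_pos_imp_increasing_open[OF 2])
      fix z assume z: "r < z" "z < J"
      have "angle_sum M z < half_angle x z"
      proof (rule ccontr)
        assume "\<not> angle_sum M z < half_angle x z"
        then have "half_angle x J < angle_sum M J"
          using angle_sum_greater_radius[OF u(1) sm, of z J] z assms(2) by simp
        then show False using u(5) by simp
      qed
      then have "2 * (half_angle x z - angle_sum M z) * (sinh z / (cosh z)\<^sup>2) > 0"
        using pos[of z] z 2 by (intro mult_pos_pos) auto
      then show "\<exists>y. (f has_real_derivative y) (at z) \<and> y > 0" using D[of z] z 2 by auto
    qed (use cont 2 in \<open>auto intro: continuous_on_subset\<close>)
    then show ?thesis by simp
  next
    case 3
    have "f r < f J"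
    proof (rule DERIV_neg_imp_decreasing_open[OF 3])
      fix z assume z: "J < z" "z < r"
      have "half_angle x z < angle_sum M z"
        using angle_sum_greater_radius[OF u(1) sm u(4) z(1)] u(5) by simp
      then have "2 * (half_angle x z - angle_sum M z) * (sinh z / (cosh z)\<^sup>2) < 0"
        using pos[of z] z 3 by (subst mult_neg_pos) auto
      then show "\<exists>y. (f has_real_derivative y) (at z) \<and> y < 0" using D[of z] z 3 by auto
    qed (use cont 3 in \<open>auto intro: continuous_on_subset\<close>)
    then show ?thesis by simp
  qed simp
  then show ?thesis by (simp add: f_def)
qed

section \<open>Nearby polygons with one side shortened\<close>

lemma tendsto_half_angle_length:
  assumes "0 < x" "x / 2 < r"
  shows "((\<lambda>x. half_angle x r) \<longlongrightarrow> half_angle x r) (at_left x)"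
proof -
  have "continuous_on {0<..<2 * r} (\<lambda>x. half_angle x r)"
    by (intro continuous_on_half_angle continuous_intros) auto
  then have "isCont (\<lambda>x. half_angle x r) x" using assms by (simp add: continuous_on_eq_continuous_at)
  then show ?thesis by (simp add: isCont_def filterlim_at_split)
qed

lemma eventually_at_left_pos: "0 < (x::real) \<Longrightarrow> \<forall>\<^sub>F x' in at_left x. 0 < x' \<and> x' < x"
  using eventually_at_left_real[of 0 x] by (auto elim: eventually_mono)

lemma eventually_at_left_all_less:
  assumes "\<And>d. d \<in># M \<Longrightarrow> d < (x::real)"
  shows "\<forall>\<^sub>F x' in at_left x. \<forall>d\<in>#M. d < x'"
proof (rule eventually_ball_finite)
  show "\<forall>d\<in>#M. \<forall>\<^sub>F x' in at_left x. d < x'"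
    using assms by (auto intro!: eventually_mono[OF eventually_at_left_real])
qed simp

lemma exists_radius_below:
  fixes r :: real
  assumes "\<And>d. d \<in># M \<Longrightarrow> d / 2 < r" "0 < e"
  shows "\<exists>\<rho><r. r - e < \<rho> \<and> (\<forall>d\<in>#M. d / 2 < \<rho>)"
proof -
  have "Max (insert (r - e) ((\<lambda>d. d / 2) ` set_mset M)) < r" using assms by auto
  then obtain \<rho> where "Max (insert (r - e) ((\<lambda>d. d / 2) ` set_mset M)) < \<rho>" "\<rho> < r"
    using dense by blast
  then show ?thesis by auto
qed

text \<open>At a radius \<open>\<rho>\<close> just below \<open>r\<close> the total angle exceeds
  \<open>pi\<close>, and this persists for slightly shorter \<open>x\<close>; at \<open>r\<close>
  the shortening pushes it below \<open>pi\<close>. The intermediate value theorem finds the new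
  radius in between.\<close>

lemma centered_shrink_side:
  assumes c: "centered (add_mset x G) r" and strict: "\<And>d. d \<in># add_mset x G \<Longrightarrow> d / 2 < r"
    and e: "0 < e"
  shows "\<forall>\<^sub>F x' in at_left x. \<exists>r'. centered (add_mset x' G) r' \<and>
    (\<forall>d\<in>#add_mset x' G. d / 2 < r') \<and> r - e < r' \<and> r' < r"
proof -
  obtain \<rho> where \<rho>: "\<rho> < r" "r - e < \<rho>" "\<And>d. d \<in># add_mset x G \<Longrightarrow> d / 2 < \<rho>"
    using exists_radius_below[of "add_mset x G" r e] strict e by blast
  have pos: "\<And>d. d \<in># add_mset x G \<Longrightarrow> 0 < d" and sum: "angle_sum (add_mset x G) r = pi"
    using c by (auto simp: centered_def)
  have "angle_sum (add_mset x G) r < angle_sum (add_mset x G) \<rho>"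
    using \<rho> pos by (intro angle_sum_strict_anti) (auto intro: less_imp_le)
  then have "\<forall>\<^sub>F x' in at_left x. pi - angle_sum G \<rho> < half_angle x' \<rho>"
    using \<rho>(3)[of x] pos[of x] sum by (intro order_tendstoD[OF tendsto_half_angle_length]) auto
  moreover have "\<forall>\<^sub>F x' in at_left x. 0 < x' \<and> x' < x" using pos by (intro eventually_at_left_pos) auto
  ultimately show ?thesis
  proof eventually_elim
    case (elim x')
    have le: "0 < d \<and> d / 2 < \<rho>" if "d \<in># add_mset x' G" for d
      using that elim \<rho>(3)[of d] \<rho>(3)[of x] pos[of d] by auto
    have cont: "continuous_on {\<rho>..r} (\<lambda>z. angle_sum (add_mset x' G) z)"
      by (rule continuous_on_angle_sum) (use le in \<open>force intro: continuous_intros\<close>)+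
    have "half_angle x' r < half_angle x r"
      using elim strict[of x] by (intro half_angle_less_length) auto
    then have less: "angle_sum (add_mset x' G) r < pi" using sum by simp
    obtain r' where r': "\<rho> \<le> r'" "r' \<le> r" "angle_sum (add_mset x' G) r' = pi"
      using IVT2'[of "\<lambda>z. angle_sum (add_mset x' G) z" r pi \<rho>] cont less elim \<rho> by auto
    moreover from this less have "r' \<noteq> r" by auto
    ultimately show ?case
      unfolding centered_def using le \<rho> by (intro exI[of _ r']) force
  qed
qed

text \<open>Same scheme; the single crossing supplies the sign to the left of \<open>r\<close>, and
  at \<open>r\<close> the shorter \<open>x\<close> takes less angle than the other sides.\<close>

lemma uncentered_shrink_longest:
  assumes c: "uncentered x M r" and strict: "x / 2 < r" and e: "0 < e"
  shows "\<forall>\<^sub>F x' in at_left x. \<exists>r'. uncentered x' M r' \<and> x' / 2 < r' \<and> r - e < r' \<and> r' < r"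
proof -
  note u = uncenteredD[OF c]
  obtain \<rho> where \<rho>: "\<rho> < r" "r - e < \<rho>" "x / 2 < \<rho>"
    using exists_radius_below[of "{#x#}" r e] strict e by auto
  have "angle_sum M \<rho> < half_angle x \<rho>"
    using angle_sum_greater_radius[OF u(1), of x \<rho> r] u(5-7) \<rho> by force
  then have "\<forall>\<^sub>F x' in at_left x. angle_sum M \<rho> < half_angle x' \<rho>"
    using \<rho> u(2) by (intro order_tendstoD[OF tendsto_half_angle_length]) auto
  moreover have "\<forall>\<^sub>F x' in at_left x. 0 < x' \<and> x' < x" using u by (intro eventually_at_left_pos) auto
  moreover have "\<forall>\<^sub>F x' in at_left x. \<forall>d\<in>#M. d < x'" using u by (intro eventually_at_left_all_less) auto
  ultimately show ?thesis
  proof eventually_elim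
    case (elim x')
    have cont: "continuous_on {\<rho>..r} (\<lambda>z. angle_sum M z - half_angle x' z)"
      by (intro continuous_intros continuous_on_angle_sum continuous_on_half_angle)
        (use u(6) elim \<rho> in force)+
    have "half_angle x' r < half_angle x r"
      using elim strict by (intro half_angle_less_length) auto
    then have less: "0 < angle_sum M r - half_angle x' r" using u(5) by simp
    obtain r' where r': "\<rho> \<le> r'" "r' \<le> r" "angle_sum M r' - half_angle x' r' = 0"
      using IVT'[of "\<lambda>z. angle_sum M z - half_angle x' z" \<rho> 0 r] cont less elim \<rho> by auto
    moreover from this less have "r' \<noteq> r" by auto
    ultimately show ?case
      unfolding uncentered_def using elim \<rho> u by (intro exI[of _ r']) force
  qed
qed

text \<open>Here the radius grows: the shorter side leaves a deficit against \<open>x\<close>, and a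
  larger circle makes up for it because the longest side loses angle proportionally faster.\<close>

lemma uncentered_shrink_side:
  assumes c: "uncentered x (add_mset y G) r" and e: "0 < e"
  shows "\<forall>\<^sub>F y' in at_left y. \<exists>r'. uncentered x (add_mset y' G) r' \<and> r < r' \<and> r' < r + e"
proof -
  note u = uncenteredD[OF c]
  define \<rho> where "\<rho> = r + e / 2"
  have \<rho>: "r < \<rho>" "\<rho> < r + e" using e by (auto simp: \<rho>_def)
  have y: "0 < y" "y < x" using u by auto
  have "half_angle x \<rho> < angle_sum (add_mset y G) \<rho>"
    using angle_sum_greater_radius[OF u(1), of x r \<rho>] u(4-7) \<rho> by force
  then have "\<forall>\<^sub>F y' in at_left y. half_angle x \<rho> - angle_sum G \<rho> < half_angle y' \<rho>"
    using \<rho> y u(4) by (intro order_tendstoD[OF tendsto_half_angle_length]) auto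
  moreover have "\<forall>\<^sub>F y' in at_left y. 0 < y' \<and> y' < y" using y by (intro eventually_at_left_pos) auto
  ultimately show ?thesis
  proof eventually_elim
    case (elim y')
    have G: "0 < d \<and> d < x" if "d \<in># add_mset y' G" for d
      using that elim y u(6,7)[of d] by auto
    have cont: "continuous_on {r..\<rho>} (\<lambda>z. angle_sum (add_mset y' G) z - half_angle x z)"
      by (intro continuous_intros continuous_on_angle_sum continuous_on_half_angle)
        (use u(2,4) G in force)+
    have "half_angle y' r < half_angle y r"
      using elim y u(4) by (intro half_angle_less_length) auto
    then have less: "angle_sum (add_mset y' G) r - half_angle x r < 0" using u(5) by simp
    obtain r' where r': "r \<le> r'" "r' \<le> \<rho>" "angle_sum (add_mset y' G) r' - half_angle x r' = 0"
      using IVT'[of "\<lambda>z. angle_sum (add_mset y' G) z - half_angle x z" r 0 \<rho>] cont less elim \<rho> by auto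
    moreover from this less have "r' \<noteq> r" by auto
    ultimately show ?case
      unfolding uncentered_def using \<rho> u(4,8) G by (intro exI[of _ r']) force
  qed
qed

section \<open>Shortening an edge shared by two polygons\<close>

text \<open>\<open>G + H\<close> is the outline of the two polygons glued along the shared edge. If
  \<open>r' \<le> s'\<close>, these sides would take at most \<open>pi\<close> at \<open>r'\<close>
  and, because of \<open>s \<le> r\<close>, at least \<open>pi\<close> at \<open>r\<close>, although
  half angles are larger on the smaller circle \<open>r' < r\<close>.\<close>

lemma radius_order_shrink:
  assumes c: "centered (add_mset x G) r" and c': "centered (add_mset x' G) r'"
    and u: "uncentered x H s" and u': "uncentered x' H s'"
    and "x' < x" "s \<le> r" "r' < r"
  shows "s' < r'"
proof (rule ccontr)
  assume "\<not> s' < r'"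
  then have le: "r' \<le> s'" by simp
  note v = uncenteredD[OF u] and v' = uncenteredD[OF u']
  have xr: "x / 2 \<le> r" "x' / 2 \<le> r'" using c c' by (auto simp: centered_def)
  have H': "0 < d \<and> d < x'" if "d \<in># H" for d using v' that by auto
  have H: "0 < d \<and> d < x" if "d \<in># H" for d using v that by auto
  have "angle_sum H r' \<le> half_angle x' r'"
  proof (rule ccontr)
    assume no: "\<not> ?thesis"
    then have "half_angle x' s' < angle_sum H s'" if "r' < s'"
      using angle_sum_greater_radius[OF v'(1) H' xr(2) that] by simp
    then show False using no le v'(5) by (cases "r' = s'") auto
  qed
  also have "\<dots> = pi - angle_sum G r'" using c' by (auto simp: centered_def)
  also have "\<dots> \<le> pi - angle_sum G r"
    using angle_sum_anti[of G r' r] c' \<open>r' < r\<close> by (auto simp: centered_def)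
  also have "\<dots> = half_angle x r" using c by (auto simp: centered_def)
  also have "\<dots> \<le> angle_sum H r"
    using angle_sum_greater_radius[OF v(1) H v(4), of r] v(5) \<open>s \<le> r\<close> by (cases "s = r") auto
  also have "\<dots> < angle_sum H r'"
    using v'(1) \<open>r' < r\<close> H' xr(2) by (intro angle_sum_strict_anti) force+
  finally show False by simp
qed

lemma base_sum_centered: "centered M r \<Longrightarrow> 2 * base_sum M r = side_sum M r - 2 * pi / cosh r"
  by (simp add: side_sum_eq centered_def)

lemma base_sum_uncentered:
  "uncentered x M r \<Longrightarrow> 2 * (base_sum M r - base_angle x r) = side_sum M r - side_term x r"
  by (simp add: side_sum_eq uncentered_def side_term_def)

text \<open>The old centered polygon is tested at the new radius \<open>r'\<close>, the new
  uncentered one at the old radius \<open>s\<close>. What remains is the change of the shared term,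
  compared between \<open>s\<close> and \<open>r'\<close>, and \<open>s < r'\<close> makes it
  strict.\<close>

lemma shrink_centered_edge_strict:
  assumes c: "centered (add_mset x G) r" and strict: "\<And>d. d \<in># add_mset x G \<Longrightarrow> d / 2 < r"
    and u: "uncentered x H s" and us: "x / 2 < s" and sr: "s < r" and e: "0 < e"
  shows "\<exists>x' r' s'. x - e < x' \<and> x' < x \<and> centered (add_mset x' G) r' \<and>
    (\<forall>d\<in>#add_mset x' G. d / 2 < r') \<and> uncentered x' H s' \<and> x' / 2 < s' \<and> s' < r' \<and>
    r - e < r' \<and> r' < r \<and> s - e < s' \<and> s' < s \<and>
    base_sum (add_mset x G) r + base_sum H s - base_angle x s <
    base_sum (add_mset x' G) r' + base_sum H s' - base_angle x' s'"
proof -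
  have x: "0 < x" using uncenteredD[OF u] by simp
  \<comment> \<open>Staying above \<open>s\<close> gives the strict comparison; staying above
    \<open>x / 2\<close> keeps the old edge a chord of the new circle, as needed to test the old
    polygon there.\<close>
  have "0 < min e (min (r - s) (r - x / 2))" using e sr strict[of x] by auto
  from centered_shrink_side[OF c strict this] uncentered_shrink_longest[OF u us e]
    eventually_at_left_real[of "x - e" x]
  have "\<forall>\<^sub>F x' in at_left x. (\<exists>r'. centered (add_mset x' G) r' \<and> (\<forall>d\<in>#add_mset x' G. d / 2 < r') \<and>
       r - min e (min (r - s) (r - x / 2)) < r' \<and> r' < r) \<and>
     (\<exists>s'. uncentered x' H s' \<and> x' / 2 < s' \<and> s - e < s' \<and> s' < s) \<and> x' \<in> {x - e<..<x}"
    using e by (auto intro: eventually_conj)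
  from eventually_happens'[OF trivial_limit_at_left_real this] obtain x' r' s' where x': "x - e < x'" "x' < x"
    and c': "centered (add_mset x' G) r'" "\<forall>d\<in>#add_mset x' G. d / 2 < r'"
    and r': "r - min e (min (r - s) (r - x / 2)) < r'" "r' < r"
    and u': "uncentered x' H s'" "x' / 2 < s'" "s - e < s'" "s' < s"
    by auto
  have r'': "r - e < r'" "s < r'" "x / 2 < r'" using r' by (auto simp: min_def split: if_splits)
  have order: "s' < r'"
    using radius_order_shrink[OF c c'(1) u u'(1) x'(2)] sr r'(2) by simp
  have x'0: "0 < x'" using uncenteredD[OF u'(1)] by simp
  have "side_sum (add_mset x G) r - 2 * pi / cosh r \<le> side_sum (add_mset x G) r' - 2 * pi / cosh r'"
    using r'' c'(2) by (intro centered_side_sum_le[OF c]) auto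
  moreover have "side_sum H s - side_term x' s \<le> side_sum H s' - side_term x' s'"
    using us x' by (intro uncentered_side_sum_ge[OF u'(1)]) auto
  moreover have "side_term x' s - side_term x s < side_term x' r' - side_term x r'"
    using us x' x'0 r'' by (intro side_term_diff_less) auto
  ultimately have "side_sum (add_mset x G) r - 2 * pi / cosh r + (side_sum H s - side_term x s) <
      side_sum (add_mset x' G) r' - 2 * pi / cosh r' + (side_sum H s' - side_term x' s')"
    by simp
  then have "base_sum (add_mset x G) r + base_sum H s - base_angle x s <
    base_sum (add_mset x' G) r' + base_sum H s' - base_angle x' s'"
    unfolding base_sum_centered[OF c, symmetric] base_sum_centered[OF c'(1), symmetric]
      base_sum_uncentered[OF u, symmetric] base_sum_uncentered[OF u'(1), symmetric] by simp
  then show ?thesis using x' c' r'' r' u' order by blast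
qed

lemma shrink_centered_edge:
  assumes c: "centered (add_mset x G) r" and strict: "\<And>d. d \<in># add_mset x G \<Longrightarrow> d / 2 < r"
    and u: "uncentered x H s" and us: "x / 2 < s" and sr: "s \<le> r" and e: "0 < e"
  shows "\<exists>x' r' s'. x - e < x' \<and> x' < x \<and> centered (add_mset x' G) r' \<and>
    (\<forall>d\<in>#add_mset x' G. d / 2 < r') \<and> uncentered x' H s' \<and> x' / 2 < s' \<and> s' < r' \<and>
    r - e < r' \<and> r' < r \<and> s - e < s' \<and> s' < s \<and>
    base_sum (add_mset x G) r + base_sum H s - base_angle x s <
    base_sum (add_mset x' G) r' + base_sum H s' - base_angle x' s'"
proof (cases "s = r")
  case False
  with shrink_centered_edge_strict[OF c strict u us _ e] sr show ?thesis by simp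
next
  case True
  have x: "0 < x" using uncenteredD[OF u] by simp
  \<comment> \<open>Half of the allowance is kept for a second shortening: the first one is only
    shown to lose nothing, but it makes \<open>s' < r'\<close>, so that the strict case applies to
    its result.\<close>
  have e2: "0 < e / 2" using e by simp
  from centered_shrink_side[OF c strict e2] uncentered_shrink_longest[OF u us e2]
    eventually_at_left_real[of "x - e / 2" x]
  have "\<forall>\<^sub>F x' in at_left x. (\<exists>r'. centered (add_mset x' G) r' \<and> (\<forall>d\<in>#add_mset x' G. d / 2 < r') \<and>
       r - e / 2 < r' \<and> r' < r) \<and>
     (\<exists>s'. uncentered x' H s' \<and> x' / 2 < s' \<and> s - e / 2 < s' \<and> s' < s) \<and> x' \<in> {x - e / 2<..<x}"
    using e by (auto intro: eventually_conj)
  from eventually_happens'[OF trivial_limit_at_left_real this] obtain x' r' s' where x': "x - e / 2 < x'" "x' < x"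
    and c': "centered (add_mset x' G) r'" "\<forall>d\<in>#add_mset x' G. d / 2 < r'" "r - e / 2 < r'" "r' < r"
    and u': "uncentered x' H s'" "x' / 2 < s'" "s - e / 2 < s'" "s' < s"
    by auto
  have order: "s' < r'"
    using radius_order_shrink[OF c c'(1) u u'(1) x'(2)] sr c'(4) by simp
  txt \<open>At equal radii the two polygons fit together to a single centered polygon on the same
    circle, whose extremal property can be used instead.\<close>
  have "0 < d \<and> d / 2 \<le> r" if "d \<in># H" for d
    using uncenteredD(4)[OF u] uncenteredD(6,7)[OF u that] True by simp
  then have join: "centered (G + H) r"
    using c uncenteredD(5)[OF u] True by (auto simp: centered_def)
  have "side_sum (G + H) r - 2 * pi / cosh r \<le> side_sum (G + H) r' - 2 * pi / cosh r'"
    using c'(2) by (intro centered_side_sum_le[OF join]) (auto dest!: uncenteredD(7)[OF u'(1)])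
  moreover have "side_sum H r' - side_term x' r' \<le> side_sum H s' - side_term x' s'"
    using c'(2) by (intro uncentered_side_sum_ge[OF u'(1)]) auto
  ultimately have "side_sum (add_mset x G) r - 2 * pi / cosh r + (side_sum H s - side_term x s) \<le>
      side_sum (add_mset x' G) r' - 2 * pi / cosh r' + (side_sum H s' - side_term x' s')"
    using True by simp
  then have le: "base_sum (add_mset x G) r + base_sum H s - base_angle x s \<le>
    base_sum (add_mset x' G) r' + base_sum H s' - base_angle x' s'"
    unfolding base_sum_centered[OF c, symmetric] base_sum_centered[OF c'(1), symmetric]
      base_sum_uncentered[OF u, symmetric] base_sum_uncentered[OF u'(1), symmetric] by simp
  obtain x'' r'' s'' where
    *: "x' - e / 2 < x''" "x'' < x'" "centered (add_mset x'' G) r''"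
    "\<forall>d\<in>#add_mset x'' G. d / 2 < r''" "uncentered x'' H s''" "x'' / 2 < s''" "s'' < r''"
    "r' - e / 2 < r''" "r'' < r'" "s' - e / 2 < s''" "s'' < s'"
    "base_sum (add_mset x' G) r' + base_sum H s' - base_angle x' s' <
    base_sum (add_mset x'' G) r'' + base_sum H s'' - base_angle x'' s''"
    using shrink_centered_edge_strict[OF c'(1) _ u'(1,2) order e2] c'(2) by blast
  then show ?thesis using x' c' u' le
    by (intro exI[of _ x''] exI[of _ r''] exI[of _ s'']) simp
qed

text \<open>Both new polygons maximise their own sums, so both are tested at the old radii
  \<open>r\<close> and \<open>s\<close>. Since \<open>r\<close> goes up and \<open>s\<close> goes
  down, the order of the radii takes care of itself; for \<open>s = r\<close> the shared terms
  cancel and only the weak inequality is left.\<close>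

lemma shrink_uncentered_edge_le:
  assumes c: "uncentered x (add_mset y G) r"
    and u: "uncentered y H s" and us: "y / 2 < s" and sr: "s \<le> r" and e: "0 < e"
  shows "\<exists>y' r' s'. y - e < y' \<and> y' < y \<and> uncentered x (add_mset y' G) r' \<and>
    uncentered y' H s' \<and> y' / 2 < s' \<and> s' < r' \<and>
    r < r' \<and> r' < r + e \<and> s - e < s' \<and> s' < s \<and>
    base_sum (add_mset y G) r - base_angle x r + base_sum H s - base_angle y s \<le>
    base_sum (add_mset y' G) r' - base_angle x r' + base_sum H s' - base_angle y' s' \<and>
    (s < r \<longrightarrow> base_sum (add_mset y G) r - base_angle x r + base_sum H s - base_angle y s <
    base_sum (add_mset y' G) r' - base_angle x r' + base_sum H s' - base_angle y' s')"
proof -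
  from uncentered_shrink_side[OF c e] uncentered_shrink_longest[OF u us e]
    eventually_at_left_real[of "y - e" y]
  have "\<forall>\<^sub>F y' in at_left y. (\<exists>r'. uncentered x (add_mset y' G) r' \<and> r < r' \<and> r' < r + e) \<and>
     (\<exists>s'. uncentered y' H s' \<and> y' / 2 < s' \<and> s - e < s' \<and> s' < s) \<and> y' \<in> {y - e<..<y}"
    using e by (auto intro: eventually_conj)
  from eventually_happens'[OF trivial_limit_at_left_real this] obtain y' r' s' where y': "y - e < y'" "y' < y"
    and c': "uncentered x (add_mset y' G) r'" "r < r'" "r' < r + e"
    and u': "uncentered y' H s'" "y' / 2 < s'" "s - e < s'" "s' < s"
    by auto
  have y'0: "0 < y'" using uncenteredD[OF u'(1)] by simp
  have "side_sum (add_mset y' G) r - side_term x r \<le> side_sum (add_mset y' G) r' - side_term x r'"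
    using uncenteredD[OF c] by (intro uncentered_side_sum_ge[OF c'(1)]) auto
  moreover have "side_sum H s - side_term y' s \<le> side_sum H s' - side_term y' s'"
    using us y' by (intro uncentered_side_sum_ge[OF u'(1)]) auto
  moreover have strict: "side_term y' s - side_term y s < side_term y' r - side_term y r" if "s < r"
    using us y' y'0 that by (intro side_term_diff_less) auto
  moreover from this have "side_term y' s - side_term y s \<le> side_term y' r - side_term y r"
    using sr by (cases "s = r") auto
  ultimately have "side_sum (add_mset y G) r - side_term x r + (side_sum H s - side_term y s) \<le>
      side_sum (add_mset y' G) r' - side_term x r' + (side_sum H s' - side_term y' s')"
    "s < r \<Longrightarrow> side_sum (add_mset y G) r - side_term x r + (side_sum H s - side_term y s) <
      side_sum (add_mset y' G) r' - side_term x r' + (side_sum H s' - side_term y' s')"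
    by simp_all
  then have "base_sum (add_mset y G) r - base_angle x r + base_sum H s - base_angle y s \<le>
    base_sum (add_mset y' G) r' - base_angle x r' + base_sum H s' - base_angle y' s'"
    "s < r \<Longrightarrow> base_sum (add_mset y G) r - base_angle x r + base_sum H s - base_angle y s <
    base_sum (add_mset y' G) r' - base_angle x r' + base_sum H s' - base_angle y' s'"
    unfolding base_sum_uncentered[OF c, symmetric] base_sum_uncentered[OF c'(1), symmetric]
      base_sum_uncentered[OF u, symmetric] base_sum_uncentered[OF u'(1), symmetric] by simp_all
  moreover have "s' < r'" using c' u' sr by simp
  ultimately show ?thesis using y' c' u' by blast
qed

text \<open>Two shortenings with allowance \<open>e / 2\<close> each: the first separates the radii,
  so the second is strict.\<close>

lemma shrink_uncentered_edge:
  assumes c: "uncentered x (add_mset y G) r"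
    and u: "uncentered y H s" and us: "y / 2 < s" and sr: "s \<le> r" and e: "0 < e"
  shows "\<exists>y' r' s'. y - e < y' \<and> y' < y \<and> uncentered x (add_mset y' G) r' \<and>
    uncentered y' H s' \<and> s' < r' \<and> r < r' \<and> r' < r + e \<and> s - e < s' \<and> s' < s \<and>
    base_sum (add_mset y G) r - base_angle x r + base_sum H s - base_angle y s <
    base_sum (add_mset y' G) r' - base_angle x r' + base_sum H s' - base_angle y' s'"
proof -
  have e2: "0 < e / 2" using e by simp
  obtain y' r' s' where 1: "y - e / 2 < y'" "y' < y" "uncentered x (add_mset y' G) r'"
    "uncentered y' H s'" "y' / 2 < s'" "s' < r'" "r < r'" "r' < r + e / 2" "s - e / 2 < s'" "s' < s"
    "base_sum (add_mset y G) r - base_angle x r + base_sum H s - base_angle y s \<le>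
    base_sum (add_mset y' G) r' - base_angle x r' + base_sum H s' - base_angle y' s'"
    using shrink_uncentered_edge_le[OF c u us sr e2] by blast
  obtain y'' r'' s'' where 2: "y' - e / 2 < y''" "y'' < y'" "uncentered x (add_mset y'' G) r''"
    "uncentered y'' H s''" "s'' < r''" "r' < r''" "r'' < r' + e / 2" "s' - e / 2 < s''" "s'' < s'"
    "base_sum (add_mset y' G) r' - base_angle x r' + base_sum H s' - base_angle y' s' <
    base_sum (add_mset y'' G) r'' - base_angle x r'' + base_sum H s'' - base_angle y'' s''"
    using shrink_uncentered_edge_le[OF 1(3-5) less_imp_le[OF 1(6)] e2] 1(6) by blast
  show ?thesis using 1 2 by (intro exI[of _ y''] exI[of _ r''] exI[of _ s'']) simp
qed

section \<open>Membership in the spaces of side lengths\<close>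

lemma sum_nth_eq_sum_mset:
  fixes f :: "'a \<Rightarrow> 'b::comm_monoid_add"
  shows "(\<Sum>j<length xs. f (xs ! j)) = (\<Sum>d\<in>#mset xs. f d)"
  by (simp add: sum_mset_sum_list sum_list_sum_nth atLeast0LessThan flip: mset_map)

lemma sum_central_angle:
  assumes "\<forall>x\<in>set ds. 0 < x"
  shows "(\<Sum>j<length ds. central_angle (ds ! j) (Max (set ds) / 2)) =
    2 * angle_sum (mset ds) (Max (set ds) / 2)"
proof -
  have "(\<Sum>j<length ds. central_angle (ds ! j) (Max (set ds) / 2)) =
      (\<Sum>j<length ds. 2 * half_angle (ds ! j) (Max (set ds) / 2))"
    by (rule sum.cong) (use assms in \<open>auto simp: central_angle_eq_arcsin half_angle_def\<close>)
  also have "\<dots> = (\<Sum>d\<in>#mset ds. 2 * half_angle d (Max (set ds) / 2))"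
    by (rule sum_nth_eq_sum_mset)
  also have "\<dots> = 2 * angle_sum (mset ds) (Max (set ds) / 2)"
    by (simp only: angle_sum_def sum_mset_distrib_left)
  finally show ?thesis .
qed

lemma C_tilde_iff:
  "ds \<in> C_tilde n \<longleftrightarrow> length ds = n \<and> (\<forall>x\<in>set ds. 0 < x) \<and> pi < angle_sum (mset ds) (Max (set ds) / 2)"
  using sum_central_angle[of ds] by (auto simp: C_tilde_def)

lemma BC_tilde_iff:
  "ds \<in> BC_tilde n \<longleftrightarrow> length ds = n \<and> (\<forall>x\<in>set ds. 0 < x) \<and> angle_sum (mset ds) (Max (set ds) / 2) = pi"
  using sum_central_angle[of ds] by (auto simp: BC_tilde_def)

lemma AC_tilde_iff:
  "ds \<in> AC_tilde n \<longleftrightarrow> length ds = n \<and> (\<forall>x\<in>set ds. 0 < x) \<and>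
    (\<forall>d\<in>set ds. 2 * sinh (d / 2) < (\<Sum>e\<in>#mset ds. sinh (e / 2)))"
proof -
  have "(\<Sum>j\<in>{..<n} - {i}. sinh (ds ! j / 2)) = (\<Sum>e\<in>#mset ds. sinh (e / 2)) - sinh (ds ! i / 2)"
    if "i < n" "length ds = n" for i
    using that sum_nth_eq_sum_mset[of "\<lambda>e. sinh (e / 2)" ds] by (simp add: sum_diff1)
  then show ?thesis by (auto simp: AC_tilde_def all_set_conv_all_nth)
qed

lemma tendsto_angle_sum_at_top: "((\<lambda>r. angle_sum M r) \<longlongrightarrow> 0) at_top"
proof (induction M)
  case (add d M)
  have "((\<lambda>r. sinh (d / 2) / sinh r) \<longlongrightarrow> 0) at_top"
    by (intro tendsto_divide_0[OF tendsto_const] filterlim_at_top_imp_at_infinity sinh_real_at_top)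
  moreover have "isCont arcsin 0" by (intro isCont_arcsin) auto
  ultimately have "((\<lambda>r. half_angle d r) \<longlongrightarrow> arcsin 0) at_top"
    unfolding half_angle_def using isCont_tendsto_compose by blast
  from tendsto_add[OF this add.IH] show ?case by simp
qed simp

text \<open>The total angle exceeds \<open>pi\<close> on the circle with the longest side as
  diameter and tends to 0 for large radii. The strict excess at the start keeps every side shorter
  than the diameter at the radius found.\<close>

lemma C_tilde_imp_centered:
  assumes "ds \<in> C_tilde n"
  shows "\<exists>r. centered (mset ds) r \<and> (\<forall>d\<in>set ds. d / 2 < r)"
proof -
  define m where "m = Max (set ds) / 2"
  have pos: "\<And>d. d \<in> set ds \<Longrightarrow> 0 < d" and big: "pi < angle_sum (mset ds) m"
    using assms by (auto simp: C_tilde_iff m_def)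
  have le: "d / 2 \<le> m" if "d \<in> set ds" for d using that by (simp add: m_def)
  have "\<forall>\<^sub>F r in at_top. angle_sum (mset ds) r < pi"
    by (rule order_tendstoD[OF tendsto_angle_sum_at_top]) simp
  with eventually_ge_at_top[of m] have "\<forall>\<^sub>F r in at_top. m \<le> r \<and> angle_sum (mset ds) r < pi"
    by eventually_elim simp
  then obtain b where b: "m \<le> b" "angle_sum (mset ds) b < pi"
    using eventually_happens'[OF trivial_limit_at_top_linorder] by blast
  have "continuous_on {m..b} (\<lambda>r. angle_sum (mset ds) r)"
    by (rule continuous_on_angle_sum) (use pos le in \<open>force intro: continuous_intros\<close>)+
  then obtain r where r: "m \<le> r" "angle_sum (mset ds) r = pi"
    using IVT2'[of "\<lambda>r. angle_sum (mset ds) r" b pi m] b big by auto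
  moreover from this big have "m < r" by (cases "m = r") auto
  ultimately show ?thesis using pos le unfolding centered_def by (intro exI[of _ r]) force
qed

lemma centered_imp_C_tilde:
  assumes "centered (mset ds) r" "\<And>d. d \<in> set ds \<Longrightarrow> d / 2 < r" "length ds = n"
  shows "ds \<in> C_tilde n"
proof -
  have ne: "set ds \<noteq> {}" using centered_nonempty[OF assms(1)] by simp
  then have "Max (set ds) / 2 < r" using assms(2)[of "Max (set ds)"] by simp
  then have "angle_sum (mset ds) r < angle_sum (mset ds) (Max (set ds) / 2)"
    by (intro angle_sum_strict_anti) (use assms(1) centered_nonempty in \<open>auto simp: centered_def\<close>)
  then show ?thesis using assms by (auto simp: C_tilde_iff centered_def)
qed

lemma centered_imp_BC_tilde:
  assumes "centered (mset ds) r" "d \<in> set ds" "d / 2 = r" "length ds = n"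
  shows "ds \<in> BC_tilde n"
proof -
  have "Max (set ds) = d"
    by (rule Max_eqI) (use assms in \<open>auto simp: centered_def\<close>)
  then show ?thesis using assms by (auto simp: BC_tilde_iff centered_def)
qed

lemma uncentered_Max:
  assumes "uncentered x M r" "mset ds = add_mset x M"
  shows "Max (set ds) = x"
proof -
  have "set ds = insert x (set_mset M)" using assms(2) by (metis set_mset_add_mset_insert set_mset_mset)
  then show ?thesis using uncenteredD(7)[OF assms(1)] by (intro Max_eqI) (auto intro: less_imp_le)
qed

lemma uncentered_imp_BC_tilde:
  assumes "uncentered x M r" "mset ds = add_mset x M" "x / 2 = r" "length ds = n"
  shows "ds \<in> BC_tilde n"
proof -
  note u = uncenteredD[OF assms(1)]
  have "set ds = insert x (set_mset M)" using assms(2) by (metis set_mset_add_mset_insert set_mset_mset)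
  then show ?thesis
    using u half_angle_half[OF u(2)] by (simp add: BC_tilde_iff uncentered_Max[OF assms(1,2)] assms(2-4))
qed

text \<open>\<open>sinh r * sin a\<close> is the sinh of half the chord over an arc
  \<open>2 * a\<close>, so one chord is compared with a broken line along its arc. The reason is
  subadditivity of sine up to \<open>pi / 2\<close>.\<close>

lemma sin_angle_sum_less:
  assumes "2 \<le> size M" "\<And>d. d \<in># M \<Longrightarrow> 0 < d \<and> d / 2 \<le> r" "angle_sum M r \<le> pi / 2"
  shows "sinh r * sin (angle_sum M r) < (\<Sum>d\<in>#M. sinh (d / 2))"
proof -
  have le: "sinh r * sin (angle_sum M r) \<le> (\<Sum>d\<in>#M. sinh (d / 2))"
    if "\<And>d. d \<in># M \<Longrightarrow> 0 < d \<and> d / 2 \<le> r" "angle_sum M r \<le> pi / 2" for M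
    using that
  proof (induction M)
    case (add d M)
    have "0 < half_angle d r" using add.prems by (auto intro: half_angle_pos)
    moreover have "0 \<le> angle_sum M r" using add.prems by (intro angle_sum_nonneg) auto
    ultimately have a: "0 < half_angle d r" "0 \<le> angle_sum M r" "half_angle d r + angle_sum M r \<le> pi / 2"
      using add.prems(2) by auto
    have r: "0 < sinh r" using add.prems(1)[of d] by auto
    have "sin (half_angle d r + angle_sum M r) =
        sin (half_angle d r) * cos (angle_sum M r) + cos (half_angle d r) * sin (angle_sum M r)"
      by (rule sin_add)
    also have "\<dots> \<le> sin (half_angle d r) + sin (angle_sum M r)"
      using a by (intro add_mono mult_left_le mult_left_le_one_le) (auto intro!: sin_ge_zero cos_ge_zero)
    finally have "sinh r * sin (half_angle d r + angle_sum M r) \<le>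
       sinh r * sin (half_angle d r) + sinh r * sin (angle_sum M r)"
      using r by (simp flip: distrib_left)
    then show ?case using add a sin_half_angle[of d r] by auto
  qed simp
  \<comment> \<open>Splitting off one side leaves a nonempty rest with a positive angle, whose
    cosine is below 1; this makes the estimate strict.\<close>
  obtain d N where "M = add_mset d N" using assms(1) by (cases M) auto
  with assms(1) have M: "M = add_mset d N" "N \<noteq> {#}" by auto
  have d: "0 < d" "d / 2 \<le> r" using assms(2) M by auto
  have r: "0 < sinh r" using d by auto
  obtain e where e: "e \<in># N" using M by blast
  have "half_angle e r \<le> angle_sum N r" "0 < half_angle e r"
    using assms(2) M e by (auto intro!: angle_sum_ge_member half_angle_pos)
  then have a: "0 < half_angle d r" "0 < angle_sum N r" "half_angle d r + angle_sum N r \<le> pi / 2"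
    using assms(3) M half_angle_pos[OF d] by auto
  have c: "cos (angle_sum N r) < 1" using a cos_monotone_0_pi[of 0 "angle_sum N r"] by simp
  have "sin (half_angle d r + angle_sum N r) =
      sin (half_angle d r) * cos (angle_sum N r) + cos (half_angle d r) * sin (angle_sum N r)"
    by (rule sin_add)
  also have "\<dots> < sin (half_angle d r) * 1 + sin (angle_sum N r)"
    using a c by (intro add_less_le_mono mult_strict_left_mono mult_left_le_one_le)
      (auto intro!: sin_ge_zero cos_ge_zero sin_gt_zero)
  finally have "sinh r * sin (half_angle d r + angle_sum N r) <
      sinh r * sin (half_angle d r) + sinh r * sin (angle_sum N r)"
    using r by (simp flip: distrib_left)
  also have "\<dots> \<le> sinh (d / 2) + (\<Sum>d\<in>#N. sinh (d / 2))"
    using le[of N] assms(2) M a sin_half_angle[OF d] by auto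
  finally show ?thesis using M by simp
qed

text \<open>The other sides run along the arc of the longest one. Besides the polygon inequality,
  this later bounds all edge lengths of a configuration.\<close>

lemma uncentered_side_bound:
  assumes "uncentered x M r"
  shows "sinh (x / 2) < (\<Sum>d\<in>#M. sinh (d / 2))"
proof -
  note v = uncenteredD[OF assms]
  have "0 < d \<and> d / 2 \<le> r" if "d \<in># M" for d using v(6,7)[OF that] v(4) by simp
  then have "sinh r * sin (angle_sum M r) < (\<Sum>d\<in>#M. sinh (d / 2))"
    using v(5,8) half_angle_le[OF v(2,4)] by (intro sin_angle_sum_less) auto
  then show ?thesis using sin_half_angle[OF v(2,4)] v(5) by simp
qed

lemma uncentered_imp_AC_tilde:
  assumes u: "uncentered x M r" and m: "mset ds = add_mset x M" and n: "length ds = n"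
  shows "ds \<in> AC_tilde n - C_tilde n"
proof -
  note v = uncenteredD[OF u]
  have set: "set ds = insert x (set_mset M)" using m by (metis set_mset_add_mset_insert set_mset_mset)
  have "2 * sinh (x / 2) < (\<Sum>e\<in>#mset ds. sinh (e / 2))" using uncentered_side_bound[OF u] m by simp
  moreover have "sinh (d / 2) \<le> sinh (x / 2)" if "d \<in> set ds" for d
    using that set v by (auto intro: less_imp_le)
  ultimately have "\<forall>d\<in>set ds. 2 * sinh (d / 2) < (\<Sum>e\<in>#mset ds. sinh (e / 2))"
    by (meson order.strict_trans1 mult_left_mono zero_le_numeral)
  moreover have "\<forall>d\<in>set ds. 0 < d" using v set by auto
  ultimately have "ds \<in> AC_tilde n" using n by (simp add: AC_tilde_iff)
  \<comment> \<open>On the circle with diameter \<open>x\<close> this side has half angle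
    \<open>pi / 2\<close>, so a total above \<open>pi\<close> would put the other sides ahead there
    and, by the single crossing, at \<open>r\<close> too.\<close>
  moreover have "\<not> pi < angle_sum (mset ds) (Max (set ds) / 2)"
  proof
    assume "pi < angle_sum (mset ds) (Max (set ds) / 2)"
    then have *: "pi / 2 < angle_sum M (x / 2)"
      using m half_angle_half[OF v(2)] by (simp add: uncentered_Max[OF u m])
    then have "x / 2 \<noteq> r" using v(5) half_angle_half[OF v(2)] by auto
    then have "half_angle x r < angle_sum M r"
      using angle_sum_greater_radius[OF v(1), of x "x / 2" r] v * half_angle_half[OF v(2)] by auto
    then show False using v by simp
  qed
  ultimately show ?thesis by (auto simp: C_tilde_iff)
qed

text \<open>The root is found between half the longest side, where the other sides do not suffice, and
  a large radius, where \<open>sinh r\<close> times the half angle is close to \<open>sinh (d / 2)\<close>.\<close>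

lemma AC_tilde_imp_uncentered:
  assumes "ds \<in> AC_tilde n - C_tilde n" "3 \<le> n" "Max (set ds) = x" "mset ds = add_mset x M"
  shows "\<exists>r. uncentered x M r"
proof -
  have len: "length ds = n" and pos: "\<And>d. d \<in> set ds \<Longrightarrow> 0 < d"
    and ac: "\<And>d. d \<in> set ds \<Longrightarrow> 2 * sinh (d / 2) < (\<Sum>e\<in>#mset ds. sinh (e / 2))"
    using assms(1) by (auto simp: AC_tilde_iff)
  have notC: "angle_sum (mset ds) (x / 2) \<le> pi"
    using assms(1,3) pos len by (auto simp: C_tilde_iff)
  have set: "set ds = insert x (set_mset M)"
    using assms(4) by (metis set_mset_add_mset_insert set_mset_mset)
  have "size (mset ds) = size (add_mset x M)" using assms(4) by (rule arg_cong)
  then have size: "2 \<le> size M" using assms(2) len by simp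
  have x: "0 < x" using pos set by auto
  have Mle: "0 < d \<and> d \<le> x" if "d \<in># M" for d
  proof -
    have "d \<in> set ds" using that set by simp
    then show ?thesis using pos Max_ge[OF finite_set, of d ds] assms(3) by simp
  qed
  define S where "S = (\<Sum>d\<in>#M. sinh (d / 2))"
  have S: "sinh (x / 2) < S" using ac[of x] set assms(4) by (simp add: S_def)
  have low: "angle_sum M (x / 2) \<le> half_angle x (x / 2)"
    using notC assms(4) half_angle_half[OF x] by simp
  \<comment> \<open>Here \<open>u\<close> stands for \<open>1 / sinh r\<close>. The derivative at 0
    is \<open>S\<close>, so the strict polygon inequality \<open>sinh (x / 2) < S\<close> yields
    \<open>sinh (x / 2) < sin (S * u) / u\<close> for small \<open>u\<close>.\<close>
  have "((\<lambda>u. sin (S * u)) has_real_derivative cos (S * 0) * S) (at 0)"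
    by (auto intro!: derivative_eq_intros)
  then have "((\<lambda>u. sin (S * u) / u) \<longlongrightarrow> S) (at 0)" by (simp add: DERIV_def)
  then have "((\<lambda>u. sin (S * u) / u) \<longlongrightarrow> S) (at_right 0)" by (simp add: filterlim_at_split)
  then have *: "\<forall>\<^sub>F u in at_right 0. sinh (x / 2) < sin (S * u) / u"
    using S by (rule order_tendstoD)
  have S0: "0 < S" using S x by (meson less_trans sinh_real_pos_iff half_gt_zero)
  have lim: "filterlim (\<lambda>r. inverse (sinh r)) (at_right 0) (at_top :: real filter)"
    by (intro filterlim_compose[OF filterlim_inverse_at_right_top] sinh_real_at_top)
  \<comment> \<open>The bound \<open>pi / (2 * S)\<close> keeps \<open>S * u\<close> where sine is
    increasing, so that an inequality of sines can be turned back into one of angles.\<close>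
  have near: "\<forall>\<^sub>F u in at_right (0::real). sinh (x / 2) < sin (S * u) / u \<and> u \<in> {0<..<pi / (2 * S)}"
    using S0 by (intro eventually_conj[OF *] eventually_at_right_real) simp
  have "\<forall>\<^sub>F r in at_top. sinh (x / 2) < sin (S * inverse (sinh r)) / inverse (sinh r) \<and>
      inverse (sinh r) \<in> {0<..<pi / (2 * S)}"
    by (rule eventually_compose_filterlim[OF near lim])
  with eventually_ge_at_top[of "x / 2"] have "\<forall>\<^sub>F r in at_top. x / 2 \<le> r \<and>
     sinh (x / 2) < sin (S * inverse (sinh r)) / inverse (sinh r) \<and>
      inverse (sinh r) \<in> {0<..<pi / (2 * S)}" by eventually_elim simp
  from eventually_happens'[OF trivial_limit_at_top_linorder this] obtain b where
    b: "x / 2 \<le> b" "sinh (x / 2) < sin (S * inverse (sinh b)) / inverse (sinh b)"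
      "inverse (sinh b) < pi / (2 * S)" by auto
  have sb: "0 < sinh b" using b x by auto
  have Sb: "0 \<le> S / sinh b" "S / sinh b \<le> pi / 2" using b sb S0 by (auto simp: field_simps)
  have "sinh (x / 2) / sinh b < sin (S / sinh b)" using b(2) sb by (simp add: field_simps)
  moreover have "sinh (x/2) / sinh b = sin (half_angle x b)"
    using sin_half_angle[OF x b(1)] sb by (simp add: field_simps)
  ultimately have less: "sin (half_angle x b) < sin (S / sinh b)" by simp
  have "half_angle x b < S / sinh b"
  proof (rule ccontr)
    assume "\<not> ?thesis"
    then have "sin (S / sinh b) \<le> sin (half_angle x b)"
      using Sb(1) half_angle_le[OF x b(1)] by (intro sin_monotone_2pi_le) auto
    then show False using less by simp
  qed
  also have "S / sinh b = (\<Sum>d\<in>#M. sin (half_angle d b))"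
  proof -
    have "sin (half_angle d b) = sinh (d / 2) * inverse (sinh b)" if "d \<in># M" for d
    proof -
      have "d / 2 \<le> b" using Mle[OF that] b(1) by linarith
      then have "sinh (d / 2) = sinh b * sin (half_angle d b)" using Mle[OF that] sin_half_angle by simp
      then show ?thesis using sb by simp
    qed
    then have "image_mset (\<lambda>d. sin (half_angle d b)) M = image_mset (\<lambda>d. sinh (d / 2) * inverse (sinh b)) M"
      by (rule image_mset_cong)
    then show ?thesis by (simp only: S_def sum_mset_distrib_right divide_inverse)
  qed
  also have "\<dots> \<le> angle_sum M b" unfolding angle_sum_def
  proof (rule sum_mset_mono)
    fix d assume "d \<in># M"
    then have "0 < half_angle d b" using Mle[of d] b by (intro half_angle_pos) auto
    then show "sin (half_angle d b) \<le> half_angle d b" by (intro sin_x_le_x) simp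
  qed
  finally have high: "half_angle x b < angle_sum M b" .
  have "0 < d \<and> d / 2 \<le> z" if "z \<in> {x / 2..b}" "d \<in># M" for z d
    using Mle[OF that(2)] that(1) by simp
  then have "continuous_on {x / 2..b} (\<lambda>z. angle_sum M z - half_angle x z)"
    using x by (intro continuous_on_diff continuous_on_angle_sum continuous_on_half_angle continuous_on_const continuous_on_id) auto
  then obtain r where "x / 2 \<le> r" "angle_sum M r - half_angle x r = 0"
    using IVT'[of "\<lambda>z. angle_sum M z - half_angle x z" "x / 2" 0 b] low high b by auto
  then show ?thesis using Mle size unfolding uncentered_def by (intro exI[of _ r]) auto
qed

section \<open>Points on a circle in the hyperboloid model\<close>

text \<open>The Euclidean cross product with its last entry negated, so that
  \<open>lorentz w (lorentz_cross u v)\<close> is the determinant of \<open>w\<close>,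
  \<open>u\<close>, \<open>v\<close>.\<close>

definition lorentz_cross :: "real^3 \<Rightarrow> real^3 \<Rightarrow> real^3" where
  "lorentz_cross u v = vector [u$2 * v$3 - u$3 * v$2, u$3 * v$1 - u$1 * v$3, u$2 * v$1 - u$1 * v$2]"

definition frame :: "real^3 \<Rightarrow> real^3 \<Rightarrow> real^3 \<Rightarrow> bool" where
  "frame c e f \<longleftrightarrow> lorentz c c = -1 \<and> lorentz e e = 1 \<and> lorentz c e = 0 \<and>
     (f = lorentz_cross c e \<or> f = - lorentz_cross c e)"

definition circle_point :: "real^3 \<Rightarrow> real^3 \<Rightarrow> real^3 \<Rightarrow> real \<Rightarrow> real \<Rightarrow> real^3" where
  "circle_point c e f r t = cosh r *\<^sub>R c + sinh r *\<^sub>R (cos t *\<^sub>R e + sin t *\<^sub>R f)"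

lemma lorentz_add_left [simp]: "lorentz (x + y) z = lorentz x z + lorentz y z"
  and lorentz_add_right [simp]: "lorentz z (x + y) = lorentz z x + lorentz z y"
  and lorentz_scale_left [simp]: "lorentz (a *\<^sub>R x) z = a * lorentz x z"
  and lorentz_scale_right [simp]: "lorentz z (a *\<^sub>R x) = a * lorentz z x"
  and lorentz_diff_left [simp]: "lorentz (x - y) z = lorentz x z - lorentz y z"
  and lorentz_diff_right [simp]: "lorentz z (x - y) = lorentz z x - lorentz z y"
  and lorentz_minus_left [simp]: "lorentz (- x) z = - lorentz x z"
  and lorentz_minus_right [simp]: "lorentz z (- x) = - lorentz z x"
  by (simp_all add: lorentz_def algebra_simps)


lemma lorentz_commute: "lorentz x y = lorentz y x"
  by (simp add: lorentz_def mult.commute)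

lemma lorentz_cross_orth: "lorentz c (lorentz_cross c e) = 0" "lorentz c (lorentz_cross e c) = 0"
  by (simp_all add: lorentz_def lorentz_cross_def vector_3 algebra_simps)

lemma lorentz_cross_self:
  "lorentz (lorentz_cross u v) (lorentz_cross u v) = (lorentz u v)\<^sup>2 - lorentz u u * lorentz v v"
  by (simp add: lorentz_def lorentz_cross_def vector_3) algebra

lemma frameD:
  assumes "frame c e f"
  shows "lorentz c c = -1" "lorentz e e = 1" "lorentz f f = 1" "lorentz c e = 0" "lorentz e c = 0"
    "lorentz c f = 0" "lorentz f c = 0" "lorentz e f = 0" "lorentz f e = 0"
  using assms lorentz_cross_orth(1)[of c e] lorentz_cross_orth(2)[of e c] lorentz_cross_self[of c e]
  by (auto simp: frame_def lorentz_commute[of e c] lorentz_commute[of f c] lorentz_commute[of f e])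

lemma frame_uminus: "frame c e f \<Longrightarrow> frame c e (- f)"
  by (auto simp: frame_def)

text \<open>Cramer's rule for the Lorentz form: a vector is recovered from its products with a
  basis. In particular a vector orthogonal to a whole frame vanishes.\<close>

lemma line_side_scale:
  "line_side u v w *\<^sub>R y = lorentz y u *\<^sub>R lorentz_cross v w +
     lorentz y v *\<^sub>R lorentz_cross w u + lorentz y w *\<^sub>R lorentz_cross u v"
  by (simp add: vec_eq_iff forall_3 line_side_def det_3 vector_3 lorentz_def lorentz_cross_def algebra_simps)

text \<open>Multilinear expansion; the bracket is twice the signed area of the Euclidean triangle
  with corners \<open>(a1, b1)\<close>, \<open>(a2, b2)\<close>, \<open>(a3, b3)\<close>.\<close>

lemma line_side_combination:
  "line_side (h *\<^sub>R u + a1 *\<^sub>R v + b1 *\<^sub>R w) (h *\<^sub>R u + a2 *\<^sub>R v + b2 *\<^sub>R w)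
     (h *\<^sub>R u + a3 *\<^sub>R v + b3 *\<^sub>R w) =
   h * ((a2 * b3 - a3 * b2) - (a1 * b3 - a3 * b1) + (a1 * b2 - a2 * b1)) * line_side u v w"
  by (simp add: line_side_def det_3 vector_3 algebra_simps)

lemma line_side_frame:
  assumes "frame c e f"
  shows "line_side c e f \<noteq> 0"
proof -
  have "line_side c e f = lorentz f (lorentz_cross c e)"
    by (simp add: line_side_def det_3 vector_3 lorentz_def lorentz_cross_def algebra_simps)
  then show ?thesis using assms lorentz_cross_self[of c e] by (auto simp: frame_def)
qed

lemma frame_expand:
  assumes "frame c e f"
  shows "x = - lorentz x c *\<^sub>R c + lorentz x e *\<^sub>R e + lorentz x f *\<^sub>R f"
proof -
  define y where "y = x + - (- lorentz x c *\<^sub>R c + lorentz x e *\<^sub>R e + lorentz x f *\<^sub>R f)"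
  have "lorentz y c = 0" "lorentz y e = 0" "lorentz y f = 0"
    by (simp_all add: y_def frameD[OF assms])
  then have "line_side c e f *\<^sub>R y = 0" unfolding line_side_scale by simp
  then have "y = 0" using line_side_frame[OF assms] by simp
  then show ?thesis by (simp add: y_def algebra_simps eq_neg_iff_add_eq_0)
qed

lemma lorentz_circle_point:
  assumes "frame c e f"
  shows "lorentz (circle_point c e f r s) (circle_point c e f r t) =
    - 1 - 2 * (sinh r)\<^sup>2 * (sin ((t - s) / 2))\<^sup>2"
proof -
  have "cos (t - s) = 1 - 2 * (sin ((t - s) / 2))\<^sup>2"
    using cos_double_sin[of "(t - s) / 2"] by (metis field_sum_of_halves mult_2)
  moreover have "lorentz (circle_point c e f r s) (circle_point c e f r t) =
     - (cosh r)\<^sup>2 + (sinh r)\<^sup>2 * cos (t - s)"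
    by (simp add: circle_point_def frameD[OF assms] cos_diff algebra_simps power2_eq_square)
  ultimately show ?thesis unfolding cosh_square_eq by algebra
qed

lemma hdist_circle_point:
  assumes "frame c e f" "0 \<le> r" "0 \<le> sin ((t - s) / 2)"
  shows "0 \<le> hdist (circle_point c e f r s) (circle_point c e f r t)"
    "sinh (hdist (circle_point c e f r s) (circle_point c e f r t) / 2) = sinh r * sin ((t - s) / 2)"
proof -
  define d where "d = hdist (circle_point c e f r s) (circle_point c e f r t)"
  define y where "y = sinh r * sin ((t - s) / 2)"
  have y: "0 \<le> y" using assms by (simp add: y_def)
  have d: "d = arcosh (1 + 2 * y\<^sup>2)"
    by (simp add: d_def hdist_def lorentz_circle_point[OF assms(1)] y_def power_mult_distrib add.commute mult.assoc)
  have d0: "0 \<le> d" unfolding d by simp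
  have "cosh d = 1 + 2 * y\<^sup>2" unfolding d by (intro cosh_arcosh_real) simp
  moreover have "cosh d = 1 + 2 * (sinh (d / 2))\<^sup>2"
    using cosh_double[of "d / 2"] by (simp add: cosh_square_eq)
  ultimately have "(sinh (d / 2))\<^sup>2 = y\<^sup>2" by simp
  then have "sinh (d / 2) = y" using y d0 by (simp add: power2_eq_iff_nonneg)
  then show "0 \<le> d" "sinh (d / 2) = sinh r * sin ((t - s) / 2)" using d0 by (simp_all add: y_def)
qed

text \<open>The sign of \<open>k\<close> records the orientation of the frame and drops out of a
  product of two values of \<open>line_side\<close>; what is left are signs of differences of polar
  angles.\<close>

lemma line_side_circle_point:
  assumes "frame c e f"
  shows "\<exists>k. k \<noteq> 0 \<and> (\<forall>s t u. line_side (circle_point c e f r s) (circle_point c e f r t) (circle_point c e f r u) =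
    k * (sinh r)\<^sup>2 * (sin ((t - s) / 2) * sin ((u - t) / 2) * sin ((u - s) / 2)))"
proof -
  define k0 where "k0 = line_side c e f"
  have "k0 \<noteq> 0" using line_side_frame[OF assms] by (simp add: k0_def)
  then have k: "4 * cosh r * k0 \<noteq> 0" by simp
  have sum: "sin (t - s) + sin (u - t) - sin (u - s) =
      4 * (sin ((t - s) / 2) * sin ((u - t) / 2) * sin ((u - s) / 2))" for s t u :: real
  proof -
    define a b where "a = (t - s) / 2" and "b = (u - t) / 2"
    have ab: "t - s = 2 * a" "u - t = 2 * b" "u - s = 2 * (a + b)" "(u - s) / 2 = a + b"
      by (auto simp: a_def b_def field_simps)
    have "sin (2 * a) + sin (2 * b) - sin (2 * (a + b)) = 4 * (sin a * sin b * sin (a + b))"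
    proof -
      have S: "sin (2 * (a + b)) = 2 * (sin a * cos a * (1 - 2 * (sin b)\<^sup>2) + sin b * cos b * (1 - 2 * (sin a)\<^sup>2))"
        unfolding distrib_left sin_add sin_double cos_double_sin by (simp add: algebra_simps)
      show ?thesis unfolding S unfolding sin_double sin_add by (simp add: power2_eq_square algebra_simps)
    qed
    moreover have "2 * a / 2 = a" "2 * b / 2 = b" "2 * (a + b) / 2 = a + b" by simp_all
    ultimately show ?thesis by (simp only: ab(1-3))
  qed
  have "line_side (circle_point c e f r s) (circle_point c e f r t) (circle_point c e f r u) =
     cosh r * (sinh r)\<^sup>2 * k0 * (sin (t - s) + sin (u - t) - sin (u - s))" for s t u
    unfolding circle_point_def scaleR_right_distrib scaleR_scaleR add.assoc[symmetric] line_side_combination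
    by (simp add: k0_def sin_diff power2_eq_square algebra_simps)
  then have "line_side (circle_point c e f r s) (circle_point c e f r t) (circle_point c e f r u) =
    4 * cosh r * k0 * (sinh r)\<^sup>2 * (sin ((t - s) / 2) * sin ((u - t) / 2) * sin ((u - s) / 2))" for s t u
    unfolding sum by (simp add: mult_ac)
  then show ?thesis using k by blast
qed

text \<open>The reversed Cauchy-Schwarz inequality with its equality case.\<close>

lemma lorentz_hyp_plane:
  assumes "x \<in> hyp_plane" "y \<in> hyp_plane"
  shows "lorentz x y \<le> -1" "lorentz x y = -1 \<Longrightarrow> x = y"
proof -
  have x: "x$3 * x$3 = 1 + x$1 * x$1 + x$2 * x$2" "0 < x$3"
    and y: "y$3 * y$3 = 1 + y$1 * y$1 + y$2 * y$2" "0 < y$3"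
    using assms by (auto simp: hyp_plane_def lorentz_def)
  \<comment> \<open>Lagrange's identity for \<open>(1, x$1, x$2)\<close> and
    \<open>(1, y$1, y$2)\<close>, whose Euclidean norms are \<open>x$3\<close> and
    \<open>y$3\<close>.\<close>
  have eq: "(x$3 * y$3)\<^sup>2 = (1 + x$1 * y$1 + x$2 * y$2)\<^sup>2 + ((x$1 - y$1)\<^sup>2 + (x$2 - y$2)\<^sup>2 + (x$1 * y$2 - x$2 * y$1)\<^sup>2)"
  proof -
    have "(x$3 * y$3)\<^sup>2 = (x$3 * x$3) * (y$3 * y$3)" by (simp add: power2_eq_square)
    also have "\<dots> = (1 + x$1 * x$1 + x$2 * x$2) * (1 + y$1 * y$1 + y$2 * y$2)" by (simp only: x(1) y(1))
    finally show ?thesis by (simp add: power2_eq_square algebra_simps)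
  qed
  have "(1 + x$1 * y$1 + x$2 * y$2)\<^sup>2 \<le> (x$3 * y$3)\<^sup>2"
    unfolding eq by simp
  then have "1 + x$1 * y$1 + x$2 * y$2 \<le> x$3 * y$3"
    by (rule power2_le_imp_le) (use x(2) y(2) in simp)
  then show "lorentz x y \<le> -1" by (simp add: lorentz_def)
  assume "lorentz x y = -1"
  then have "x$3 * y$3 = 1 + x$1 * y$1 + x$2 * y$2" by (simp add: lorentz_def)
  then have "(x$1 - y$1)\<^sup>2 + (x$2 - y$2)\<^sup>2 + (x$1 * y$2 - x$2 * y$1)\<^sup>2 = 0" using eq by simp
  then have 12: "x$1 = y$1" "x$2 = y$2" by (simp_all add: add_nonneg_eq_0_iff)
  then have "x$3 * x$3 = y$3 * y$3" by (simp only: x(1) y(1))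
  then have "x$3 = y$3" using x(2) y(2) by (simp add: power2_eq_iff_nonneg flip: power2_eq_square)
  then show "x = y" using 12 by (simp add: vec_eq_iff forall_3)
qed

lemma cosh_hdist:
  assumes "x \<in> hyp_plane" "y \<in> hyp_plane"
  shows "cosh (hdist x y) = - lorentz x y" "0 \<le> hdist x y"
  using lorentz_hyp_plane(1)[OF assms] by (auto simp: hdist_def)

lemma circle_point_ex:
  assumes "frame c e f" "c \<in> hyp_plane" "x \<in> hyp_plane" "hdist c x = r" "0 < r"
  shows "\<exists>t. 0 \<le> t \<and> t < 2 * pi \<and> x = circle_point c e f r t"
proof -
  define p q where "p = lorentz x e" and "q = lorentz x f"
  have c: "lorentz x c = - cosh r" using cosh_hdist[OF assms(2,3)] assms(4) lorentz_commute by force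
  have x: "x = cosh r *\<^sub>R c + p *\<^sub>R e + q *\<^sub>R f"
    using frame_expand[OF assms(1), of x] c by (simp add: p_def q_def)
  have "lorentz x x = -1" using assms(3) by (simp add: hyp_plane_def)
  moreover have "lorentz x x = - (cosh r)\<^sup>2 + p\<^sup>2 + q\<^sup>2"
    unfolding arg_cong2[where f = lorentz, OF x x] by (simp add: frameD[OF assms(1)] power2_eq_square)
  ultimately have pq: "p\<^sup>2 + q\<^sup>2 = (sinh r)\<^sup>2" by (simp add: cosh_square_eq)
  have s: "0 < sinh r" using assms by simp
  have "(p / sinh r)\<^sup>2 + (q / sinh r)\<^sup>2 = 1"
    using s pq by (simp add: power_divide flip: add_divide_distrib)
  then obtain t where "0 \<le> t" "t < 2 * pi" "p / sinh r = cos t" "q / sinh r = sin t"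
    using sincos_total_2pi by metis
  then have t: "0 \<le> t" "t < 2 * pi" "sinh r * cos t = p" "sinh r * sin t = q"
    using s by (simp_all add: field_simps)
  have "x = circle_point c e f r t"
    unfolding circle_point_def scaleR_right_distrib scaleR_scaleR t(3,4) add.assoc[symmetric] by (rule x)
  then show ?thesis using t by blast
qed

text \<open>The radius to the middle vertex cuts the angle into the base angles over the two arcs.
  For an arc beyond \<open>pi\<close> the cotangent is negative, so its base angle is subtracted, as
  it should be for a center outside the polygon.\<close>

lemma hangle_circle_point:
  assumes "frame c e f" "0 < r" "0 < a" "0 < b" "a < 2 * pi" "b < 2 * pi" "a + b \<le> 2 * pi"
  shows "hangle (circle_point c e f r (s - a)) (circle_point c e f r s) (circle_point c e f r (s + b)) =
    arctan (cot (a / 2) / cosh r) + arctan (cot (b / 2) / cosh r)"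
proof -
  define P where "P = circle_point c e f r"
  define h where "h = cosh r"
  define ka sa kb sb where "ka = cos (a / 2)" and "sa = sin (a / 2)" and "kb = cos (b / 2)" and "sb = sin (b / 2)"
  have pos: "0 < sinh r" "0 < h" "0 < sa" "0 < sb"
    using assms by (auto simp: h_def sa_def sb_def intro!: sin_gt_zero)
  have sc: "sa\<^sup>2 + ka\<^sup>2 = 1" "sb\<^sup>2 + kb\<^sup>2 = 1" by (simp_all add: sa_def ka_def sb_def kb_def)
  have h2: "h\<^sup>2 = (sinh r)\<^sup>2 + 1" by (simp add: h_def cosh_square_eq)
  have norm: "h\<^sup>2 * sa\<^sup>2 + ka\<^sup>2 = 1 + (sinh r)\<^sup>2 * sa\<^sup>2" "h\<^sup>2 * sb\<^sup>2 + kb\<^sup>2 = 1 + (sinh r)\<^sup>2 * sb\<^sup>2"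
    using sc by (simp_all add: h2 algebra_simps)
  have L: "lorentz (P s) (P s) = -1" "lorentz (P (s - a)) (P (s - a)) = -1" "lorentz (P (s + b)) (P (s + b)) = -1"
    "lorentz (P s) (P (s - a)) = - 1 - 2 * (sinh r)\<^sup>2 * sa\<^sup>2"
    "lorentz (P s) (P (s + b)) = - 1 - 2 * (sinh r)\<^sup>2 * sb\<^sup>2"
    "lorentz (P (s - a)) (P (s + b)) = - 1 - 2 * (sinh r)\<^sup>2 * (sin ((a + b) / 2))\<^sup>2"
    by (simp_all add: P_def lorentz_circle_point[OF assms(1)] sa_def sb_def add.commute)
  have sab: "sin ((a + b) / 2) = sa * kb + ka * sb"
    by (simp add: add_divide_distrib sin_add sa_def sb_def ka_def kb_def)
  have dir: "lorentz (hdirection (P s) x) (hdirection (P s) y) = lorentz x y + lorentz (P s) x * lorentz (P s) y"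
    for x y by (simp add: hdirection_def L(1) lorentz_commute[of x "P s"] algebra_simps)
  have uv: "lorentz (hdirection (P s) (P (s - a))) (hdirection (P s) (P (s + b))) =
      (2 * sinh r * sa) * (2 * sinh r * sb) * (h\<^sup>2 * sa * sb - ka * kb)"
  proof -
    have K: "ka\<^sup>2 = 1 - sa\<^sup>2" "kb\<^sup>2 = 1 - sb\<^sup>2" using sc by (simp_all only: eq_diff_eq add.commute)
    have X: "(sa * kb + ka * sb)\<^sup>2 = sa\<^sup>2 * (1 - sb\<^sup>2) + (1 - sa\<^sup>2) * sb\<^sup>2 + 2 * sa * sb * ka * kb"
      unfolding K[symmetric] by (simp add: power2_eq_square algebra_simps)
    show ?thesis unfolding dir L sab X h2 by (simp add: power2_eq_square algebra_simps)
  qed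
  have uu: "lorentz (hdirection (P s) (P (s - a))) (hdirection (P s) (P (s - a))) =
      (2 * sinh r * sa)\<^sup>2 * (h\<^sup>2 * sa\<^sup>2 + ka\<^sup>2)"
    unfolding dir L norm by (simp add: power2_eq_square algebra_simps)
  have vv: "lorentz (hdirection (P s) (P (s + b))) (hdirection (P s) (P (s + b))) =
      (2 * sinh r * sb)\<^sup>2 * (h\<^sup>2 * sb\<^sup>2 + kb\<^sup>2)"
    unfolding dir L norm by (simp add: power2_eq_square algebra_simps)
  define ta tb where "ta = arctan (cot (a / 2) / cosh r)" and "tb = arctan (cot (b / 2) / cosh r)"
  have arc: "cos (arctan (k / (h * z))) = h * z / sqrt (h\<^sup>2 * z\<^sup>2 + k\<^sup>2)"
    "sin (arctan (k / (h * z))) = k / sqrt (h\<^sup>2 * z\<^sup>2 + k\<^sup>2)" if "0 < z" for k z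
  proof -
    have hz: "0 < h * z" using pos that by simp
    have "1 + (k / (h * z))\<^sup>2 = (h\<^sup>2 * z\<^sup>2 + k\<^sup>2) / (h * z)\<^sup>2"
      using pos that by (simp add: add_divide_distrib power_divide power_mult_distrib)
    then have "sqrt (1 + (k / (h * z))\<^sup>2) = sqrt (h\<^sup>2 * z\<^sup>2 + k\<^sup>2) / (h * z)"
      using hz by (simp add: real_sqrt_divide)
    then show "cos (arctan (k / (h * z))) = h * z / sqrt (h\<^sup>2 * z\<^sup>2 + k\<^sup>2)"
      "sin (arctan (k / (h * z))) = k / sqrt (h\<^sup>2 * z\<^sup>2 + k\<^sup>2)"
      using hz pos that by (simp_all add: cos_arctan sin_arctan)
  qed
  have cab: "cot (a / 2) / cosh r = ka / (h * sa)" "cot (b / 2) / cosh r = kb / (h * sb)"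
    by (simp_all add: cot_def ka_def sa_def kb_def sb_def h_def field_simps)
  have "lorentz (hdirection (P s) (P (s - a))) (hdirection (P s) (P (s + b))) /
     (sqrt (lorentz (hdirection (P s) (P (s - a))) (hdirection (P s) (P (s - a)))) *
      sqrt (lorentz (hdirection (P s) (P (s + b))) (hdirection (P s) (P (s + b))))) =
     (h\<^sup>2 * sa * sb - ka * kb) / (sqrt (h\<^sup>2 * sa\<^sup>2 + ka\<^sup>2) * sqrt (h\<^sup>2 * sb\<^sup>2 + kb\<^sup>2))"
    unfolding uv uu vv using pos by (simp add: real_sqrt_mult)
  also have "\<dots> = cos (ta + tb)"
    unfolding ta_def tb_def cos_add cab arc[OF pos(3)] arc[OF pos(4)]
    by (simp add: diff_divide_distrib power2_eq_square mult_ac)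
  finally have "hangle (P (s - a)) (P s) (P (s + b)) = arccos (cos (ta + tb))"
    by (simp add: hangle_def Let_def)
  also have "\<dots> = ta + tb"
  proof (rule arccos_cos)
    show "ta + tb \<le> pi" using arctan_ubound[of "cot (a / 2) / cosh r"] arctan_ubound[of "cot (b / 2) / cosh r"]
      unfolding ta_def tb_def by linarith
    \<comment> \<open>The arcs do not overlap, as \<open>a + b\<close> is at most
      \<open>2 * pi\<close>; this makes the sum of the base angles nonnegative, so that arccos
      undoes the cosine.\<close>
    have "0 \<le> sin ((a + b) / 2)" using assms by (intro sin_ge_zero) auto
    then have "- (ka / (h * sa)) \<le> kb / (h * sb)" using pos sab by (simp add: field_simps)
    then have "- ta \<le> tb" unfolding ta_def tb_def cab by (simp add: arctan_le_iff flip: arctan_minus)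
    then show "0 \<le> ta + tb" by simp
  qed
  finally show ?thesis by (simp add: P_def ta_def tb_def)
qed

section \<open>Inscribed polygons\<close>

text \<open>The vertices have polar angles \<open>t 0 < \<dots> < t (n - 1)\<close> about the center \<open>c\<close>; setting \<open>t n\<close> to
  \<open>2 * pi\<close> instead of \<open>0\<close> makes the last side similar to the other ones.\<close>

definition inscribed :: "(real^3) list \<Rightarrow> real^3 \<Rightarrow> real^3 \<Rightarrow> real^3 \<Rightarrow> real \<Rightarrow> (nat \<Rightarrow> real) \<Rightarrow> bool" where
  "inscribed xs c e f r t \<longleftrightarrow> frame c e f \<and> 0 < r \<and> 3 \<le> length xs \<and> t 0 = 0 \<and> t (length xs) = 2 * pi \<and>
     (\<forall>i<length xs. t i < t (Suc i)) \<and> (\<forall>i<length xs. xs ! i = circle_point c e f r (t i))"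

lemma circle_point_periodic [simp]: "circle_point c e f r (t + 2 * pi) = circle_point c e f r t"
  "circle_point c e f r (2 * pi) = circle_point c e f r 0"
  by (simp_all add: circle_point_def)

lemma inscribedD:
  assumes "inscribed xs c e f r t"
  shows "frame c e f" "0 < r" "3 \<le> length xs" "t 0 = 0" "t (length xs) = 2 * pi"
    "\<And>i. i < length xs \<Longrightarrow> t i < t (Suc i)"
    "\<And>i. i < length xs \<Longrightarrow> xs ! i = circle_point c e f r (t i)"
  using assms by (auto simp: inscribed_def)

lemma inscribed_less:
  assumes "inscribed xs c e f r t" "i < j" "j \<le> length xs"
  shows "t i < t j"
  using assms(2,3)
proof (induction j)
  case (Suc j)
  have "t j < t (Suc j)" using Suc.prems inscribedD(6)[OF assms(1)] by auto
  then show ?case using Suc by (cases "i = j") auto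
qed simp

lemma inscribed_bounds:
  assumes "inscribed xs c e f r t" "i < length xs"
  shows "0 \<le> t i" "t i < 2 * pi" "0 < t (Suc i)" "t (Suc i) \<le> 2 * pi"
proof -
  note t = inscribed_less[OF assms(1)] and s = inscribedD(3-5)[OF assms(1)]
  show "0 \<le> t i" using t[of 0 i] s assms(2) by (cases "i = 0") auto
  show "t i < 2 * pi" using t[of i "length xs"] s assms(2) by auto
  show "0 < t (Suc i)" using t[of 0 "Suc i"] s assms(2) by auto
  show "t (Suc i) \<le> 2 * pi" using t[of "Suc i" "length xs"] s assms(2) by (cases "Suc i = length xs") auto
qed

lemma inscribed_Suc:
  assumes "inscribed xs c e f r t" "i < length xs"
  shows "xs ! (Suc i mod length xs) = circle_point c e f r (t (Suc i))"
proof (cases "Suc i = length xs")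
  case True
  moreover have "0 < length xs" using assms(2) by linarith
  ultimately show ?thesis using inscribedD(4,5)[OF assms(1)] inscribedD(7)[OF assms(1), of 0] by simp
next
  case False
  then show ?thesis using assms inscribedD(7)[OF assms(1)] by simp
qed

lemma inscribed_side:
  assumes "inscribed xs c e f r t" "i < length xs"
  shows "0 < side_lengths xs ! i" "sinh (side_lengths xs ! i / 2) = sinh r * sin ((t (Suc i) - t i) / 2)"
proof -
  note s = inscribedD[OF assms(1)]
  have "0 < (t (Suc i) - t i) / 2" "(t (Suc i) - t i) / 2 < pi \<or> (t (Suc i) - t i) / 2 = pi"
    using s(6)[OF assms(2)] inscribed_bounds[OF assms] by auto
  moreover have "(t (Suc i) - t i) / 2 \<noteq> pi"
  proof
    assume "(t (Suc i) - t i) / 2 = pi"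
    then have "t i = 0" "t (Suc i) = 2 * pi" using inscribed_bounds[OF assms] by auto
    then have "i = 0" "Suc i = length xs"
      using inscribed_less[OF assms(1), of 0 i] inscribed_less[OF assms(1), of "Suc i" "length xs"] s(4,5) assms(2)
      by (auto intro: Suc_lessI ccontr)
    then show False using s(3) by simp
  qed
  ultimately have sp: "0 < sin ((t (Suc i) - t i) / 2)" by (intro sin_gt_zero) auto
  have d: "side_lengths xs ! i = hdist (circle_point c e f r (t i)) (circle_point c e f r (t (Suc i)))"
    using assms(2) s(7) inscribed_Suc[OF assms] by (simp add: side_lengths_def)
  show eq: "sinh (side_lengths xs ! i / 2) = sinh r * sin ((t (Suc i) - t i) / 2)"
    unfolding d using hdist_circle_point(2)[OF s(1)] s(2) sp by simp
  have "0 < sinh (side_lengths xs ! i / 2)" unfolding eq using s(2) sp by simp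
  then show "0 < side_lengths xs ! i" by simp
qed

text \<open>Each arc contributes its base angle at both of its endpoints.\<close>

lemma inscribed_angles:
  assumes "inscribed xs c e f r t"
  shows "(\<Sum>i<length xs. interior_angle xs i) =
    2 * (\<Sum>i<length xs. arctan (cot ((t (Suc i) - t i) / 2) / cosh r))"
proof -
  note s = inscribedD[OF assms]
  obtain m where m: "length xs = Suc m" "2 \<le> m" using s(3) by (cases "length xs") auto
  define b where "b i = arctan (cot ((t (Suc i) - t i) / 2) / cosh r)" for i
  have len: "0 < t (Suc i) - t i" "t (Suc i) - t i < 2 * pi" if "i < length xs" for i
  proof -
    show "0 < t (Suc i) - t i" using s(6) that by auto
    show "t (Suc i) - t i < 2 * pi"
      using inscribed_bounds[OF assms that] inscribed_less[OF assms, of 0 i]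
        inscribed_less[OF assms, of "Suc i" "length xs"] s(3-5) that
      by (cases "i = 0") auto
  qed
  have ang: "interior_angle xs i = b ((i + m) mod Suc m) + b i" if "i < length xs" for i
  proof (cases i)
    case 0
    \<comment> \<open>The arc before vertex 0 is the last one, ending at \<open>2 * pi\<close>, so
      its start is shifted back by a full turn.\<close>
    have xm: "xs ! m = circle_point c e f r (t 0 - (t (Suc m) - t m))"
      using s(4,5) s(7)[of m] m circle_point_periodic(1)[of c e f r "t m - 2 * pi"] by simp
    have x1: "xs ! (Suc 0 mod length xs) = circle_point c e f r (t 0 + (t (Suc 0) - t 0))"
      using inscribed_Suc[OF assms, of 0] m by simp
    have "t (Suc 0) < t m" using inscribed_less[OF assms, of 1 m] m by simp
    then have "hangle (circle_point c e f r (t 0 - (t (Suc m) - t m))) (circle_point c e f r (t 0))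
        (circle_point c e f r (t 0 + (t (Suc 0) - t 0))) = b m + b 0"
      unfolding b_def using len[of 0] len[of m] m s(4,5)
      by (intro hangle_circle_point[OF s(1,2)]) auto
    moreover have "(0 + length xs - 1) mod length xs = m" using m by simp
    moreover have "xs ! 0 = circle_point c e f r (t 0)" using s(7)[of 0] m by simp
    ultimately show ?thesis using x1 xm 0 by (simp add: interior_angle_def Let_def m)
  next
    case (Suc k)
    have "(Suc k + m) mod Suc m = k" using that m Suc by (metis Suc_lessD add_Suc_shift mod_add_self2 mod_less)
    moreover have "(Suc k + length xs - 1) mod length xs = k" using that m Suc calculation by simp
    moreover have "xs ! k = circle_point c e f r (t (Suc k) - (t (Suc k) - t k))"
      using s(7)[of k] that Suc by simp
    moreover have "xs ! (Suc (Suc k) mod length xs) = circle_point c e f r (t (Suc k) + (t (Suc (Suc k)) - t (Suc k)))"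
      using inscribed_Suc[OF assms, of "Suc k"] that Suc by simp
    moreover have "hangle (circle_point c e f r (t (Suc k) - (t (Suc k) - t k))) (circle_point c e f r (t (Suc k)))
        (circle_point c e f r (t (Suc k) + (t (Suc (Suc k)) - t (Suc k)))) = b k + b (Suc k)"
      unfolding b_def using len[of k] len[of "Suc k"] that Suc
        inscribed_bounds[OF assms, of k] inscribed_bounds[OF assms, of "Suc k"]
      by (intro hangle_circle_point[OF s(1,2)]) auto
    moreover have "xs ! Suc k = circle_point c e f r (t (Suc k))" using s(7) that Suc by simp
    ultimately show ?thesis using Suc by (simp add: interior_angle_def Let_def)
  qed
  have "(\<Sum>i<Suc m. b ((i + m) mod Suc m)) = b m + (\<Sum>i<m. b ((Suc i + m) mod Suc m))"
    by (subst sum.lessThan_Suc_shift) simp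
  also have "(\<Sum>i<m. b ((Suc i + m) mod Suc m)) = (\<Sum>i<m. b i)"
    by (rule sum.cong) (auto simp: mod_add_self2 simp flip: add_Suc_right)
  finally have "(\<Sum>i<Suc m. b ((i + m) mod Suc m)) = (\<Sum>i<Suc m. b i)" by simp
  then show ?thesis
    using ang by (simp add: m(1) sum.distrib b_def del: sum.lessThan_Suc)
qed

text \<open>A chord determines only the sine of half its arc, and \<open>half_angle\<close> takes
  the minor arc. For a major arc it is the supplement, and the base angle changes its sign.\<close>

lemma half_angle_arc:
  assumes "0 < d" "0 < r" "0 < a" "a < 2 * pi" "sinh (d / 2) = sinh r * sin (a / 2)"
  shows "d / 2 \<le> r"
    "half_angle d r = (if a \<le> pi then a / 2 else pi - a / 2)"
    "base_angle d r = (if a \<le> pi then 1 else -1) * arctan (cot (a / 2) / cosh r)"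
proof -
  have "sinh (d / 2) \<le> sinh r" using assms by (simp add: mult_left_le)
  then show "d / 2 \<le> r" by simp
  show h: "half_angle d r = (if a \<le> pi then a / 2 else pi - a / 2)"
    using assms by (intro half_angle_unique) auto
  show "base_angle d r = (if a \<le> pi then 1 else -1) * arctan (cot (a / 2) / cosh r)"
  proof (cases "a \<le> pi")
    case False
    have "cot (pi - a / 2) = - cot (a / 2)" by (simp add: cot_def)
    then show ?thesis using False by (simp add: base_angle_def h arctan_minus)
  qed (simp add: base_angle_def h)
qed

text \<open>The number \<open>b\<close> is half the sum of the interior angles.\<close>

definition polygon_data :: "real multiset \<Rightarrow> real \<Rightarrow> real \<Rightarrow> bool" where
  "polygon_data M r b \<longleftrightarrow> centered M r \<and> b = base_sum M r \<or>
     (\<exists>x N. M = add_mset x N \<and> uncentered x N r \<and> b = base_sum N r - base_angle x r)"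

text \<open>Both angle conditions together force the half angle of \<open>x\<close> to be
  \<open>pi / 2\<close>, so \<open>x\<close> is a diameter and its triangle is flat. Thus the two
  descriptions in \<open>polygon_data\<close> agree where they overlap.\<close>

lemma uncentered_eq_centered:
  assumes "uncentered x M r" "centered (add_mset x M) r"
  shows "base_angle x r = 0"
proof -
  note u = uncenteredD[OF assms(1)]
  have "half_angle x r = pi / 2" using assms(2) u(5) by (simp add: centered_def)
  then have "r = x / 2" using half_angle_less_pi_half[of x r] u by fastforce
  then show ?thesis using base_angle_half[OF u(2)] by (simp only:)
qed

lemma polygon_data_unique:
  assumes "polygon_data M r b" "polygon_data M r' b'"
  shows "r = r' \<and> b = b'"
proof -
  have mixed: "r = r' \<and> base_sum (add_mset x N) r = base_sum N r' - base_angle x r'"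
    if "centered (add_mset x N) r" "uncentered x N r'" for x N r r'
    using centered_uncentered_unique[OF that] uncentered_eq_centered[OF that(2)] that by auto
  from assms show ?thesis unfolding polygon_data_def
    using centered_unique[of M r r'] mixed[of _ _ r r'] mixed[of _ _ r' r] uncentered_longest_unique
    by metis
qed

text \<open>The arcs add up to \<open>2 * pi\<close>, so at most one exceeds \<open>pi\<close>. If
  there is none, the polygon is centered; otherwise the chord of that arc is the longest side and
  its base angle counts negatively.\<close>

lemma inscribed_polygon_data:
  assumes "inscribed xs c e f r t"
  shows "\<exists>b. polygon_data (mset (side_lengths xs)) r b \<and> (\<Sum>i<length xs. interior_angle xs i) = 2 * b"
proof -
  note s = inscribedD[OF assms]
  define n ds a where "n = length xs" and "ds = side_lengths xs" and "a i = t (Suc i) - t i" for i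
  have len: "length ds = n" by (simp add: ds_def n_def side_lengths_def)
  have suma: "(\<Sum>i<n. a i) = 2 * pi"
    using s(4,5) by (simp add: a_def n_def sum_lessThan_telescope)
  have a: "0 < a i" if "i < n" for i using s(6) that by (auto simp: a_def n_def)
  have rest: "(\<Sum>i\<in>{..<n} - {m}. a i) = 2 * pi - a m" if "m < n" for m
    using that suma by (simp add: sum_diff1)
  \<comment> \<open>With at least three vertices, a third arc of positive length is left.\<close>
  have two: "a i + a m \<le> 2 * pi" "i \<noteq> m \<Longrightarrow> a i + a m < 2 * pi" if "i < n" "m < n" "i \<noteq> m" for i m
  proof -
    obtain k where k: "k < n" "k \<noteq> i" "k \<noteq> m"
    proof -
      have "\<exists>k\<in>{0, 1, 2}. k \<noteq> i \<and> k \<noteq> m" by auto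
      then obtain k where "k \<in> {0, 1, 2}" "k \<noteq> i" "k \<noteq> m" by blast
      moreover from this have "k \<le> 2" by auto
      then have "k < n" using s(3) unfolding n_def by linarith
      ultimately show ?thesis using that by blast
    qed
    have "(\<Sum>j\<in>{i, m, k}. a j) \<le> (\<Sum>j<n. a j)"
      using that k a by (intro sum_mono2) (auto intro: less_imp_le)
    then show "a i + a m < 2 * pi" using suma a[OF k(1)] that(3) k by simp
    then show "a i + a m \<le> 2 * pi" by simp
  qed
  have a2: "a i < 2 * pi" if "i < n" for i
  proof -
    obtain m where "m < n" "i \<noteq> m" using s(3) that unfolding n_def
      by (metis One_nat_def Suc_le_lessD n_not_Suc_n nat_neq_iff numeral_3_eq_3 zero_less_Suc order_less_trans lessI)
    then show ?thesis using two[of i m] a[of m] that by simp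
  qed
  have d: "0 < ds ! i" "sinh (ds ! i / 2) = sinh r * sin (a i / 2)" if "i < n" for i
    using inscribed_side[OF assms] that by (auto simp: ds_def a_def n_def)
  have h: "ds ! i / 2 \<le> r"
    "half_angle (ds ! i) r = (if a i \<le> pi then a i / 2 else pi - a i / 2)"
    "base_angle (ds ! i) r = (if a i \<le> pi then 1 else -1) * arctan (cot (a i / 2) / cosh r)"
    if "i < n" for i
    by (rule half_angle_arc[OF d(1)[OF that] s(2) a[OF that] a2[OF that] d(2)[OF that]])+
  define B where "B i = arctan (cot (a i / 2) / cosh r)" for i
  have ang: "(\<Sum>i<length xs. interior_angle xs i) = 2 * (\<Sum>i<n. B i)"
    using inscribed_angles[OF assms] by (simp add: n_def B_def a_def)
  have asum: "angle_sum (mset ds) r = (\<Sum>i<n. half_angle (ds ! i) r)"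
    and bsum: "base_sum (mset ds) r = (\<Sum>i<n. base_angle (ds ! i) r)"
    unfolding angle_sum_def base_sum_def len[symmetric]
    by (rule sum_nth_eq_sum_mset[symmetric])+
  show ?thesis
  proof (cases "\<forall>i<n. a i \<le> pi")
    case True
    have "angle_sum (mset ds) r = (\<Sum>i<n. a i / 2)" unfolding asum
      by (rule sum.cong) (use True h in auto)
    also have "\<dots> = pi" using suma by (simp flip: sum_divide_distrib)
    finally have "centered (mset ds) r"
      unfolding centered_def using d(1) h(1) len by (auto simp: in_set_conv_nth)
    moreover have "base_sum (mset ds) r = (\<Sum>i<n. B i)" unfolding bsum
      by (rule sum.cong) (use True h in \<open>auto simp: B_def\<close>)
    ultimately show ?thesis unfolding polygon_data_def ds_def[symmetric] using ang by auto
  next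
    case False
    then obtain m where m: "m < n" "pi < a m" by (auto simp: not_le)
    define x N where "x = ds ! m" and "N = mset ds - {#x#}"
    have M: "mset ds = add_mset x N" using m len by (simp add: N_def x_def)
    have small: "a i < pi" if "i < n" "i \<noteq> m" for i using two[of i m] that m by auto
    have "angle_sum (mset ds) r = half_angle x r + (\<Sum>i\<in>{..<n} - {m}. half_angle (ds ! i) r)"
      unfolding asum x_def using m by (simp add: sum.remove)
    also have "(\<Sum>i\<in>{..<n} - {m}. half_angle (ds ! i) r) = (\<Sum>i\<in>{..<n} - {m}. a i / 2)"
      by (rule sum.cong) (use small h in force)+
    also have "\<dots> = pi - a m / 2" using rest[OF m(1)] by (simp flip: sum_divide_distrib add: diff_divide_distrib)
    also have "\<dots> = half_angle x r" using h(2)[OF m(1)] m by (simp add: x_def)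
    finally have asN: "angle_sum N r = half_angle x r" using M by simp
    have "base_sum (mset ds) r = base_angle x r + (\<Sum>i\<in>{..<n} - {m}. base_angle (ds ! i) r)"
      unfolding bsum x_def using m by (simp add: sum.remove)
    also have "(\<Sum>i\<in>{..<n} - {m}. base_angle (ds ! i) r) = (\<Sum>i\<in>{..<n} - {m}. B i)"
      by (rule sum.cong) (use small h in \<open>force simp: B_def\<close>)+
    finally have "base_sum N r = (\<Sum>i<n. B i) - B m" using M m by (simp add: sum_diff1)
    moreover have "base_angle x r = - B m" using h(3)[OF m(1)] m by (simp add: x_def B_def)
    ultimately have bs: "base_sum N r - base_angle x r = (\<Sum>i<n. B i)" by simp
    have le: "0 < d' \<and> d' \<le> x" if "d' \<in># N" for d'
    proof -
      have "d' \<in> set ds" using that M by (metis set_mset_mset union_single_eq_member in_diffD N_def)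
      then obtain i where i: "i < n" "d' = ds ! i" using len by (auto simp: in_set_conv_nth)
      \<comment> \<open>Lengths are compared through half angles:
        \<open>a i + a m \<le> 2 * pi\<close> means
        \<open>a i / 2 \<le> pi - a m / 2\<close>.\<close>
      have "half_angle d' r \<le> half_angle x r"
      proof (cases "i = m")
        case False
        then show ?thesis using h(2)[OF m(1)] h(2)[OF i(1)] small[OF i(1)] m two(1)[OF i(1) m(1)]
          by (simp add: x_def i)
      qed (simp add: i x_def)
      then have "\<not> x < d'" using half_angle_less_length[of x d' r] d(1)[OF m(1)] h(1)[OF i(1)]
        by (auto simp: x_def i)
      then show ?thesis using d(1)[OF i(1)] i by simp
    qed
    have "size N = n - 1" using len m by (simp add: N_def x_def size_Diff_singleton)
    then have "uncentered x N r" unfolding uncentered_def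
      using s(3) h(1)[OF m(1)] le asN by (auto simp: n_def x_def)
    with M bs have "polygon_data (mset ds) r (\<Sum>i<n. B i)" unfolding polygon_data_def by metis
    then show ?thesis unfolding ds_def[symmetric] using ang by blast
  qed
qed

section \<open>Convex polygons and increasing polar angles\<close>

text \<open>By \<open>sep\<close>, two vertices lie both between the angles of a consecutive pair or
  both outside. Vertex 0 has the smallest angle, hence lies outside every pair avoiding it, and so
  do all other vertices. The order of \<open>t 1\<close> and \<open>t 2\<close> then propagates
  along the list; vertex 0 stays smallest in the decreasing case as well, hence \<open>0 < i\<close>
  there.\<close>

lemma cyclic_order_monotone:
  fixes t :: "nat \<Rightarrow> real"
  assumes n: "3 \<le> n" and t0: "t 0 = 0" and tn: "\<And>i. i < n \<Longrightarrow> 0 \<le> t i"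
    and sep: "\<And>i j k. i < n \<Longrightarrow> j < n \<Longrightarrow> k < n \<Longrightarrow> j \<notin> {i, Suc i mod n} \<Longrightarrow> k \<notin> {i, Suc i mod n} \<Longrightarrow>
      0 < ((t j - t (Suc i mod n)) * (t j - t i)) * ((t k - t (Suc i mod n)) * (t k - t i))"
  shows "(\<forall>i. 0 < i \<longrightarrow> i < n \<longrightarrow> 0 < t i) \<and> ((\<forall>i j. i < j \<longrightarrow> j < n \<longrightarrow> t i < t j) \<or>
    (\<forall>i j. 0 < i \<longrightarrow> i < j \<longrightarrow> j < n \<longrightarrow> t j < t i))"
proof -
  have sep1: "0 < ((t j - t 1) * t j) * ((t k - t 1) * t k)" if "2 \<le> j" "j < n" "2 \<le> k" "k < n" for j k
    using sep[of 0 j k] that n t0 by auto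
  have pos: "0 < t i" if "0 < i" "i < n" for i
  proof -
    have "t i \<noteq> 0"
    proof (cases "i = 1")
      case True
      then show ?thesis using sep[of 1 0 0] n t0 by auto
    next
      case False
      then show ?thesis using sep1[of i i] that by auto
    qed
    then show ?thesis using tn[OF that(2)] by simp
  qed
  have step: "0 < (t k - t (Suc i)) * (t k - t i)" if "0 < i" "Suc i < k" "k < n" for i k
  proof -
    have "0 < ((t 0 - t (Suc i)) * (t 0 - t i)) * ((t k - t (Suc i)) * (t k - t i))"
      using sep[of i 0 k] that by auto
    moreover have "0 < (t 0 - t (Suc i)) * (t 0 - t i)"
      using pos[of i] pos[of "Suc i"] that t0 by simp
    ultimately show ?thesis by (simp add: zero_less_mult_iff)
  qed
  have "t 1 \<noteq> t 2" using sep1[of 2 2] n by (intro notI) simp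
  then have "t 1 < t 2 \<or> t 2 < t 1" by linarith
  then show ?thesis
  proof
    assume 12: "t 1 < t 2"
    have "t i < t k" if "0 < i" "i < k" "k < n" for i k
      using that
    proof (induction i arbitrary: k rule: nat_induct_non_zero)
      case 1
      have "0 < (t 2 - t 1) * t 2" using 12 pos[of 2] n by simp
      then have "0 < (t k - t 1) * t k" using zero_less_mult_pos[OF sep1[of 2 k]] 1 n by simp
      then show ?case using pos[of k] 1 by (simp add: zero_less_mult_iff)
    next
      case (Suc i)
      have "0 < t k - t (Suc i)"
        by (rule zero_less_mult_pos2[OF step[of i k]]) (use Suc in auto)
      then show ?case by simp
    qed
    then show ?thesis using pos t0 by (metis gr0I)
  next
    assume 12: "t 2 < t 1"
    have "t k < t i" if "0 < i" "i < k" "k < n" for i k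
      using that
    proof (induction i arbitrary: k rule: nat_induct_non_zero)
      case 1
      have "(t 2 - t 1) * t 2 < 0" using 12 pos[of 2] n by (simp add: mult_neg_pos)
      moreover have "0 < ((t 2 - t 1) * t 2) * ((t k - t 1) * t k)" using sep1[of 2 k] 1 n by simp
      ultimately have "(t k - t 1) * t k < 0" by (meson less_asym zero_less_mult_iff)
      then show ?case using pos[of k] 1 by (simp add: mult_less_0_iff)
    next
      case (Suc i)
      have "t k - t i < 0" "0 < (t k - t (Suc i)) * (t k - t i)" using Suc step[of i k] by simp_all
      then have "t k - t (Suc i) < 0" by (meson less_asym zero_less_mult_iff)
      then show ?case by simp
    qed
    then show ?thesis using pos by blast
  qed
qed

lemma sin_half_sgn:
  fixes x :: real
  assumes "\<bar>x\<bar> < 2 * pi"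
  shows "sgn (sin (x / 2)) = sgn x"
proof -
  consider "x = 0" | "0 < x" | "x < 0" by linarith
  then show ?thesis
  proof cases
    case 2
    then have "0 < sin (x / 2)" using assms by (intro sin_gt_zero) auto
    then show ?thesis using 2 by simp
  next
    case 3
    then have "0 < sin (- (x / 2))" using assms by (intro sin_gt_zero) auto
    then show ?thesis using 3 by simp
  qed simp
qed

text \<open>In polar coordinates about the center, convexity becomes the separation condition of
  \<open>cyclic_order_monotone\<close>: differences of angles in \<open>[0, 2 * pi)\<close> have the
  same signs as the sines of their halves.\<close>

lemma convex_polygon_inscribed:
  assumes conv: "convex_polygon xs" and cen: "centered_at xs c r"
  shows "\<exists>e f t. inscribed xs c e f r t"
proof -
  define n where "n = length xs"
  have n: "3 \<le> n" and hyp: "\<And>i. i < n \<Longrightarrow> xs ! i \<in> hyp_plane"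
    and side: "\<And>i j k. i < n \<Longrightarrow> j < n \<Longrightarrow> k < n \<Longrightarrow> j \<notin> {i, Suc i mod n} \<Longrightarrow> k \<notin> {i, Suc i mod n} \<Longrightarrow>
      0 < line_side (xs!i) (xs!(Suc i mod n)) (xs!j) * line_side (xs!i) (xs!(Suc i mod n)) (xs!k)"
    using conv by (auto simp: convex_polygon_def Let_def n_def)
  have c: "c \<in> hyp_plane" and dist: "\<And>i. i < n \<Longrightarrow> hdist c (xs ! i) = r"
    using cen by (auto simp: centered_at_def n_def)
  have r0: "0 \<le> r" using cosh_hdist(2)[OF c hyp[of 0]] dist[of 0] n by simp
  have "r \<noteq> 0"
  proof
    assume "r = 0"
    then have "lorentz c (xs ! i) = -1" if "i < n" for i
      using cosh_hdist(1)[OF c hyp[OF that]] dist[OF that] by simp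
    then have "xs ! i = c" if "i < n" for i using lorentz_hyp_plane(2)[OF c hyp[OF that]] that by simp
    then have "line_side c c c * line_side c c c > 0" using side[of 0 2 2] n by simp
    then show False by (simp add: line_side_def det_3 vector_3)
  qed
  then have r: "0 < r" using r0 by simp
  then have sr: "0 < sinh r" by simp
  have n0: "0 < n" using n by simp
  \<comment> \<open>The unit tangent vector at \<open>c\<close> towards the first vertex, which
    thereby gets polar angle 0.\<close>
  define e where "e = (1 / sinh r) *\<^sub>R (xs ! 0 - cosh r *\<^sub>R c)"
  have c0: "lorentz c (xs ! 0) = - cosh r" using cosh_hdist(1)[OF c hyp[OF n0]] dist[OF n0] by simp
  have cc: "lorentz c c = -1" "lorentz (xs ! 0) (xs ! 0) = -1" using c hyp[OF n0] by (auto simp: hyp_plane_def)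
  have ce: "lorentz c e = 0" using c0 cc by (simp add: e_def)
  have "lorentz e e = (1 / sinh r)\<^sup>2 * (lorentz (xs ! 0) (xs ! 0) - 2 * cosh r * lorentz c (xs ! 0) + (cosh r)\<^sup>2 * lorentz c c)"
    unfolding e_def by (simp add: lorentz_def power2_eq_square algebra_simps)
  also have "lorentz (xs ! 0) (xs ! 0) - 2 * cosh r * lorentz c (xs ! 0) + (cosh r)\<^sup>2 * lorentz c c = (sinh r)\<^sup>2"
    unfolding c0 cc using cosh_square_eq[of r] by (simp add: power2_eq_square)
  also have "(1 / sinh r)\<^sup>2 * (sinh r)\<^sup>2 = 1" using sr by (simp add: power_divide)
  finally have ee: "lorentz e e = 1" .
  define f where "f = lorentz_cross c e"
  have fr: "frame c e f" using cc ce ee by (simp add: frame_def f_def)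
  have x0: "xs ! 0 = circle_point c e f r 0" using sr by (simp add: circle_point_def e_def)
  have "\<exists>t. i < n \<longrightarrow> 0 \<le> t \<and> t < 2 * pi \<and> xs ! i = circle_point c e f r t \<and> (i = 0 \<longrightarrow> t = 0)" for i
    using circle_point_ex[OF fr c hyp[of i] dist[of i] r] x0 by (cases "i = 0") auto
  then obtain t where t: "\<And>i. i < n \<Longrightarrow> 0 \<le> t i" "\<And>i. i < n \<Longrightarrow> t i < 2 * pi"
    "\<And>i. i < n \<Longrightarrow> xs ! i = circle_point c e f r (t i)" "t 0 = 0"
    using n0 by metis
  obtain k where k: "k \<noteq> 0" and ls: "\<And>s t u. line_side (circle_point c e f r s) (circle_point c e f r t) (circle_point c e f r u) =
    k * (sinh r)\<^sup>2 * (sin ((t - s) / 2) * sin ((u - t) / 2) * sin ((u - s) / 2))"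
    using line_side_circle_point[OF fr] by blast
  have "(\<forall>i. 0 < i \<longrightarrow> i < n \<longrightarrow> 0 < t i) \<and> ((\<forall>i j. i < j \<longrightarrow> j < n \<longrightarrow> t i < t j) \<or>
    (\<forall>i j. 0 < i \<longrightarrow> i < j \<longrightarrow> j < n \<longrightarrow> t j < t i))"
  proof (rule cyclic_order_monotone[where t = t, OF n t(4) t(1)])
    fix i j l assume *: "i < n" "j < n" "l < n" "j \<notin> {i, Suc i mod n}" "l \<notin> {i, Suc i mod n}"
    define m where "m = Suc i mod n"
    have m: "m < n" using n0 by (simp add: m_def)
    have sg: "sgn (sin ((t a - t b) / 2)) = sgn (t a - t b)" if "a < n" "b < n" for a b
      by (rule sin_half_sgn) (use t(1,2)[OF that(1)] t(1,2)[OF that(2)] in auto)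
    \<comment> \<open>The factor common to both values of \<open>line_side\<close>; it enters
      squared and can be cancelled.\<close>
    define K where "K = k * (sinh r)\<^sup>2 * sin ((t m - t i) / 2)"
    have "0 < (K * (sin ((t j - t m) / 2) * sin ((t j - t i) / 2))) * (K * (sin ((t l - t m) / 2) * sin ((t l - t i) / 2)))"
      using side[OF *] * m unfolding m_def[symmetric] by (simp add: t(3) ls K_def mult_ac)
    also have "\<dots> = K\<^sup>2 * ((sin ((t j - t m) / 2) * sin ((t j - t i) / 2)) * (sin ((t l - t m) / 2) * sin ((t l - t i) / 2)))"
      by (simp add: power2_eq_square mult_ac)
    finally have "0 < (sin ((t j - t m) / 2) * sin ((t j - t i) / 2)) * (sin ((t l - t m) / 2) * sin ((t l - t i) / 2))"
      by (simp add: zero_less_mult_iff)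
    then have "sgn ((sin ((t j - t m) / 2) * sin ((t j - t i) / 2)) * (sin ((t l - t m) / 2) * sin ((t l - t i) / 2))) = 1"
      by simp
    then have "sgn (((t j - t m) * (t j - t i)) * ((t l - t m) * (t l - t i))) = 1"
      using * m by (simp only: sgn_mult sg)
    then show "0 < ((t j - t (Suc i mod n)) * (t j - t i)) * ((t l - t (Suc i mod n)) * (t l - t i))"
      unfolding m_def[symmetric] by (simp only: sgn_1_pos)
  qed
  then have pos: "\<And>i. 0 < i \<Longrightarrow> i < n \<Longrightarrow> 0 < t i" and mono: "(\<forall>i j. i < j \<longrightarrow> j < n \<longrightarrow> t i < t j) \<or>
    (\<forall>i j. 0 < i \<longrightarrow> i < j \<longrightarrow> j < n \<longrightarrow> t j < t i)" by blast+
  from mono show ?thesis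
  proof
    assume inc: "\<forall>i j. i < j \<longrightarrow> j < n \<longrightarrow> t i < t j"
    define t' where "t' i = (if i = n then 2 * pi else t i)" for i
    have "t' i < t' (Suc i)" if "i < n" for i
      using inc t(2)[OF that] that by (cases "Suc i = n") (auto simp: t'_def)
    then have "inscribed xs c e f r t'"
      using fr r n t n0 by (auto simp: inscribed_def t'_def n_def)
    then show ?thesis by blast
  next
    assume dec: "\<forall>i j. 0 < i \<longrightarrow> i < j \<longrightarrow> j < n \<longrightarrow> t j < t i"
    \<comment> \<open>Passing to \<open>- f\<close> negates angles modulo \<open>2 * pi\<close>;
      vertex 0 has to stay at 0 instead of moving to \<open>2 * pi\<close>.\<close>
    define t' where "t' i = (if i = n then 2 * pi else if i = 0 then 0 else 2 * pi - t i)" for i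
    have "t' i < t' (Suc i)" if "i < n" for i
      using dec t(2)[of "Suc i"] pos[of i] that n by (cases "Suc i = n"; cases "i = 0") (auto simp: t'_def)
    moreover have "xs ! i = circle_point c e (- f) r (t' i)" if "i < n" for i
      using t(3)[OF that] x0 that by (auto simp: t'_def circle_point_def)
    ultimately have "inscribed xs c e (- f) r t'"
      using frame_uminus[OF fr] r n n0 by (auto simp: inscribed_def t'_def n_def)
    then show ?thesis by blast
  qed
qed

text \<open>The angle of a vertex off the edge lies outside the arc from \<open>t i\<close> to
  \<open>t (Suc i)\<close>. Its differences to both ends therefore have equal signs, and so have the
  sines of their halves, which puts all these vertices on one side.\<close>

lemma inscribed_imp_cyclic_polygon:
  assumes ins: "inscribed xs c e f r t" and c: "c \<in> hyp_plane" and xs: "set xs \<subseteq> hyp_plane"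
  shows "cyclic_polygon xs"
proof -
  define n where "n = length xs"
  note s = inscribedD[OF ins, folded n_def]
  have cp: "centered_at xs c r"
    unfolding centered_at_def
  proof (intro conjI c ballI)
    fix x assume "x \<in> set xs"
    then obtain i where "i < n" "x = circle_point c e f r (t i)" using s(7) by (auto simp: in_set_conv_nth n_def)
    then have "lorentz c x = - cosh r" by (simp add: circle_point_def frameD[OF s(1)])
    then show "hdist c x = r" using s(2) by (simp add: hdist_def arcosh_cosh_real)
  qed
  obtain k where k: "k \<noteq> 0" and ls: "\<And>s t u. line_side (circle_point c e f r s) (circle_point c e f r t) (circle_point c e f r u) =
    k * (sinh r)\<^sup>2 * (sin ((t - s) / 2) * sin ((u - t) / 2) * sin ((u - s) / 2))"
    using line_side_circle_point[OF s(1)] by blast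
  have less: "t i < t j" if "i < j" "j \<le> n" for i j using inscribed_less[OF ins] that by (simp add: n_def)
  have "0 < line_side (xs!i) (xs!(Suc i mod n)) (xs!j) * line_side (xs!i) (xs!(Suc i mod n)) (xs!l)"
    if "i < n" "j < n" "l < n" "j \<notin> {i, Suc i mod n}" "l \<notin> {i, Suc i mod n}" for i j l
  proof -
    have b: "0 \<le> t i" "t i < 2 * pi" if "i < n" for i using inscribed_bounds[OF ins] that by (auto simp: n_def)
    have B: "0 < t (Suc i)" "t (Suc i) \<le> 2 * pi" using inscribed_bounds[OF ins] that by (auto simp: n_def)
    have brack: "0 < sin ((t j - t (Suc i)) / 2) * sin ((t j - t i) / 2)"
      if j: "j < n" "j \<notin> {i, Suc i mod n}" for j
    proof -
      consider "j < i" | "Suc i < j" | "j = Suc i" using j by fastforce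
      then show ?thesis
      proof cases
        case 1
        \<comment> \<open>A full turn would occur only for the last edge and \<open>j = 0\<close>,
          but vertex 0 is an endpoint of that edge.\<close>
        have tj: "t (Suc i) - t j < 2 * pi"
        proof (cases "Suc i = n")
          case True
          then have "0 < j" using j by (cases j) auto
          then show ?thesis using less[of 0 j] j B s(4) by simp
        next
          case False
          then show ?thesis using b[of "Suc i"] b[of j] j \<open>i < n\<close> by simp
        qed
        have "0 < sin ((t (Suc i) - t j) / 2)" "0 < sin ((t i - t j) / 2)"
          using less[of j "Suc i"] less[of j i] 1 \<open>i < n\<close> tj b[of i] b[of j] j by (auto intro!: sin_gt_zero)
        moreover have "(t j - t (Suc i)) / 2 = - ((t (Suc i) - t j) / 2)" by (metis minus_diff_eq minus_divide_left)
        moreover have "(t j - t i) / 2 = - ((t i - t j) / 2)" by (metis minus_diff_eq minus_divide_left)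
        ultimately have "sin ((t j - t (Suc i)) / 2) < 0" "sin ((t j - t i) / 2) < 0"
          by (simp_all only: sin_minus neg_less_0_iff_less)
        then show ?thesis by (rule mult_neg_neg)
      next
        case 2
        have "0 < sin ((t j - t (Suc i)) / 2)" "0 < sin ((t j - t i) / 2)"
          using less[of "Suc i" j] less[of i j] 2 j b[of i] b[of j] B \<open>i < n\<close> by (auto intro!: sin_gt_zero)
        then show ?thesis by simp
      next
        case 3
        then show ?thesis using j by simp
      qed
    qed
    have K: "sin ((t (Suc i) - t i) / 2) \<noteq> 0"
    proof -
      have "0 < sinh (side_lengths xs ! i / 2)" using inscribed_side(1)[OF ins] that by (simp add: n_def)
      then show ?thesis using inscribed_side(2)[OF ins, of i] that by (auto simp: n_def)
    qed
    define K where "K = k * (sinh r)\<^sup>2 * sin ((t (Suc i) - t i) / 2)"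
    have "0 < K\<^sup>2" using K k s(2) by (simp add: K_def)
    then have "0 < K\<^sup>2 * ((sin ((t j - t (Suc i)) / 2) * sin ((t j - t i) / 2)) * (sin ((t l - t (Suc i)) / 2) * sin ((t l - t i) / 2)))"
      using brack[OF that(2,4)] brack[OF that(3,5)] by (simp only: mult_pos_pos)
    also have "\<dots> = line_side (xs!i) (xs!(Suc i mod n)) (xs!j) * line_side (xs!i) (xs!(Suc i mod n)) (xs!l)"
      using inscribed_Suc[OF ins, of i] that by (simp add: s(7) ls K_def n_def power2_eq_square mult_ac)
    finally show ?thesis .
  qed
  then have "convex_polygon xs" using s(3) xs by (simp add: convex_polygon_def Let_def n_def)
  then show ?thesis using cp by (auto simp: cyclic_polygon_def)
qed

lemma inscribed_exists:
  assumes n: "3 \<le> n" and r: "0 < r" and a: "\<And>i. i < n \<Longrightarrow> 0 < a i" and sum: "(\<Sum>i<n. a i) = 2 * pi"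
  shows "\<exists>xs c e f t. inscribed xs c e f r t \<and> length xs = n \<and> cyclic_polygon xs \<and>
    (\<forall>i<n. t (Suc i) - t i = a i)"
proof -
  define c e f :: "real^3" where "c = vector [0, 0, 1]" and "e = vector [1, 0, 0]" and "f = vector [0, 1, 0]"
  define t where "t k = (\<Sum>i<k. a i)" for k
  define xs where "xs = map (\<lambda>i. circle_point c e f r (t i)) [0..<n]"
  have fr: "frame c e f"
    by (simp add: frame_def lorentz_def lorentz_cross_def c_def e_def f_def vector_3 vec_eq_iff forall_3)
  have c: "c \<in> hyp_plane" by (simp add: hyp_plane_def lorentz_def c_def vector_3)
  have "circle_point c e f r s \<in> hyp_plane" for s
    using lorentz_circle_point[OF fr, of r s s]
    by (simp add: hyp_plane_def) (simp add: circle_point_def c_def e_def f_def vector_3)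
  then have "set xs \<subseteq> hyp_plane" by (auto simp: xs_def)
  moreover have ins: "inscribed xs c e f r t"
    using fr r n a sum by (auto simp: inscribed_def xs_def t_def)
  moreover have "\<forall>i<n. t (Suc i) - t i = a i" by (simp add: t_def)
  ultimately show ?thesis using inscribed_imp_cyclic_polygon[OF ins c] 
    by (intro exI[of _ xs] exI[of _ c] exI[of _ e] exI[of _ f] exI[of _ t]) (simp add: xs_def)
qed

text \<open>Each side is given the arc twice its half angle, except that the longest side of an
  uncentered polygon gets the complementary major arc. The angle conditions make the arcs add up to
  \<open>2 * pi\<close>.\<close>

lemma polygon_data_exists:
  assumes "polygon_data (mset ds) r b" "3 \<le> length ds"
  shows "\<exists>xs. cyclic_polygon xs \<and> side_lengths xs = ds"
proof -
  define n where "n = length ds"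
  have "\<exists>a. 0 < r \<and> (\<forall>i<n. 0 < ds ! i \<and> 0 < a i \<and> sinh (ds ! i / 2) = sinh r * sin (a i / 2)) \<and> (\<Sum>i<n. a i) = 2 * pi"
    using assms(1) unfolding polygon_data_def
  proof (elim disjE exE conjE)
    assume c: "centered (mset ds) r"
    then have d: "0 < ds ! i" "ds ! i / 2 \<le> r" if "i < n" for i
      using that by (auto simp: centered_def n_def)
    have "0 < n" using assms(2) unfolding n_def by linarith
    then have "0 < r" using d[of 0] by linarith
    moreover have "(\<Sum>i<n. 2 * half_angle (ds ! i) r) = 2 * pi"
      using c by (simp add: centered_def angle_sum_def n_def flip: sum_distrib_left sum_nth_eq_sum_mset)
    ultimately show ?thesis using d half_angle_pos sin_half_angle
      by (intro exI[of _ "\<lambda>i. 2 * half_angle (ds ! i) r"]) simp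
  next
    fix x N assume M: "mset ds = add_mset x N" and u: "uncentered x N r"
    note v = uncenteredD[OF u]
    have set: "set ds = insert x (set_mset N)" using M by (metis set_mset_add_mset_insert set_mset_mset)
    have d: "0 < ds ! i" "ds ! i / 2 \<le> r" if "i < n" for i
    proof -
      have "ds ! i \<in> insert x (set_mset N)" using that set nth_mem[of i ds] by (simp add: n_def)
      then show "0 < ds ! i" "ds ! i / 2 \<le> r" using v(2,4,6) v(7)[of "ds ! i"] by auto
    qed
    obtain m where m: "m < n" "ds ! m = x" using set by (metis in_set_conv_nth insertI1 n_def)
    define a where "a i = (if i = m then 2 * pi - 2 * half_angle x r else 2 * half_angle (ds ! i) r)" for i
    have "(\<Sum>i<n. half_angle (ds ! i) r) = 2 * half_angle x r"
      using v(5) M by (simp add: n_def sum_nth_eq_sum_mset[of "\<lambda>d. half_angle d r"] flip: angle_sum_def)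
    then have "(\<Sum>i\<in>{..<n} - {m}. half_angle (ds ! i) r) = half_angle x r" using m by (simp add: sum_diff1)
    then have "(\<Sum>i\<in>{..<n} - {m}. a i) = 2 * half_angle x r"
      by (simp add: a_def flip: sum_distrib_left)
    then have "(\<Sum>i<n. a i) = 2 * pi" using m by (simp add: sum.remove[of "{..<n}" m] a_def)
    moreover have "0 < a i" "sinh (ds ! i / 2) = sinh r * sin (a i / 2)" if "i < n" for i
    proof -
      have "2 * half_angle x r < 2 * pi" using half_angle_le[OF v(2,4)] pi_gt_zero by linarith
      then show "0 < a i" using half_angle_pos[OF d[OF that]] by (simp add: a_def)
      have "(2 * pi - 2 * half_angle x r) / 2 = pi - half_angle x r" by (simp add: diff_divide_distrib)
      then have "sin ((2 * pi - 2 * half_angle x r) / 2) = sin (half_angle x r)" by (simp only: sin_pi_minus)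
      then show "sinh (ds ! i / 2) = sinh r * sin (a i / 2)"
        using sin_half_angle[OF d[OF that]] m(2) unfolding a_def by (cases "i = m") simp_all
    qed
    ultimately show ?thesis using d v(3) by blast
  qed
  then obtain a where a: "0 < r" "\<And>i. i < n \<Longrightarrow> 0 < ds ! i" "\<And>i. i < n \<Longrightarrow> 0 < a i"
    "\<And>i. i < n \<Longrightarrow> sinh (ds ! i / 2) = sinh r * sin (a i / 2)" "(\<Sum>i<n. a i) = 2 * pi" by blast
  obtain xs c e f t where xs: "inscribed xs c e f r t" "length xs = n" "cyclic_polygon xs" "\<forall>i<n. t (Suc i) - t i = a i"
    using inscribed_exists[of n r a] a assms(2) by (auto simp: n_def)
  have "side_lengths xs ! i = ds ! i" if "i < n" for i
  proof -
    have "sinh (side_lengths xs ! i / 2) = sinh (ds ! i / 2)"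
      using inscribed_side(2)[OF xs(1), of i] xs(2,4) a(4) that by simp
    then show ?thesis by simp
  qed
  moreover have "length (side_lengths xs) = n" using xs(2) by (simp add: side_lengths_def)
  ultimately have "side_lengths xs = ds" by (intro nth_equalityI) (auto simp: n_def)
  then show ?thesis using xs by blast
qed

text \<open>Every cyclic polygon with these sides, about any of its centers, yields polygon data of
  \<open>mset ds\<close>, and such data are unique. So the choice of the representative does not
  matter.\<close>

lemma represented_polygon_data:
  assumes "polygon_data (mset ds) r b" "3 \<le> length ds"
  shows "cyc_radius ds = r" "D_poly R ds = (real (length ds) - 2) * pi - 2 * cosh R * b"
proof -
  define xs where "xs = represented_polygon ds"
  have xs: "cyclic_polygon xs" "side_lengths xs = ds"
    using someI_ex[OF polygon_data_exists[OF assms]] by (auto simp: xs_def represented_polygon_def)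
  have len: "length xs = length ds" using xs(2) by (auto simp: side_lengths_def)
  have data: "r' = r \<and> (\<Sum>i<length ds. interior_angle xs i) = 2 * b" if cen: "centered_at xs c r'" for c r'
  proof -
    have "convex_polygon xs" using xs(1) by (simp add: cyclic_polygon_def)
    then obtain e f t where "inscribed xs c e f r' t" using convex_polygon_inscribed[OF _ cen] by blast
    then obtain b' where "polygon_data (mset ds) r' b'" "(\<Sum>i<length ds. interior_angle xs i) = 2 * b'"
      using inscribed_polygon_data xs(2) len by metis
    then show ?thesis using polygon_data_unique[OF assms(1)] by auto
  qed
  obtain c r' where c: "centered_at xs c r'" using xs(1) by (auto simp: cyclic_polygon_def)
  then have "polygon_radius xs = r"
    unfolding polygon_radius_def using data by (intro the_equality) auto
  then show "cyc_radius ds = r" by (simp add: cyc_radius_def xs_def)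
  show "D_poly R ds = (real (length ds) - 2) * pi - 2 * cosh R * b"
    using data[OF c] by (simp add: D_poly_def flip: xs_def)
qed

section \<open>Trees with two edges\<close>

lemma pair_mset_eq_iff: "{#a, b#} = {#u, w#} \<longleftrightarrow> a = u \<and> b = w \<or> a = w \<and> b = u"
  by (auto simp: add_eq_conv_ex)

lemma walk_invariant:
  assumes "walk T u p w" "u \<in> A" "\<And>e x y. e \<in> edges T \<Longrightarrow> ends T e = {#x, y#} \<Longrightarrow> x \<in> A \<Longrightarrow> y \<in> A"
  shows "w \<in> A"
  using assms(1,2) by (induction p arbitrary: u) (use assms(3) in auto)

lemma finite_graph_ends:
  assumes "finite_graph T" "e \<in> edges T"
  obtains x y where "ends T e = {#x, y#}" "x \<in> verts T" "y \<in> verts T"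
proof -
  have "size (ends T e) = 2" "set_mset (ends T e) \<subseteq> verts T" using assms by (auto simp: finite_graph_def)
  moreover from this(1) obtain x N where N: "ends T e = add_mset x N" by (cases "ends T e") auto
  moreover from N \<open>size (ends T e) = 2\<close> obtain y where "N = {#y#}"
    using size_1_singleton_mset[of N] by auto
  ultimately show ?thesis using that by auto
qed

lemma tree_no_loop:
  assumes "finite_graph T" "tree T" "e \<in> edges T" "ends T e = {#x, y#}"
  shows "x \<noteq> y"
proof
  assume "x = y"
  moreover have "x \<in> verts T" using assms by (auto simp: finite_graph_def)
  ultimately have "walk T x [e] x" using assms by auto
  then show False using assms(2) unfolding tree_def by (metis distinct_singleton list.distinct(1))
qed

text \<open>Connectivity gives the root an edge \<open>e1\<close>. The second edge cannot join the
  same two vertices, which would close a cycle, nor avoid both, which would disconnect the tree. So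
  it attaches a new vertex to one end of \<open>e1\<close>, and \<open>p\<close> records
  which.\<close>

lemma two_edge_tree:
  assumes fin: "finite_graph T" and tree: "tree T" and card: "card (edges T) = 2" and vT: "vT \<in> verts T"
  shows "\<exists>e1 e2 v1 v2 p. edges T = {e1, e2} \<and> e1 \<noteq> e2 \<and> verts T = {vT, v1, v2} \<and> vT \<noteq> v1 \<and> vT \<noteq> v2 \<and> v1 \<noteq> v2 \<and>
    ends T e1 = {#vT, v1#} \<and> ends T e2 = {#if p then vT else v1, v2#}"
proof -
  have conn: "\<exists>p. walk T u p w" if "u \<in> verts T" "w \<in> verts T" for u w using tree that by (auto simp: tree_def)
  obtain e f where ef: "edges T = {e, f}" "e \<noteq> f" using card by (auto simp: card_2_iff)
  have "\<exists>u\<in>verts T. u \<noteq> vT"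
  proof -
    obtain x y where "ends T e = {#x, y#}" "x \<in> verts T" "y \<in> verts T" using finite_graph_ends[OF fin, of e] ef by blast
    then show ?thesis using tree_no_loop[OF fin tree, of e x y] ef by (metis insertI1)
  qed
  then obtain u q where u: "u \<in> verts T" "u \<noteq> vT" "walk T vT q u" using conn[OF vT] by blast
  then obtain e1 v1 where e1: "e1 \<in> edges T" "ends T e1 = {#vT, v1#}" by (cases q) auto
  obtain e2 where e2: "edges T = {e1, e2}" "e1 \<noteq> e2" using ef e1 by auto
  have v1: "vT \<noteq> v1" using tree_no_loop[OF fin tree e1] .
  obtain x y where xy: "ends T e2 = {#x, y#}" "x \<in> verts T" "y \<in> verts T" using finite_graph_ends[OF fin, of e2] e2 by blast
  have nxy: "x \<noteq> y" using tree_no_loop[OF fin tree _ xy(1)] e2 by auto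
  have notboth: "\<not> {x, y} = {vT, v1}"
  proof
    assume "{x, y} = {vT, v1}"
    then have "ends T e2 = {#v1, vT#}" using xy nxy v1 by (auto simp: doubleton_eq_iff)
    then have "walk T vT [e1, e2] vT" using e1 e2 vT by auto
    moreover have "distinct [e1, e2]" "[e1, e2] \<noteq> []" using e2 by auto
    ultimately show False using tree unfolding tree_def by blast
  qed
  have share: "x \<in> {vT, v1} \<or> y \<in> {vT, v1}"
  proof (rule ccontr)
    assume n: "\<not> ?thesis"
    obtain q where q: "walk T vT q x" using conn[OF vT xy(2)] by blast
    have "x \<in> {vT, v1}"
      by (rule walk_invariant[OF q]) (use e1 e2 xy n in \<open>auto simp: pair_mset_eq_iff\<close>)
    then show False using n by simp
  qed
  obtain w v2 where w: "ends T e2 = {#w, v2#}" "w \<in> {vT, v1}" "v2 \<notin> {vT, v1}" "v2 \<in> verts T"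
  proof (cases "x \<in> {vT, v1}")
    case True
    then show ?thesis using that[of x y] xy nxy notboth by auto
  next
    case False
    then show ?thesis using that[of y x] xy share by (auto simp: add_mset_commute)
  qed
  have "verts T = {vT, v1, v2}"
  proof
    show "{vT, v1, v2} \<subseteq> verts T" using vT w e1 fin by (auto simp: finite_graph_def)
    show "verts T \<subseteq> {vT, v1, v2}"
    proof
      fix z assume "z \<in> verts T"
      then obtain q where q: "walk T vT q z" using conn[OF vT] by blast
      show "z \<in> {vT, v1, v2}"
        by (rule walk_invariant[OF q]) (use e1 e2 w in \<open>auto simp: pair_mset_eq_iff\<close>)
    qed
  qed
  moreover have "ends T e2 = {#if w = vT then vT else v1, v2#}" using w by auto
  ultimately show ?thesis using e1 e2 v1 w by (metis insertCI)
qed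

context
  fixes T :: "('v, 'e) graph" and v0 v1 v2 :: 'v and e1 e2 :: 'e and p :: bool
  assumes E: "edges T = {e1, e2}" "e1 \<noteq> e2" and Vs: "verts T = {v0, v1, v2}" "v0 \<noteq> v1" "v0 \<noteq> v2" "v1 \<noteq> v2"
    and ends1: "ends T e1 = {#v0, v1#}" and ends2: "ends T e2 = {#if p then v0 else v1, v2#}"
begin

lemma walk_edge:
  "walk T u (e # q) w \<longleftrightarrow> (\<exists>x. walk T x q w \<and> (e = e1 \<and> (u = v0 \<and> x = v1 \<or> u = v1 \<and> x = v0) \<or>
     e = e2 \<and> (u = (if p then v0 else v1) \<and> x = v2 \<or> u = v2 \<and> x = (if p then v0 else v1))))"
  using E ends1 ends2 by (auto simp: pair_mset_eq_iff)

lemma distinct_walk_cases: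
  assumes "walk T u q w" "distinct q"
  shows "q \<in> {[], [e1], [e2], [e1, e2], [e2, e1]}"
proof -
  have "set q \<subseteq> {e1, e2}"
    using assms(1) by (induction q arbitrary: u) (auto simp: E)
  with assms(2) show ?thesis
    by (cases q rule: remdups_adj.cases; (cases "tl (tl q)")?) auto
qed

lemma first_edge_eq:
  "first_edge T v0 v1 = e1" "first_edge T v0 v2 = e2"
proof -
  have "tree_path T v1 v0 = [e1]" unfolding tree_path_def
  proof (rule the_equality)
    show "walk T v1 [e1] v0 \<and> distinct [e1]" using Vs E by (auto simp: walk_edge simp del: walk.simps(2))
    show "q = [e1]" if "walk T v1 q v0 \<and> distinct q" for q
      using that distinct_walk_cases[of v1 q v0] Vs E(2)
      by (auto simp: walk_edge simp del: walk.simps(2) split: if_splits)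
  qed
  then show "first_edge T v0 v1 = e1" by (simp add: first_edge_def)
  have "tree_path T v2 v0 = (if p then [e2] else [e2, e1])" unfolding tree_path_def
  proof (rule the_equality)
    show "walk T v2 (if p then [e2] else [e2, e1]) v0 \<and> distinct (if p then [e2] else [e2, e1])"
      using Vs E by (auto simp: walk_edge simp del: walk.simps(2))
    show "q = (if p then [e2] else [e2, e1])" if "walk T v2 q v0 \<and> distinct q" for q
      using that distinct_walk_cases[of v2 q v0] Vs E(2)
      by (auto simp: walk_edge simp del: walk.simps(2) split: if_splits)
  qed
  then show "first_edge T v0 v2 = e2" by (simp add: first_edge_def)
qed

lemma children_eq:
  "children T v0 v0 = {v1} \<union> (if p then {v2} else {})"
  "children T v0 v1 = (if p then {} else {v2})"
  "children T v0 v2 = {}"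
  using Vs E(2) ends1 ends2 by (auto simp: children_def first_edge_eq pair_mset_eq_iff split: if_splits)

end

lemma length_cyc:
  assumes "finite_graph V" "cyclic_orders V cyc" "v \<in> verts V"
  shows "length (cyc v) = valence V v"
proof -
  have set: "set (cyc v) \<subseteq> edges V" and cnt: "\<And>e. e \<in> edges V \<Longrightarrow> count (mset (cyc v)) e = count (ends V e) v"
    using assms by (auto simp: cyclic_orders_def)
  have "length (cyc v) = size (mset (cyc v))" by simp
  also have "\<dots> = (\<Sum>e\<in>set (cyc v). count (mset (cyc v)) e)" by (simp add: size_multiset_overloaded_eq)
  also have "\<dots> = (\<Sum>e\<in>edges V. count (mset (cyc v)) e)"
    using assms(1) set by (intro sum.mono_neutral_left) (auto simp: finite_graph_def count_eq_zero_iff)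
  also have "\<dots> = valence V v" unfolding valence_def by (rule sum.cong) (auto simp: cnt)
  finally show ?thesis .
qed

text \<open>A multiset, because a loop at \<open>v\<close> occurs twice in the cyclic order and
  different edges may be equally long.\<close>

definition frontier_lengths :: "('v, 'e) graph \<Rightarrow> ('v \<Rightarrow> 'e list) \<Rightarrow> ('e \<Rightarrow> real) \<Rightarrow> 'v \<Rightarrow> real multiset" where
  "frontier_lengths T cyc dF v = image_mset dF {#e \<in># mset (cyc v). e \<notin> edges T#}"

lemma frontier_lengths_pos:
  assumes "cyclic_orders V cyc" "subgraph T V" "v \<in> verts T" "\<forall>e\<in>fst ` tree_frontier V T. 0 < dF e"
    "d \<in># frontier_lengths T cyc dF v"
  shows "0 < d"
proof -
  obtain e where e: "e \<in> set (cyc v)" "e \<notin> edges T" "d = dF e" using assms(5) by (auto simp: frontier_lengths_def)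
  have v: "v \<in> verts V" using assms(2,3) by (auto simp: subgraph_def)
  have eV: "e \<in> edges V" using assms(1) v e(1) by (auto simp: cyclic_orders_def)
  then have "count (ends V e) v = count (mset (cyc v)) e" using assms(1) v by (simp add: cyclic_orders_def)
  then have "v \<in># ends V e" using e(1) by (metis count_greater_zero_iff set_mset_mset)
  then have "(e, v) \<in> tree_frontier V T" using e eV assms(3) by (auto simp: tree_frontier_def)
  then show ?thesis using assms(4) e(3) by force
qed

lemma mset_P_tuple:
  assumes "cyclic_orders V cyc" "subgraph T V" "v \<in> verts T"
    and "N = (\<Sum>e\<in>edges T. replicate_mset (count (ends T e) v) e)"
  shows "mset (P_tuple cyc (combine T dE dF) v) = image_mset dE N + frontier_lengths T cyc dF v"
    "size N + size (frontier_lengths T cyc dF v) = length (cyc v)"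
proof -
  have v: "v \<in> verts V" using assms(2,3) by (auto simp: subgraph_def)
  have fin: "finite (edges T)" using assms(2) by (auto simp: subgraph_def finite_graph_def)
  have cnt: "count (mset (cyc v)) e = count (ends T e) v" if "e \<in> edges T" for e
    using assms(1,2) v that by (auto simp: cyclic_orders_def subgraph_def)
  have N: "{#e \<in># mset (cyc v). e \<in> edges T#} = N"
    unfolding assms(4) by (rule multiset_eqI) (use fin cnt in \<open>auto simp: count_sum if_distrib cong: if_cong\<close>)
  have split: "mset (cyc v) = N + {#e \<in># mset (cyc v). e \<notin> edges T#}"
    unfolding N[symmetric] by (rule multiset_partition)
  have "mset (P_tuple cyc (combine T dE dF) v) = image_mset (combine T dE dF) N +
      image_mset (combine T dE dF) {#e \<in># mset (cyc v). e \<notin> edges T#}"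
    unfolding P_tuple_def mset_map by (subst split) simp
  also have "image_mset (combine T dE dF) N = image_mset dE N"
    by (rule image_mset_cong) (auto simp: combine_def simp flip: N)
  also have "image_mset (combine T dE dF) {#e \<in># mset (cyc v). e \<notin> edges T#} = frontier_lengths T cyc dF v"
    unfolding frontier_lengths_def by (rule image_mset_cong) (auto simp: combine_def)
  finally show "mset (P_tuple cyc (combine T dE dF) v) = image_mset dE N + frontier_lengths T cyc dF v" .
  show "size N + size (frontier_lengths T cyc dF v) = length (cyc v)"
    using arg_cong[OF split, of size] by (simp add: frontier_lengths_def)
qed

section \<open>Configurations of side lengths and radii\<close>

text \<open>A configuration consists of the lengths of the two tree edges and the radii at the three
  vertices: the root, the far endpoint of the first edge, and that of the second edge. The second
  edge emanates from the root if \<open>p\<close> holds, and from the far endpoint of the first one otherwise.\<close>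

type_synonym configuration = "real \<times> real \<times> real \<times> real \<times> real"

definition add_side :: "bool \<Rightarrow> real \<Rightarrow> real multiset \<Rightarrow> real multiset" where
  "add_side p y F = (if p then {#y#} else {#}) + F"

text \<open>All inequalities are weak and the root polygon may have its center on a side, so that
  limits of admissible configurations stay inside.\<close>

definition weak_config ::
  "bool \<Rightarrow> real multiset \<Rightarrow> real multiset \<Rightarrow> real multiset \<Rightarrow> configuration set" where
  "weak_config p F0 F1 F2 = {(x, y, r0, r1, r2). centered (add_mset x (add_side p y F0)) r0 \<and>
     uncentered x (add_side (\<not> p) y F1) r1 \<and> uncentered y F2 r2 \<and>
     r1 \<le> r0 \<and> r2 \<le> (if p then r0 else r1)}"

definition strict_config ::
  "bool \<Rightarrow> real multiset \<Rightarrow> real multiset \<Rightarrow> real multiset \<Rightarrow> configuration set" where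
  "strict_config p F0 F1 F2 = {(x, y, r0, r1, r2). (x, y, r0, r1, r2) \<in> weak_config p F0 F1 F2 \<and>
     (\<forall>d\<in>#add_mset x (add_side p y F0). d / 2 < r0) \<and> r1 < r0 \<and> r2 < (if p then r0 else r1)}"

definition config_angle ::
  "bool \<Rightarrow> real multiset \<Rightarrow> real multiset \<Rightarrow> real multiset \<Rightarrow> configuration \<Rightarrow> real" where
  "config_angle p F0 F1 F2 = (\<lambda>(x, y, r0, r1, r2). base_sum (add_mset x (add_side p y F0)) r0 +
     (base_sum (add_side (\<not> p) y F1) r1 - base_angle x r1) + (base_sum F2 r2 - base_angle y r2))"

text \<open>On a large circle each half angle is at most that of a side of length \<open>B\<close>,
  and \<open>n\<close> times the latter falls below \<open>pi\<close>.\<close>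

lemma centered_radius_bounded:
  assumes "0 < B"
  shows "\<exists>R. \<forall>M r. size M = n \<longrightarrow> (\<forall>d\<in>#M. d \<le> B) \<longrightarrow> centered M r \<longrightarrow> r \<le> R"
proof -
  have "\<forall>\<^sub>F r in at_top. angle_sum (replicate_mset n B) r < pi"
    by (rule order_tendstoD[OF tendsto_angle_sum_at_top]) simp
  then obtain R where R: "\<And>r. R \<le> r \<Longrightarrow> angle_sum (replicate_mset n B) r < pi"
    by (auto simp: eventually_at_top_linorder)
  have "r \<le> max R (B / 2)" if M: "size M = n" "\<And>d. d \<in># M \<Longrightarrow> d \<le> B" "centered M r" for M r
  proof (rule ccontr)
    assume "\<not> ?thesis"
    then have r: "R \<le> r" "B / 2 \<le> r" by auto
    have "pi = (\<Sum>d\<in>#M. half_angle d r)" using M(3) by (simp add: centered_def angle_sum_def)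
    also have "\<dots> \<le> (\<Sum>d\<in>#M. half_angle B r)"
    proof (rule sum_mset_mono)
      fix d assume "d \<in># M"
      then have "0 < d" "d \<le> B" using M by (auto simp: centered_def)
      then show "half_angle d r \<le> half_angle B r"
        using half_angle_less_length[of d B r] r by (cases "d = B") auto
    qed
    also have "\<dots> = angle_sum (replicate_mset n B) r" by (simp add: angle_sum_def M(1))
    finally show False using R[OF r(1)] by simp
  qed
  then show ?thesis by blast
qed

text \<open>Bounds travel towards the root: \<open>uncentered_side_bound\<close> bounds
  \<open>y\<close> by frontier sides, then \<open>x\<close> by frontier sides and possibly
  \<open>y\<close>. This bounds the sides at the root and thus \<open>r0\<close>, which dominates
  the other radii.\<close>

lemma weak_config_bounded: "bounded (weak_config p F0 F1 F2)"
proof -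
  define S where "S = (\<Sum>d\<in>#F2. sinh (d / 2)) + (\<Sum>d\<in>#F1. sinh (d / 2))"
  define B where "B = Max (insert 1 (insert (2 * arsinh (\<Sum>d\<in>#F2. sinh (d / 2))) (insert (2 * arsinh S)
    (insert (2 * arsinh (\<Sum>d\<in>#F1. sinh (d / 2))) (set_mset F0)))))"
  have B: "1 \<le> B" "2 * arsinh (\<Sum>d\<in>#F2. sinh (d / 2)) \<le> B" "2 * arsinh S \<le> B"
    "2 * arsinh (\<Sum>d\<in>#F1. sinh (d / 2)) \<le> B" "\<And>d. d \<in># F0 \<Longrightarrow> d \<le> B"
    unfolding B_def by (rule Max_ge; simp)+
  \<comment> \<open>Only the number of sides at the root is needed; the zeros are
    placeholders.\<close>
  obtain R where R: "\<And>M r. size M = size (add_mset 0 (add_side p 0 F0)) \<Longrightarrow> (\<forall>d\<in>#M. d \<le> B) \<Longrightarrow> centered M r \<Longrightarrow> r \<le> R"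
    using centered_radius_bounded[of B] B(1) by (metis less_le_trans zero_less_one)
  have sh: "x \<le> 2 * arsinh s" if "sinh (x / 2) < s" for x s :: real
  proof -
    have "sinh (x / 2) < sinh (arsinh s)" using that by (simp add: sinh_arsinh_real)
    then have "x / 2 < arsinh s" by (simp only: sinh_real_less_iff)
    then show ?thesis by linarith
  qed
  have "weak_config p F0 F1 F2 \<subseteq> {0..B} \<times> {0..B} \<times> {0..R} \<times> {0..R} \<times> {0..R}"
  proof
    fix q assume "q \<in> weak_config p F0 F1 F2"
    then obtain x y r0 r1 r2 where q: "q = (x, y, r0, r1, r2)" "(x, y, r0, r1, r2) \<in> weak_config p F0 F1 F2"
      by (cases q) auto
    then have c: "centered (add_mset x (add_side p y F0)) r0" and u1: "uncentered x (add_side (\<not> p) y F1) r1"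
      and u2: "uncentered y F2 r2" and r: "r1 \<le> r0" "r2 \<le> r0" by (auto simp: weak_config_def split: if_splits)
    have y: "sinh (y / 2) < (\<Sum>d\<in>#F2. sinh (d / 2))" by (rule uncentered_side_bound[OF u2])
    have yB: "y \<le> B" using sh[OF y] B(2) by simp
    have x: "sinh (x / 2) < (\<Sum>d\<in>#add_side (\<not> p) y F1. sinh (d / 2))" by (rule uncentered_side_bound[OF u1])
    have xB: "x \<le> B"
    proof (cases p)
      case True
      then have "sinh (x / 2) < (\<Sum>d\<in>#F1. sinh (d / 2))" using x by (simp add: add_side_def)
      then show ?thesis using sh B(4) by fastforce
    next
      case False
      then have "sinh (x / 2) < S" using x y by (simp add: add_side_def S_def)
      then show ?thesis using sh B(3) by fastforce
    qed
    have "r0 \<le> R" by (rule R[OF _ _ c]) (use xB yB B(5) in \<open>auto simp: add_side_def\<close>)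
    then show "q \<in> {0..B} \<times> {0..B} \<times> {0..R} \<times> {0..R} \<times> {0..R}"
      using q(1) xB yB r uncenteredD(2,3)[OF u1] uncenteredD(2,3)[OF u2] by auto
  qed
  then show ?thesis by (rule bounded_subset[rotated]) (intro bounded_Times bounded_closed_interval)
qed

text \<open>The angle equations are continuous only where lengths are positive and at most a
  diameter, so they are imposed on a closed set \<open>D\<close> of such points. There
  \<open>x\<close> and \<open>y\<close> are positive because each is at least as long as some
  frontier side, which the size conditions provide.\<close>

lemma weak_config_closed:
  assumes pos: "\<And>d. d \<in># F0 + F1 + F2 \<Longrightarrow> 0 < d"
    and size: "2 \<le> size (add_side (\<not> p) 0 F1)" "2 \<le> size F2"
  shows "closed (weak_config p F0 F1 F2)"
proof -
  have ne: "F1 \<noteq> {#}" "F2 \<noteq> {#}" using size by (auto simp: add_side_def split: if_splits)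
  obtain f1 f2 where f: "f1 \<in># F1" "f2 \<in># F2" using ne by (meson multiset_nonemptyE)
  define X Y A B C where "X = (\<lambda>q :: configuration. fst q)" and "Y = (\<lambda>q :: configuration. fst (snd q))"
    and "A = (\<lambda>q :: configuration. fst (snd (snd q)))" and "B = (\<lambda>q :: configuration. fst (snd (snd (snd q))))"
    and "C = (\<lambda>q :: configuration. snd (snd (snd (snd q))))"
  note XY_defs = X_def Y_def A_def B_def C_def
  define D where "D = {q. (\<forall>d. d \<in># F0 \<longrightarrow> d / 2 \<le> A q) \<and> (\<forall>d. d \<in># F1 \<longrightarrow> d / 2 \<le> B q \<and> d \<le> X q) \<and>
     (\<forall>d. d \<in># F2 \<longrightarrow> d / 2 \<le> C q \<and> d \<le> Y q) \<and> X q / 2 \<le> A q \<and> X q / 2 \<le> B q \<and> Y q / 2 \<le> C q \<and>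
     (p \<longrightarrow> Y q / 2 \<le> A q) \<and> (\<not> p \<longrightarrow> Y q / 2 \<le> B q \<and> Y q \<le> X q) \<and> B q \<le> A q \<and>
     C q \<le> (if p then A q else B q)}"
  have cont: "continuous_on U X" "continuous_on U Y" "continuous_on U A" "continuous_on U B" "continuous_on U C" for U
    unfolding XY_defs by (intro continuous_intros)+
  have clD: "closed D" unfolding D_def
    by (intro closed_Collect_conj closed_Collect_all closed_Collect_imp closed_Collect_le open_Collect_const
        continuous_intros cont; (cases p; simp add: cont)?)
  have posD: "0 < X q" "0 < Y q" if "q \<in> D" for q
    using that f pos[of f1] pos[of f2] by (force simp: D_def)+
  define e0 e1 e2 where "e0 q = angle_sum (add_mset (X q) (add_side p (Y q) F0)) (A q)"
    and "e1 q = angle_sum (add_side (\<not> p) (Y q) F1) (B q) - half_angle (X q) (B q)"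
    and "e2 q = angle_sum F2 (C q) - half_angle (Y q) (C q)" for q
  have dom: "0 < X q \<and> X q / 2 \<le> A q" "0 < X q \<and> X q / 2 \<le> B q" "0 < Y q \<and> Y q / 2 \<le> C q"
    "p \<Longrightarrow> 0 < Y q \<and> Y q / 2 \<le> A q" "\<not> p \<Longrightarrow> 0 < Y q \<and> Y q / 2 \<le> B q"
    "d \<in># F0 \<Longrightarrow> 0 < d \<and> d / 2 \<le> A q" "d \<in># F1 \<Longrightarrow> 0 < d \<and> d / 2 \<le> B q" "d \<in># F2 \<Longrightarrow> 0 < d \<and> d / 2 \<le> C q"
    if "q \<in> D" for q d
    using that posD[OF that] pos[of d] by (auto simp: D_def)
  have half: "continuous_on D (\<lambda>q. half_angle (X q) (A q))" "continuous_on D (\<lambda>q. half_angle (X q) (B q))"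
    "continuous_on D (\<lambda>q. half_angle (Y q) (C q))" "p \<Longrightarrow> continuous_on D (\<lambda>q. half_angle (Y q) (A q))"
    "\<not> p \<Longrightarrow> continuous_on D (\<lambda>q. half_angle (Y q) (B q))" "continuous_on D (\<lambda>q. angle_sum F0 (A q))"
    "continuous_on D (\<lambda>q. angle_sum F1 (B q))" "continuous_on D (\<lambda>q. angle_sum F2 (C q))"
    by (intro continuous_on_half_angle continuous_on_angle_sum cont dom; assumption)+
  have "continuous_on D e0" "continuous_on D e1" "continuous_on D e2"
    unfolding e0_def[abs_def] e1_def[abs_def] e2_def[abs_def] add_side_def
    using half by (cases p; auto intro!: continuous_intros)+
  then have "closed {q \<in> D. e0 q = pi}" "closed {q \<in> D. e1 q = 0}" "closed {q \<in> D. e2 q = 0}"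
    by (simp_all add: continuous_closed_preimage_constant clD)
  then have "closed ({q \<in> D. e0 q = pi} \<inter> {q \<in> D. e1 q = 0} \<inter> {q \<in> D. e2 q = 0})" by (intro closed_Int)
  moreover have "weak_config p F0 F1 F2 = {q \<in> D. e0 q = pi} \<inter> {q \<in> D. e1 q = 0} \<inter> {q \<in> D. e2 q = 0}"
  proof (intro set_eqI iffI)
    fix q assume q: "q \<in> weak_config p F0 F1 F2"
    then have "centered (add_mset (X q) (add_side p (Y q) F0)) (A q)" "uncentered (X q) (add_side (\<not> p) (Y q) F1) (B q)"
      "uncentered (Y q) F2 (C q)" "B q \<le> A q" "C q \<le> (if p then A q else B q)"
      by (auto simp: weak_config_def XY_defs)
    then show "q \<in> {q \<in> D. e0 q = pi} \<inter> {q \<in> D. e1 q = 0} \<inter> {q \<in> D. e2 q = 0}"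
      by (cases p) (auto simp: D_def e0_def e1_def e2_def centered_def uncentered_def add_side_def)
  next
    fix q assume q: "q \<in> {q \<in> D. e0 q = pi} \<inter> {q \<in> D. e1 q = 0} \<inter> {q \<in> D. e2 q = 0}"
    then have D: "q \<in> D" by simp
    have "centered (add_mset (X q) (add_side p (Y q) F0)) (A q)"
      unfolding centered_def using q dom(1,4,6)[OF D] by (auto simp: e0_def add_side_def split: if_splits)
    moreover have "uncentered (X q) (add_side (\<not> p) (Y q) F1) (B q)"
      unfolding uncentered_def using q dom(2,5,7)[OF D] size(1)
      by (auto simp: e1_def add_side_def D_def split: if_splits)
    moreover have "uncentered (Y q) F2 (C q)"
      unfolding uncentered_def using q dom(3,8)[OF D] size(2) by (auto simp: e2_def D_def)
    moreover have "B q \<le> A q" "C q \<le> (if p then A q else B q)" using D by (auto simp: D_def)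
    ultimately show "q \<in> weak_config p F0 F1 F2" by (auto simp: weak_config_def XY_defs)
  qed
  ultimately show ?thesis by simp
qed

lemma weak_config_compact:
  assumes "\<And>d. d \<in># F0 + F1 + F2 \<Longrightarrow> 0 < d"
    and "2 \<le> size (add_side (\<not> p) 0 F1)" "2 \<le> size F2"
  shows "compact (weak_config p F0 F1 F2)"
  using weak_config_bounded weak_config_closed[OF assms] by (simp add: compact_eq_bounded_closed)

lemma continuous_on_config_angle: "continuous_on (weak_config p F0 F1 F2) (config_angle p F0 F1 F2)"
proof -
  let ?W = "weak_config p F0 F1 F2"
  define X Y A B C where "X = (\<lambda>q :: configuration. fst q)" and "Y = (\<lambda>q :: configuration. fst (snd q))"
    and "A = (\<lambda>q :: configuration. fst (snd (snd q)))" and "B = (\<lambda>q :: configuration. fst (snd (snd (snd q))))"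
    and "C = (\<lambda>q :: configuration. snd (snd (snd (snd q))))"
  note XY_defs = X_def Y_def A_def B_def C_def
  have cont: "continuous_on U X" "continuous_on U Y" "continuous_on U A" "continuous_on U B" "continuous_on U C" for U
    unfolding XY_defs by (intro continuous_intros)+
  have q: "centered (add_mset (X q) (add_side p (Y q) F0)) (A q)" "uncentered (X q) (add_side (\<not> p) (Y q) F1) (B q)"
      "uncentered (Y q) F2 (C q)" if "q \<in> ?W" for q
    using that by (auto simp: weak_config_def XY_defs)
  have dom: "0 < X q \<and> X q / 2 \<le> A q" "0 < X q \<and> X q / 2 \<le> B q" "0 < Y q \<and> Y q / 2 \<le> C q"
    "p \<Longrightarrow> 0 < Y q \<and> Y q / 2 \<le> A q" "\<not> p \<Longrightarrow> 0 < Y q \<and> Y q / 2 \<le> B q"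
    "d \<in># F0 \<Longrightarrow> 0 < d \<and> d / 2 \<le> A q" "d \<in># F1 \<Longrightarrow> 0 < d \<and> d / 2 \<le> B q" "d \<in># F2 \<Longrightarrow> 0 < d \<and> d / 2 \<le> C q"
    if "q \<in> ?W" for q d
    using q[OF that] uncenteredD(2,4)[OF q(2)[OF that]] uncenteredD(2,4)[OF q(3)[OF that]]
      uncenteredD(6,7)[OF q(2)[OF that], of d] uncenteredD(6,7)[OF q(3)[OF that], of d]
      uncenteredD(6,7)[OF q(2)[OF that], of "Y q"]
    by (auto simp: centered_def add_side_def)
  have base: "continuous_on ?W (\<lambda>q. base_angle (X q) (A q))" "continuous_on ?W (\<lambda>q. base_angle (X q) (B q))"
    "continuous_on ?W (\<lambda>q. base_angle (Y q) (C q))" "p \<Longrightarrow> continuous_on ?W (\<lambda>q. base_angle (Y q) (A q))"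
    "\<not> p \<Longrightarrow> continuous_on ?W (\<lambda>q. base_angle (Y q) (B q))" "continuous_on ?W (\<lambda>q. base_sum F0 (A q))"
    "continuous_on ?W (\<lambda>q. base_sum F1 (B q))" "continuous_on ?W (\<lambda>q. base_sum F2 (C q))"
    by (intro continuous_on_base_angle continuous_on_base_sum cont dom; assumption)+
  have "config_angle p F0 F1 F2 = (\<lambda>q. base_sum (add_mset (X q) (add_side p (Y q) F0)) (A q) +
     (base_sum (add_side (\<not> p) (Y q) F1) (B q) - base_angle (X q) (B q)) + (base_sum F2 (C q) - base_angle (Y q) (C q)))"
    by (auto simp: config_angle_def XY_defs fun_eq_iff)
  then show ?thesis using base by (cases p; auto simp: add_side_def intro!: continuous_intros)
qed

text \<open>Unless one of the alternatives holds, there is an edge whose far polygon does not have its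
  center on the boundary and whose shortening only puts strict radius inequalities at risk.\<close>

lemma config_angle_maximal:
  assumes q: "(x, y, r0, r1, r2) \<in> weak_config p F0 F1 F2"
    and max: "\<And>s. s \<in> strict_config p F0 F1 F2 \<Longrightarrow> config_angle p F0 F1 F2 s \<le> config_angle p F0 F1 F2 (x, y, r0, r1, r2)"
  shows "x / 2 = r1 \<and> y / 2 = r2 \<or> (\<exists>d\<in>#add_mset x (add_side p y F0). d / 2 = r0) \<or> r1 = r0 \<and> r2 = r0"
proof (rule ccontr)
  assume neg: "\<not> ?thesis"
  have c: "centered (add_mset x (add_side p y F0)) r0" and u1: "uncentered x (add_side (\<not> p) y F1) r1"
    and u2: "uncentered y F2 r2" and r: "r1 \<le> r0" "r2 \<le> (if p then r0 else r1)"
    using q by (auto simp: weak_config_def)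
  have strict: "d / 2 < r0" if "d \<in># add_mset x (add_side p y F0)" for d
    using c neg that by (auto simp: centered_def less_le)
  note v1 = uncenteredD[OF u1] and v2 = uncenteredD[OF u2]
  have move_x: False if x: "x / 2 < r1" and r2: "r2 < (if p then r0 else r1)"
  proof -
    \<comment> \<open>If the parent radius drops by less than its gap to \<open>r2\<close>, the
      strict inequality between them survives.\<close>
    define e where "e = (if p then r0 else r1) - r2"
    have "0 < e" using r2 by (simp add: e_def)
    then obtain x' r0' r1' where new: "centered (add_mset x' (add_side p y F0)) r0'"
      "\<forall>d\<in>#add_mset x' (add_side p y F0). d / 2 < r0'" "uncentered x' (add_side (\<not> p) y F1) r1'"
      "r1' < r0'" "r0 - e < r0'" "r1 - e < r1'"
      "base_sum (add_mset x (add_side p y F0)) r0 + base_sum (add_side (\<not> p) y F1) r1 - base_angle x r1 <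
       base_sum (add_mset x' (add_side p y F0)) r0' + base_sum (add_side (\<not> p) y F1) r1' - base_angle x' r1'"
      using shrink_centered_edge[OF c strict u1 x r(1)] by blast
    then have "(x', y, r0', r1', r2) \<in> strict_config p F0 F1 F2"
      using u2 by (auto simp: strict_config_def weak_config_def e_def)
    from max[OF this] new(7) show False by (simp add: config_angle_def)
  qed
  have move_y: False if y: "y / 2 < r2" and r1: "r1 < r0"
  proof (cases p)
    case True
    have cy: "centered (add_mset y (add_mset x F0)) r0" using c True by (simp add: add_side_def add_mset_commute)
    \<comment> \<open>The root radius drops by less than its gap to \<open>r1\<close>.\<close>
    have "0 < r0 - r1" using r1 by simp
    then obtain y' r0' r2' where new: "centered (add_mset y' (add_mset x F0)) r0'"
      "\<forall>d\<in>#add_mset y' (add_mset x F0). d / 2 < r0'" "uncentered y' F2 r2'"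
      "r2' < r0'" "r0 - (r0 - r1) < r0'"
      "base_sum (add_mset y (add_mset x F0)) r0 + base_sum F2 r2 - base_angle y r2 <
       base_sum (add_mset y' (add_mset x F0)) r0' + base_sum F2 r2' - base_angle y' r2'"
      using shrink_centered_edge[OF cy _ u2 y, of "r0 - r1"] strict r(2) True by (auto simp: add_side_def)
    then have "(x, y', r0', r1, r2') \<in> strict_config p F0 F1 F2"
      using u1 True by (auto simp: strict_config_def weak_config_def add_side_def add_mset_commute)
    from max[OF this] new(6) True show False by (simp add: config_angle_def add_side_def)
  next
    case False
    have uy: "uncentered x (add_mset y F1) r1" using u1 False by (simp add: add_side_def)
    \<comment> \<open>Now \<open>r1\<close> grows, by less than its gap to \<open>r0\<close>, and
      the root polygon is unchanged.\<close>
    have "0 < r0 - r1" using r1 by simp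
    then obtain y' r1' r2' where new: "uncentered x (add_mset y' F1) r1'" "uncentered y' F2 r2'"
      "r2' < r1'" "r1' < r1 + (r0 - r1)"
      "base_sum (add_mset y F1) r1 - base_angle x r1 + base_sum F2 r2 - base_angle y r2 <
       base_sum (add_mset y' F1) r1' - base_angle x r1' + base_sum F2 r2' - base_angle y' r2'"
      using shrink_uncentered_edge[OF uy u2 y, of "r0 - r1"] r(2) False by auto
    then have "(x, y', r0, r1', r2') \<in> strict_config p F0 F1 F2"
      using c strict False by (auto simp: strict_config_def weak_config_def add_side_def)
    from max[OF this] new(5) False show False by (simp add: config_angle_def add_side_def)
  qed
  \<comment> \<open>With equal radii, a diameter of the child circle would be one of the parent
    circle. At the root the negated second alternative excludes this; at the first vertex,
    \<open>y\<close> is shorter than the longest side \<open>x\<close>.\<close>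
  have x: "x / 2 < r1" if "r1 = r0" using strict[of x] that by simp
  have y: "y / 2 < r2" if "r2 = (if p then r0 else r1)"
  proof (cases p)
    case True
    then show ?thesis using strict[of y] that by (simp add: add_side_def)
  next
    case False
    then show ?thesis using v1(4) v1(7)[of y] that by (simp add: add_side_def)
  qed
  \<comment> \<open>If \<open>r2\<close> equals its parent radius, then \<open>r1 < r0\<close> since
    the third alternative fails, and the second edge can be shortened. Otherwise the first edge can,
    unless \<open>x\<close> is a diameter; then \<open>r1 < r0\<close>, and the second edge can,
    unless \<open>y\<close> is a diameter too, which is the first alternative.\<close>
  consider "r2 = (if p then r0 else r1)" | "r2 < (if p then r0 else r1)" using r by fastforce
  then show False
  proof cases
    case 1
    then have "r1 \<noteq> r0" using neg by (auto split: if_splits)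
    then show False using move_y[OF y[OF 1]] r(1) by simp
  next
    case 2
    then have x2: "\<not> x / 2 < r1" using move_x by blast
    then have "x / 2 = r1" "r1 < r0" using x v1(4) r(1) by (auto simp: less_le)
    moreover from this have "\<not> y / 2 < r2" using move_y by blast
    ultimately show False using neg v2(4) by auto
  qed
qed

section \<open>The minimum over the closure of the admissible space\<close>

lemma strict_subset_weak: "strict_config p F0 F1 F2 \<subseteq> weak_config p F0 F1 F2"
  by (auto simp: strict_config_def)

text \<open>The radii are projected away. One inclusion holds because the image of the compact
  \<open>closure S\<close> is closed, the other because a continuous map sends a closure into the
  closure of the image. Compactness prevents radii from escaping while lengths converge.\<close>

lemma closure_of_parametrized:
  fixes S :: "(real \<times> real \<times> 'c::t2_space) set"
  assumes E: "E = {e1, e2}" "e1 \<noteq> e2" and comp: "compact (closure S)"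
    and A: "A = {f \<in> E \<rightarrow>\<^sub>E UNIV. \<exists>s. (f e1, f e2, s) \<in> S}"
  shows "powertop_real E closure_of A = {f \<in> E \<rightarrow>\<^sub>E UNIV. \<exists>s. (f e1, f e2, s) \<in> closure S}"
proof
  define pr where "pr q = (fst q, fst (snd q))" for q :: "real \<times> real \<times> 'c"
  have mem: "(a, b) \<in> pr ` C \<longleftrightarrow> (\<exists>s. (a, b, s) \<in> C)" for a b C
    by (force simp: pr_def image_iff)
  have "continuous_on (closure S) pr" unfolding pr_def by (intro continuous_intros)
  then have cl: "closed (pr ` closure S)" by (intro compact_imp_closed compact_continuous_image comp)
  have "continuous_map (powertop_real E) (prod_topology euclideanreal euclideanreal) (\<lambda>f. (f e1, f e2))"
    using continuous_map_product_projection[of _ E "\<lambda>_. euclideanreal"] E(1) by (intro continuous_map_pairedI) auto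
  then have "closedin (powertop_real E) {f \<in> topspace (powertop_real E). (f e1, f e2) \<in> pr ` closure S}"
    using cl by (intro closedin_continuous_map_preimage) auto
  moreover have "A \<subseteq> {f \<in> topspace (powertop_real E). (f e1, f e2) \<in> pr ` closure S}"
    using closure_subset[of S] unfolding A mem by auto
  ultimately have "powertop_real E closure_of A \<subseteq> {f \<in> topspace (powertop_real E). (f e1, f e2) \<in> pr ` closure S}"
    by (rule closure_of_minimal[rotated])
  then show "powertop_real E closure_of A \<subseteq> {f \<in> E \<rightarrow>\<^sub>E UNIV. \<exists>s. (f e1, f e2, s) \<in> closure S}"
    unfolding mem by auto
next
  define g where "g q = (\<lambda>e\<in>E. if e = e1 then fst q else fst (snd q))" for q :: "real \<times> real \<times> 'c"
  have "continuous_map euclidean (powertop_real E) g"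
    unfolding continuous_map_componentwise
  proof (intro conjI ballI)
    show "g ` topspace euclidean \<subseteq> extensional E" by (auto simp: g_def)
    fix e assume "e \<in> E"
    then have "(\<lambda>q. g q e) = (\<lambda>q. if e = e1 then fst q else fst (snd q))" by (simp add: g_def)
    then show "continuous_map euclidean euclideanreal (\<lambda>q. g q e)"
      by (simp add: continuous_on_fst continuous_on_snd continuous_on_id)
  qed
  then have sub: "g ` (euclidean closure_of S) \<subseteq> powertop_real E closure_of (g ` S)"
    by (rule continuous_map_image_closure_subset)
  have "g ` S \<subseteq> A" unfolding A g_def using E by auto
  then have sub2: "powertop_real E closure_of (g ` S) \<subseteq> powertop_real E closure_of A" by (rule closure_of_mono)
  show "{f \<in> E \<rightarrow>\<^sub>E UNIV. \<exists>s. (f e1, f e2, s) \<in> closure S} \<subseteq> powertop_real E closure_of A"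
  proof clarify
    fix f s assume f: "f \<in> E \<rightarrow>\<^sub>E UNIV" and s: "(f e1, f e2, s) \<in> closure S"
    have "f = g (f e1, f e2, s)" using f E by (auto simp: g_def PiE_iff extensional_def fun_eq_iff)
    moreover have "g (f e1, f e2, s) \<in> powertop_real E closure_of A"
      using s sub sub2 unfolding euclidean_closure_of by blast
    ultimately show "f \<in> powertop_real E closure_of A" by simp
  qed
qed

lemma centered_tuple:
  assumes "centered M r" "mset ds = M" "3 \<le> length ds"
  shows "cyc_radius ds = r" "D_poly R ds = (real (length ds) - 2) * pi - 2 * cosh R * base_sum M r"
  using represented_polygon_data[of ds r "base_sum M r"] assms by (auto simp: polygon_data_def)

lemma uncentered_tuple:
  assumes "uncentered x M r" "mset ds = add_mset x M"
  shows "cyc_radius ds = r"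
    "D_poly R ds = (real (length ds) - 2) * pi - 2 * cosh R * (base_sum M r - base_angle x r)"
proof -
  have "size (mset ds) = size (add_mset x M)" using assms(2) by (rule arg_cong)
  then have "3 \<le> length ds" using uncenteredD(8)[OF assms(1)] by simp
  moreover have "polygon_data (mset ds) r (base_sum M r - base_angle x r)"
    using assms unfolding polygon_data_def by blast
  ultimately show "cyc_radius ds = r"
    "D_poly R ds = (real (length ds) - 2) * pi - 2 * cosh R * (base_sum M r - base_angle x r)"
    using represented_polygon_data by auto
qed

theorem proposition5p10:
  fixes V T :: "('v, 'e) graph"
    and vT :: 'v
    and cyc :: "'v \<Rightarrow> 'e list"
    and dF :: "'e \<Rightarrow> real"
    and R :: real
  assumes "finite_graph V"
    and "\<forall>v\<in>verts V. valence V v \<ge> 3"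
    and "cyclic_orders V cyc"
    and "subgraph T V" and "tree T" and "card (edges T) = 2" and "vT \<in> verts T"
    and "\<forall>e\<in>fst ` tree_frontier V T. dF e > 0"
    and "Ad V T vT cyc dF \<noteq> {}"
    and "R \<ge> 0"
  shows "\<exists>dE\<in>Ad_closure V T vT cyc dF. let d = combine T dE dF in
    (\<forall>dE'\<in>Ad_closure V T vT cyc dF. D_tree R T cyc d \<le> D_tree R T cyc (combine T dE' dF)) \<and>
    ((\<forall>v\<in>verts T - {vT}. P_tuple cyc d v \<in> BC_tilde (valence V v)) \<or>
     P_tuple cyc d vT \<in> BC_tilde (valence V vT) \<or>
     (\<forall>v\<in>verts T - {vT}. cyc_radius (P_tuple cyc d v) = cyc_radius (P_tuple cyc d vT)))"
proof -
  have finT: "finite_graph T" using assms(4) by (simp add: subgraph_def)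
  obtain e1 e2 v1 v2 p where E: "edges T = {e1, e2}" "e1 \<noteq> e2"
    and Vs: "verts T = {vT, v1, v2}" "vT \<noteq> v1" "vT \<noteq> v2" "v1 \<noteq> v2"
    and ends: "ends T e1 = {#vT, v1#}" "ends T e2 = {#if p then vT else v1, v2#}"
    using two_edge_tree[OF finT assms(5-7)] by metis
  note fe = first_edge_eq[OF E Vs ends] and ch = children_eq[OF E Vs ends]
  define F where "F v = frontier_lengths T cyc dF v" for v
  define P where "P dE v = P_tuple cyc (combine T dE dF) v" for dE v
  have vV: "v \<in> verts V" if "v \<in> verts T" for v using assms(4) that by (auto simp: subgraph_def)
  have val: "3 \<le> valence V v" "length (P dE v) = valence V v" if "v \<in> verts T" for v dE
    using assms(2) vV[OF that] length_cyc[OF assms(1,3) vV[OF that]] by (auto simp: P_def P_tuple_def)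
  have tuple: "mset (P dE vT) = add_mset (dE e1) (add_side p (dE e2) (F vT))"
    "mset (P dE v1) = add_mset (dE e1) (add_side (\<not> p) (dE e2) (F v1))"
    "mset (P dE v2) = add_mset (dE e2) (F v2)" for dE
    using mset_P_tuple(1)[OF assms(3,4) _ refl, of _ dE dF] Vs E ends
    by (auto simp: P_def F_def add_side_def numeral_2_eq_2)
  have pos: "0 < d" if "d \<in># F vT + F v1 + F v2" for d
    using that frontier_lengths_pos[OF assms(3,4) _ assms(8)] Vs(1) by (auto simp: F_def)
  have size: "2 \<le> size (add_side (\<not> p) 0 (F v1))" "2 \<le> size (F v2)"
  proof -
    \<comment> \<open>Sizes do not depend on the lengths, so zero lengths serve for counting;
      valence at least three leaves two sides besides the longest.\<close>
    have "size (mset (P (\<lambda>_. 0) v1)) = valence V v1" "size (mset (P (\<lambda>_. 0) v2)) = valence V v2"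
      using val Vs(1) by auto
    then show "2 \<le> size (add_side (\<not> p) 0 (F v1))" "2 \<le> size (F v2)"
      unfolding tuple using val(1)[of v1] val(1)[of v2] Vs(1) by auto
  qed
  define W S \<Phi> where "W = weak_config p (F vT) (F v1) (F v2)"
    and "S = strict_config p (F vT) (F v1) (F v2)" and "\<Phi> = config_angle p (F vT) (F v1) (F v2)"
  have compW: "compact W" unfolding W_def by (rule weak_config_compact[OF pos size])
  have SW: "S \<subseteq> W" by (simp add: S_def W_def strict_subset_weak)
  have clS: "closure S \<subseteq> W" using SW compW by (intro closure_minimal compact_imp_closed)
  have compS: "compact (closure S)" using compW SW by (meson bounded_subset compact_closure compact_imp_bounded)
  \<comment> \<open>Points of \<open>W\<close> carry the actual radii of the polygons, so
    \<open>D_tree\<close> is a constant minus a positive multiple of \<open>\<Phi>\<close>.\<close>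
  have radii: "cyc_radius (P dE vT) = r0" "cyc_radius (P dE v1) = r1" "cyc_radius (P dE v2) = r2"
    and D: "D_tree R T cyc (combine T dE dF) =
      (\<Sum>v\<in>verts T. (real (valence V v) - 2) * pi) - 2 * cosh R * \<Phi> (dE e1, dE e2, r0, r1, r2)"
    and weak: "centered (mset (P dE vT)) r0" "uncentered (dE e1) (add_side (\<not> p) (dE e2) (F v1)) r1"
      "uncentered (dE e2) (F v2) r2"
    if "(dE e1, dE e2, r0, r1, r2) \<in> W" for dE r0 r1 r2
  proof -
    show c: "centered (mset (P dE vT)) r0" "uncentered (dE e1) (add_side (\<not> p) (dE e2) (F v1)) r1"
      "uncentered (dE e2) (F v2) r2"
      using that by (auto simp: W_def weak_config_def tuple)
    have "3 \<le> length (P dE vT)" using val assms(7) by simp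
    note t0 = centered_tuple[OF c(1) refl this] and t1 = uncentered_tuple[OF c(2) tuple(2)[of dE]]
      and t2 = uncentered_tuple[OF c(3) tuple(3)[of dE]]
    show "cyc_radius (P dE vT) = r0" "cyc_radius (P dE v1) = r1" "cyc_radius (P dE v2) = r2"
      using t0 t1 t2 by auto
    show "D_tree R T cyc (combine T dE dF) =
      (\<Sum>v\<in>verts T. (real (valence V v) - 2) * pi) - 2 * cosh R * \<Phi> (dE e1, dE e2, r0, r1, r2)"
      using Vs val by (simp add: D_tree_def t0 t1 t2 \<Phi>_def config_angle_def algebra_simps tuple flip: P_def)
  qed
  have Ad: "Ad V T vT cyc dF = {dE \<in> edges T \<rightarrow>\<^sub>E UNIV. \<exists>s. (dE e1, dE e2, s) \<in> S}"
  proof -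
    have "dE \<in> Ad V T vT cyc dF \<longleftrightarrow> (\<exists>s. (dE e1, dE e2, s) \<in> S)" if ext: "dE \<in> edges T \<rightarrow>\<^sub>E UNIV" for dE
    proof -
      have comb: "combine T dE dF e1 = dE e1" "combine T dE dF e2 = dE e2" using E by (auto simp: combine_def)
      have Ad_iff: "dE \<in> Ad V T vT cyc dF \<longleftrightarrow>
        P dE v1 \<in> AC_tilde (valence V v1) - C_tilde (valence V v1) \<and> Max (set (P dE v1)) = dE e1 \<and>
        P dE v2 \<in> AC_tilde (valence V v2) - C_tilde (valence V v2) \<and> Max (set (P dE v2)) = dE e2 \<and>
        P dE vT \<in> C_tilde (valence V vT) \<and> cyc_radius (P dE v1) < cyc_radius (P dE vT) \<and>
        cyc_radius (P dE v2) < cyc_radius (P dE (if p then vT else v1))"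
        using ext Vs by (auto simp: Ad_def Let_def fe ch comb P_def split: if_splits)
      show ?thesis
      proof
        assume "dE \<in> Ad V T vT cyc dF"
        note A = this[unfolded Ad_iff]
        obtain r0 where r0: "centered (mset (P dE vT)) r0" "\<forall>d\<in>set (P dE vT). d / 2 < r0"
          using C_tilde_imp_centered A by blast
        obtain r1 where r1: "uncentered (dE e1) (add_side (\<not> p) (dE e2) (F v1)) r1"
          using AC_tilde_imp_uncentered[OF _ _ _ tuple(2)[of dE]] A val(1) Vs(1) by blast
        obtain r2 where r2: "uncentered (dE e2) (F v2) r2"
          using AC_tilde_imp_uncentered[OF _ _ _ tuple(3)[of dE]] A val(1) Vs(1) by blast
        have "3 \<le> length (P dE vT)" using val assms(7) by simp
        then have "cyc_radius (P dE vT) = r0" "cyc_radius (P dE v1) = r1" "cyc_radius (P dE v2) = r2"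
          using centered_tuple(1)[OF r0(1) refl] uncentered_tuple(1)[OF r1 tuple(2)[of dE]]
            uncentered_tuple(1)[OF r2 tuple(3)[of dE]] by auto
        then have "r1 < r0" "r2 < (if p then r0 else r1)" using A by (auto split: if_splits)
        moreover have "\<forall>d\<in>#mset (P dE vT). d / 2 < r0" using r0(2) by simp
        ultimately have "(dE e1, dE e2, r0, r1, r2) \<in> S"
          using r0(1) r1 r2 unfolding S_def strict_config_def weak_config_def tuple by (auto split: if_splits)
        then show "\<exists>s. (dE e1, dE e2, s) \<in> S" by blast
      next
        assume "\<exists>s. (dE e1, dE e2, s) \<in> S"
        then obtain r0 r1 r2 where s: "(dE e1, dE e2, r0, r1, r2) \<in> S" by (metis surj_pair)
        then have w: "(dE e1, dE e2, r0, r1, r2) \<in> W" using SW by blast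
        have strict: "\<forall>d\<in>#mset (P dE vT). d / 2 < r0" "r1 < r0" "r2 < (if p then r0 else r1)"
          using s by (auto simp: S_def strict_config_def tuple)
        have "P dE vT \<in> C_tilde (valence V vT)"
          by (rule centered_imp_C_tilde[OF weak(1)[OF w]]) (use strict(1) val(2) assms(7) in auto)
        moreover have "P dE v1 \<in> AC_tilde (valence V v1) - C_tilde (valence V v1)"
          by (rule uncentered_imp_AC_tilde[OF weak(2)[OF w] tuple(2)[of dE]]) (use val Vs in auto)
        moreover have "P dE v2 \<in> AC_tilde (valence V v2) - C_tilde (valence V v2)"
          by (rule uncentered_imp_AC_tilde[OF weak(3)[OF w] tuple(3)[of dE]]) (use val Vs in auto)
        moreover have "Max (set (P dE v1)) = dE e1" by (rule uncentered_Max[OF weak(2)[OF w] tuple(2)[of dE]])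
        moreover have "Max (set (P dE v2)) = dE e2" by (rule uncentered_Max[OF weak(3)[OF w] tuple(3)[of dE]])
        ultimately show "dE \<in> Ad V T vT cyc dF"
          unfolding Ad_iff using radii[OF w] strict by (auto split: if_splits)
      qed
    qed
    then show ?thesis by (auto simp: Ad_def)
  qed
  have clAd: "Ad_closure V T vT cyc dF = {dE \<in> edges T \<rightarrow>\<^sub>E UNIV. \<exists>s. (dE e1, dE e2, s) \<in> closure S}"
    unfolding Ad_closure_def by (rule closure_of_parametrized[OF E compS Ad])
  have "S \<noteq> {}" using assms(9) Ad by auto
  then have "closure S \<noteq> {}" by simp
  moreover have "continuous_on (closure S) \<Phi>"
    unfolding \<Phi>_def by (rule continuous_on_subset[OF continuous_on_config_angle]) (use clS in \<open>simp add: W_def\<close>)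
  \<comment> \<open>The maximum is taken over \<open>closure S\<close> rather than \<open>W\<close>,
    because precisely its lengths make up \<open>Ad_closure\<close>. The maximality needed later
    compares with points of \<open>S\<close> only.\<close>
  ultimately obtain q where q: "q \<in> closure S" and max: "\<And>s. s \<in> closure S \<Longrightarrow> \<Phi> s \<le> \<Phi> q"
    using continuous_attains_sup[OF compS] by blast
  obtain x y r0 r1 r2 where qq: "q = (x, y, r0, r1, r2)" by (cases q) auto
  define dE where "dE = (\<lambda>e\<in>edges T. if e = e1 then x else y)"
  have dE: "dE e1 = x" "dE e2 = y" "dE \<in> edges T \<rightarrow>\<^sub>E UNIV" using E by (auto simp: dE_def)
  have w: "(dE e1, dE e2, r0, r1, r2) \<in> W" using q clS qq dE by auto
  have "D_tree R T cyc (combine T dE dF) \<le> D_tree R T cyc (combine T dE' dF)"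
    if dE': "dE' \<in> Ad_closure V T vT cyc dF" for dE'
  proof -
    obtain s0 s1 s2 where s: "(dE' e1, dE' e2, s0, s1, s2) \<in> closure S"
      using dE' unfolding clAd by auto
    then have "\<Phi> (dE' e1, dE' e2, s0, s1, s2) \<le> \<Phi> (dE e1, dE e2, r0, r1, r2)" using max qq dE by simp
    then show ?thesis using D[OF w] D[of dE' s0 s1 s2] s clS by auto
  qed
  moreover have "x / 2 = r1 \<and> y / 2 = r2 \<or> (\<exists>d\<in>#mset (P dE vT). d / 2 = r0) \<or> r1 = r0 \<and> r2 = r0"
    unfolding tuple dE
    by (rule config_angle_maximal) (use w max closure_subset[of S] in \<open>auto simp: W_def S_def \<Phi>_def dE qq\<close>)
  then have "(\<forall>v\<in>verts T - {vT}. P dE v \<in> BC_tilde (valence V v)) \<or> P dE vT \<in> BC_tilde (valence V vT) \<or>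
     (\<forall>v\<in>verts T - {vT}. cyc_radius (P dE v) = cyc_radius (P dE vT))"
  proof (elim disjE)
    assume xy: "x / 2 = r1 \<and> y / 2 = r2"
    have "P dE v1 \<in> BC_tilde (valence V v1)"
      by (rule uncentered_imp_BC_tilde[OF weak(2)[OF w] tuple(2)[of dE]]) (use xy dE val Vs in auto)
    moreover have "P dE v2 \<in> BC_tilde (valence V v2)"
      by (rule uncentered_imp_BC_tilde[OF weak(3)[OF w] tuple(3)[of dE]]) (use xy dE val Vs in auto)
    ultimately show ?thesis using Vs by auto
  next
    assume "\<exists>d\<in>#mset (P dE vT). d / 2 = r0"
    then have "P dE vT \<in> BC_tilde (valence V vT)"
      using centered_imp_BC_tilde[OF weak(1)[OF w]] val(2) assms(7) by auto
    then show ?thesis by blast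
  next
    assume "r1 = r0 \<and> r2 = r0"
    then show ?thesis using radii[OF w] Vs by auto
  qed
  moreover have "dE \<in> Ad_closure V T vT cyc dF" unfolding clAd using dE q qq by auto
  ultimately show ?thesis unfolding P_def Let_def by blast
qed

end
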